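(* Consider the Markov chain $X^S=(Q^S,LI^S)$ on the state space $\mathcal A$ describing the parallel-server system under the PI-Split policy (Persistent-Idle with batch splitting) with batch arrivals and random service capacities. Assume $\lambda<\sum_{i=1}^n\mu_i$. Then: (i) $X^S$ is positive recurrent. Consequently, (ii) $X^S$ has a unique stationary distribution, denoted by $\pi^S_X$, and (iii) for any initial state $\alpha\in\mathcal A$ and any $B\subset\mathcal A$, $\mathbb P_\alpha(X^S(t)\in B)\to\pi^S_X(B)$ as $t\to\infty$.
   Context: **Primitives.** There are $n$ servers; $[n]=\{1,\dots,n\}$, $\mathbb N=\{0,1,2,\dots\}$, $[x]^+=\max\{x,0\}$, and $v[i]$ is the $i$th entry of a vector $v\in\mathbb N^n$. The arrivals $\{a(t)\}_{t\ge1}$ are i.i.d. $\mathbb N$-valued random variables with $\mathbb P(a(1)=0)>0$, finite mean $\lambda$ and finite standard deviation $\sigma_a$. For each $i\in[n]$, the service capacities $\{s_i(t)\}_{t\ge1}$ are i.i.d. integer-valued random variables with $1\le s_i(t)\le s_{max}$ for a constant $s_{max}\in\mathbb N$, and with mean $\mu_i$ and standard deviation $\sigma_{s_i}$. $\{B(t)\}_{t\ge1}$ is an i.i.d. real-valued process. The sequences $\{a(t)\},\{s_1(t)\},\dots,\{s_n(t)\},\{B(t)\}$ are mutually independent and independent of the initial condition $X^S(0)$. **Splitting rule.** $f:\mathbb N^n\times\mathbb N\times\mathbb R\to\mathbb N^n$ is any fixed deterministic (measurable) function satisfying $$\sum_{i=1}^n f(\alpha_1,\dots,\alpha_n,a,b)[i]=a,\qquad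 f(\alpha_1,\dots,\alpha_n,a,b)[i]=0\ \text{ if }\min_{1\le j\le n}\alpha_j=0\text{ and }\alpha_i>0.$$ **Chain.** $X^S(t)=(Q^S(t),LI^S(t))$ with $Q^S(t)=(Q^S_1(t),\dots,Q^S_n(t))\in\mathbb N^n$ (queue lengths at the end of slot $t$) and $LI^S(t)\in[n]$ (Last-Idle server). Let $I^S(t)=\{i:Q^S_i(t)=0\}$. For $t>0$, $$Q^S_i(t)=[Q^S_i(t-1)+a_i(t)-s_i(t)]^+,\qquad LI^S(t)=\begin{cases}LI^S(t-1),&|I^S(t-1)|=0,\\ \xi^S_t,&\text{otherwise,}\end{cases}$$ $$a_i(t)=\begin{cases}a(t),&|I^S(t-1)|=0\text{ and }i=LI^S(t),\\ f(Q^S(t-1),a(t),B(t))[i],&|I^S(t-1)|>0\text{ and }i\in I^S(t-1),\\ 0,&\text{otherwise,}\end{cases}$$ where the conditional distribution of $\xi^S_t$ given $(X^S(0),\dots,X^S(t-1),a(t),s_1(t),\dots,s_n(t),B(t))$ is uniform on $I^S(t-1)$ on the event $\{|I^S(t-1)|>0\}$, and $\xi^S_t=1$ on $\{|I^S(t-1)|=0\}$. For each $t\ge1$, $(a(t),s_1(t),\dots,s_n(t),B(t))$ is independent of $X^S(0)$, $(a(u),s_1(u),\dots,s_n(u),B(u))_{u<t}$ and $(\xi^S_u)_{u\le t}$ jointly. **State space.** $\mathcal A\subset\mathbb N^n\times[n]$ is the set of all states $\alpha=(\alpha_1,\dots,\alpha_n,l)$ that can be reached with positive probability by this chain from any of the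 states $(0,\dots,0,i)$, $i\in[n]$. It is assumed that $X^S(0)\in\mathcal A$ almost surely; then $X^S$ is an irreducible, aperiodic, time-homogeneous Markov chain on $\mathcal A$. $\mathbb P_\alpha(\cdot)=\mathbb P(\cdot\mid X^S(0)=\alpha)$. *)

theory Defs
  imports "HOL-Probability.Probability"
begin

text \<open>
  The servers are the elements of a finite type \<open>'n\<close>, so \<open>n = CARD('n)\<close>. Time slots are
  numbered from 1; the values at 0 of the driving sequences \<open>a\<close>, \<open>s i\<close>, \<open>B\<close>, \<open>\<xi>\<close> are irrelevant.
\<close>

type_synonym 'n state = "('n \<Rightarrow> nat) \<times> 'n"

definition idle :: "('n \<Rightarrow> nat) \<Rightarrow> 'n set" where
  "idle q = {i. q i = 0}"

definition splitting_rule :: "(('n::finite \<Rightarrow> nat) \<Rightarrow> nat \<Rightarrow> real \<Rightarrow> ('n \<Rightarrow> nat)) \<Rightarrow> bool" where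
  "splitting_rule f \<longleftrightarrow>
     (\<lambda>(q, k, b). f q k b) \<in>
        measurable (count_space UNIV \<Otimes>\<^sub>M count_space UNIV \<Otimes>\<^sub>M borel) (count_space UNIV) \<and>
     (\<forall>q k b. (\<Sum>i\<in>UNIV. f q k b i) = k) \<and>
     (\<forall>q k b i. Min (range q) = 0 \<and> q i > 0 \<longrightarrow> f q k b i = 0)"

text \<open>
  Number of jobs sent to server \<open>i\<close> in a slot that starts with queues \<open>q\<close>, has batch size \<open>k\<close>
  and splitting variable \<open>b\<close>, and whose Last-Idle server (after the update of that slot) is \<open>l\<close>.
\<close>
definition routed ::
  "(('n \<Rightarrow> nat) \<Rightarrow> nat \<Rightarrow> real \<Rightarrow> ('n \<Rightarrow> nat)) \<Rightarrow> ('n \<Rightarrow> nat) \<Rightarrow> 'n \<Rightarrow> nat \<Rightarrow> real \<Rightarrow> 'n \<Rightarrow> nat" where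
  "routed f q l k b i =
     (if idle q = {} \<and> i = l then k
      else if idle q \<noteq> {} \<and> i \<in> idle q then f q k b i
      else 0)"

definition slot ::
  "(nat \<Rightarrow> 'w \<Rightarrow> nat) \<Rightarrow> ('n \<Rightarrow> nat \<Rightarrow> 'w \<Rightarrow> nat) \<Rightarrow> (nat \<Rightarrow> 'w \<Rightarrow> real) \<Rightarrow>
   nat \<Rightarrow> 'w \<Rightarrow> nat \<times> ('n \<Rightarrow> nat) \<times> real" where
  "slot a s B t \<omega> = (a t \<omega>, (\<lambda>i. s i t \<omega>), B t \<omega>)"

definition slot_space :: "(nat \<times> ('n::finite \<Rightarrow> nat) \<times> real) measure" where
  "slot_space = count_space UNIV \<Otimes>\<^sub>M count_space UNIV \<Otimes>\<^sub>M borel"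

text \<open>The mutually independent sources of randomness: \<open>X(0)\<close> and the driving sequences.\<close>
datatype 'n source = Initial | Arrivals | Services 'n | Splitting

text \<open>
  A version of the chain on a probability space \<open>M\<close>, driven by \<open>a\<close>, \<open>s\<close>, \<open>B\<close> with the given
  one-slot laws. The server \<open>first\<close> is the one called 1, which serves as the value of \<open>\<xi>\<close> when no
  server is idle. The sigma-algebra generated by a random element \<open>Y\<close> with values in \<open>N\<close> is
  \<open>vimage_algebra (space M) Y N\<close>.
\<close>
locale pi_split_chain = prob_space M
  for M :: "'w measure"
    and arr_law :: "nat pmf" and srv_law :: "'n::finite \<Rightarrow> nat pmf" and spl_law :: "real measure"
    and f :: "('n \<Rightarrow> nat) \<Rightarrow> nat \<Rightarrow> real \<Rightarrow> ('n \<Rightarrow> nat)"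
    and first :: 'n
    and a :: "nat \<Rightarrow> 'w \<Rightarrow> nat" and s :: "'n \<Rightarrow> nat \<Rightarrow> 'w \<Rightarrow> nat" and B :: "nat \<Rightarrow> 'w \<Rightarrow> real"
    and \<xi> :: "nat \<Rightarrow> 'w \<Rightarrow> 'n"
    and Q :: "nat \<Rightarrow> 'w \<Rightarrow> 'n \<Rightarrow> nat" and LI :: "nat \<Rightarrow> 'w \<Rightarrow> 'n" +
  assumes initial_measurable: "(\<lambda>\<omega>. (Q 0 \<omega>, LI 0 \<omega>)) \<in> measurable M (count_space UNIV)"
    and arrivals_iid:
      "indep_vars (\<lambda>_. count_space UNIV) a {1..}"
      "\<And>t. t \<ge> 1 \<Longrightarrow> distr M (count_space UNIV) (a t) = measure_pmf arr_law"
    and services_iid: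
      "\<And>i. indep_vars (\<lambda>_. count_space UNIV) (s i) {1..}"
      "\<And>i t. t \<ge> 1 \<Longrightarrow> distr M (count_space UNIV) (s i t) = measure_pmf (srv_law i)"
    and splitting_iid:
      "indep_vars (\<lambda>_. borel) B {1..}"
      "\<And>t. t \<ge> 1 \<Longrightarrow> distr M borel (B t) = spl_law"
    and sources_independent:
      "indep_sets (\<lambda>k. case k of
           Initial \<Rightarrow> sets (vimage_algebra (space M) (\<lambda>\<omega>. (Q 0 \<omega>, LI 0 \<omega>)) (count_space UNIV))
         | Arrivals \<Rightarrow> sets (vimage_algebra (space M) (\<lambda>\<omega>. \<lambda>t\<in>{1..}. a t \<omega>)
                                (PiM {1..} (\<lambda>_. count_space UNIV)))
         | Services i \<Rightarrow> sets (vimage_algebra (space M) (\<lambda>\<omega>. \<lambda>t\<in>{1..}. s i t \<omega>)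
                                (PiM {1..} (\<lambda>_. count_space UNIV)))
         | Splitting \<Rightarrow> sets (vimage_algebra (space M) (\<lambda>\<omega>. \<lambda>t\<in>{1..}. B t \<omega>)
                                (PiM {1..} (\<lambda>_. borel)))) UNIV"
    and LI_step:
      "\<And>t \<omega>. t \<ge> 1 \<Longrightarrow> \<omega> \<in> space M \<Longrightarrow>
         LI t \<omega> = (if card (idle (Q (t - 1) \<omega>)) = 0 then LI (t - 1) \<omega> else \<xi> t \<omega>)"
    and Q_step: \<comment> \<open>truncated subtraction on \<open>nat\<close> is the positive part\<close>
      "\<And>t \<omega> i. t \<ge> 1 \<Longrightarrow> \<omega> \<in> space M \<Longrightarrow>
         Q t \<omega> i = Q (t - 1) \<omega> i + routed f (Q (t - 1) \<omega>) (LI t \<omega>) (a t \<omega>) (B t \<omega>) i - s i t \<omega>"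
    and \<xi>_measurable: "\<And>t. t \<ge> 1 \<Longrightarrow> \<xi> t \<in> measurable M (count_space UNIV)"
    and \<xi>_uniform:
      "\<And>t i. t \<ge> 1 \<Longrightarrow> AE \<omega> in M. idle (Q (t - 1) \<omega>) \<noteq> {} \<longrightarrow>
         real_cond_exp M
           (vimage_algebra (space M)
             (\<lambda>\<omega>'. (\<lambda>u\<in>{..<t}. (Q u \<omega>', LI u \<omega>'), slot a s B t \<omega>'))
             (PiM {..<t} (\<lambda>_. count_space UNIV) \<Otimes>\<^sub>M slot_space))
           (\<lambda>\<omega>'. if \<xi> t \<omega>' = i then 1 else 0) \<omega>
         = pmf (pmf_of_set (idle (Q (t - 1) \<omega>))) i"
    and \<xi>_default:
      "\<And>t \<omega>. t \<ge> 1 \<Longrightarrow> \<omega> \<in> space M \<Longrightarrow> idle (Q (t - 1) \<omega>) = {} \<Longrightarrow> \<xi> t \<omega> = first"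
    and slot_independent_past:
      "\<And>t. t \<ge> 1 \<Longrightarrow> indep_set
         (sets (vimage_algebra (space M) (slot a s B t) slot_space))
         (sets (vimage_algebra (space M)
            (\<lambda>\<omega>. ((Q 0 \<omega>, LI 0 \<omega>), \<lambda>u\<in>{1..<t}. slot a s B u \<omega>, \<lambda>u\<in>{1..t}. \<xi> u \<omega>))
            (count_space UNIV \<Otimes>\<^sub>M PiM {1..<t} (\<lambda>_. slot_space)
               \<Otimes>\<^sub>M PiM {1..t} (\<lambda>_. count_space UNIV))))"

text \<open>
  Below, \<open>P \<alpha>\<close> plays the role of \<open>\<P>(\<cdot> | X(0) = \<alpha>)\<close> for a process \<open>X\<close>.
  Stationarity and positive recurrence are relative to a closed set \<open>S\<close> of states.
\<close>

definition prob_at :: "('x \<Rightarrow> 'w measure) \<Rightarrow> (nat \<Rightarrow> 'w \<Rightarrow> 'x) \<Rightarrow> 'x \<Rightarrow> nat \<Rightarrow> 'x set \<Rightarrow> real" where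
  "prob_at P X \<alpha> t C = measure (P \<alpha>) {\<omega> \<in> space (P \<alpha>). X t \<omega> \<in> C}"

definition reachable_states ::
  "('n state \<Rightarrow> 'w measure) \<Rightarrow> (nat \<Rightarrow> 'w \<Rightarrow> 'n state) \<Rightarrow> 'n state set" where
  "reachable_states P X = {\<beta>. \<exists>i t. prob_at P X ((\<lambda>_. 0), i) t {\<beta>} > 0}"

text \<open>The infimum of the empty set is infinity: \<open>X\<close> may fail to visit \<open>\<alpha>\<close>.\<close>
definition hitting_time :: "(nat \<Rightarrow> 'w \<Rightarrow> 'x) \<Rightarrow> 'x \<Rightarrow> 'w \<Rightarrow> ennreal" where
  "hitting_time X \<alpha> \<omega> = (INF t\<in>{t. t \<ge> 1 \<and> X t \<omega> = \<alpha>}. of_nat t)"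

definition positive_recurrent ::
  "('x \<Rightarrow> 'w measure) \<Rightarrow> (nat \<Rightarrow> 'w \<Rightarrow> 'x) \<Rightarrow> 'x set \<Rightarrow> bool" where
  "positive_recurrent P X S \<longleftrightarrow> (\<forall>\<alpha>\<in>S. (\<integral>\<^sup>+ \<omega>. hitting_time X \<alpha> \<omega> \<partial>P \<alpha>) < \<infinity>)"

definition stationary_distribution ::
  "('x \<Rightarrow> 'w measure) \<Rightarrow> (nat \<Rightarrow> 'w \<Rightarrow> 'x) \<Rightarrow> 'x set \<Rightarrow> 'x pmf \<Rightarrow> bool" where
  "stationary_distribution P X S \<pi> \<longleftrightarrow>
     set_pmf \<pi> \<subseteq> S \<and>
     (\<forall>\<beta>\<in>S. ((\<lambda>\<alpha>. pmf \<pi> \<alpha> * prob_at P X \<alpha> 1 {\<beta>}) has_sum pmf \<pi> \<beta>) S)"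

end

theory Submission
  imports Defs
begin

text \<open>
  The Lyapunov function is the total queue length \<open>W\<close>. In a slot in which every server works at full
  capacity, \<open>W\<close> changes on average by \<open>\<lambda> - \<Sum>\<mu>\<^sub>i < 0\<close>. Capacity is lost only around slots with an
  idle server, and in such slots the drift of \<open>W\<close> may be positive however large \<open>W\<close> is: one long queue
  does not prevent the short ones from running empty. So \<open>W\<close> is observed over a long fixed
  number \<open>T\<close> of slots, and the loss is controlled pathwise, by induction on the number of servers.

  Consider servers \<open>S\<close> that receive all arrivals, with \<open>\<mu>\<^sub>S\<close> the sum of their mean capacities, on a path
  whose cumulative arrivals and services stay within \<open>D\<close> of their means. Suppose some \<open>j \<in> S\<close> is so
  long that it stays busy throughout. Until the first idle slot nothing is lost, and the work of \<open>S\<close> grows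
  at rate \<open>\<lambda> - \<mu>\<^sub>S\<close>. From the first idle slot on, arrivals go to idle servers or to the last idle
  one, never to \<open>j\<close>; so \<open>j\<close> drains at rate \<open>\<mu>\<^sub>j\<close> while \<open>S - {j}\<close> receives all arrivals
  and is covered by the induction hypothesis (lemma \<open>drift_with_busy_server\<close>). Cutting time into blocks that
  are long compared with \<open>D\<close>, either the work of \<open>S\<close> is small or some server stays busy through the
  block; hence the work of \<open>S\<close> grows at rate at most \<open>max 0 (\<lambda> - \<mu>\<^sub>S) + \<delta>\<close>, up to a multiple of
  \<open>D\<close> (lemma \<open>work_bound\<close>). For the whole system this gives two estimates: \<open>W\<close> grows by at most
  \<open>\<delta>T + O(D)\<close> from any state, and it falls at rate about \<open>min (\<Sum>\<mu>\<^sub>i - \<lambda>) 1\<close> from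
  states so large that some server stays busy up to time \<open>T\<close>. By the finite variances the mean of \<open>D\<close> is
  \<open>o(T)\<close>, so for a suitable \<open>T\<close> the mean of \<open>W\<close> rises by at most \<open>\<eta>\<close> from everywhere and falls by at
  least \<open>3\<eta>\<close> outside a finite set (lemma \<open>total_bounds\<close>).

  From each of these finitely many states all queues can be emptied by slots without arrivals, in every
  large enough number of slots. Foster's criterion (theorem \<open>foster\<close>) then makes mean hitting times finite.
  Since the possible rise \<open>\<eta>\<close> is smaller than the fall \<open>3\<eta>\<close>, the sum of \<open>W\<close> over two independent
  copies of the chain is a Lyapunov function for the pair; the copies meet in the empty state, which gives
  convergence to, and uniqueness of, a stationary distribution. It exists because the occupation
  measure of an excursion from the empty state is finite (theorem \<open>stationary_exists\<close>).
\<close>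
section \<open>Powers of a transition kernel and avoidance probabilities\<close>

primrec kpow :: "('x \<Rightarrow> 'x pmf) \<Rightarrow> nat \<Rightarrow> 'x \<Rightarrow> 'x pmf" where
  "kpow K 0 x = return_pmf x"
| "kpow K (Suc t) x = K x \<bind> kpow K t"

lemma kpow_0: "kpow K 0 = return_pmf"
  by (rule ext) simp

lemma kpow_add: "kpow K (s + t) x = kpow K s x \<bind> kpow K t"
proof (induction s arbitrary: x)
  case (Suc s)
  then have "kpow K (s + t) = (\<lambda>x. kpow K s x \<bind> kpow K t)" by (rule ext)
  then show ?case by (simp add: bind_assoc_pmf)
qed (simp add: bind_return_pmf)

lemma kpow_1: "kpow K (Suc 0) x = K x"
  by (simp add: kpow_0 bind_return_pmf')

lemma kpow_Suc_right: "kpow K (Suc t) x = kpow K t x \<bind> K"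
proof -
  have "kpow K (Suc 0) = K" by (rule ext) (rule kpow_1)
  then show ?thesis using kpow_add[of K t "Suc 0" x] by (simp del: kpow.simps)
qed

text \<open>
  The probability that the chain with kernel \<open>K\<close>, started at \<open>x\<close>, is not at \<open>\<beta>\<close> at any of the times
  \<open>1, \<dots>, t\<close>. The state at time 0 does not count, so that summing over \<open>t\<close> gives the mean
  return time when \<open>x = \<beta>\<close>.
\<close>

primrec avoid :: "('x \<Rightarrow> 'x pmf) \<Rightarrow> 'x \<Rightarrow> nat \<Rightarrow> 'x \<Rightarrow> ennreal" where
  "avoid K \<beta> 0 x = 1"
| "avoid K \<beta> (Suc t) x = (\<integral>\<^sup>+ y. (if y = \<beta> then 0 else avoid K \<beta> t y) \<partial>K x)"

lemma avoid_le_1: "avoid K \<beta> t x \<le> 1"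
proof (induction t arbitrary: x)
  case (Suc t)
  have "avoid K \<beta> (Suc t) x \<le> (\<integral>\<^sup>+ y. 1 \<partial>K x)"
    unfolding avoid.simps by (intro nn_integral_mono) (simp add: Suc)
  then show ?case by simp
qed simp

lemma avoid_add_kpow_le_1: "avoid K \<beta> (Suc N) x + pmf (kpow K (Suc N) x) \<beta> \<le> 1"
proof (induction N arbitrary: x)
  case 0
  have "avoid K \<beta> (Suc 0) x + pmf (kpow K (Suc 0) x) \<beta>
      = (\<integral>\<^sup>+ y. (if y = \<beta> then 0 else 1) + indicator {\<beta>} y \<partial>K x)"
    by (subst nn_integral_add) (auto simp: emeasure_pmf_single kpow_0 bind_return_pmf' cong: if_cong)
  also have "\<dots> = (\<integral>\<^sup>+ y. 1 \<partial>K x)"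
    by (intro nn_integral_cong) auto
  finally show ?case by simp
next
  case (Suc N)
  have "avoid K \<beta> (Suc (Suc N)) x + pmf (kpow K (Suc (Suc N)) x) \<beta>
      = (\<integral>\<^sup>+ y. (if y = \<beta> then 0 else avoid K \<beta> (Suc N) y) + pmf (kpow K (Suc N) y) \<beta> \<partial>K x)"
    by (subst nn_integral_add)
       (simp_all add: ennreal_pmf_bind[of "K x" "kpow K (Suc N)"] del: kpow.simps(2) avoid.simps(2)
         add: kpow.simps(2)[of _ "Suc N"] avoid.simps(2)[of _ _ "Suc N"])
  also have "\<dots> \<le> (\<integral>\<^sup>+ y. 1 \<partial>K x)"
  proof (intro nn_integral_mono)
    fix y
    show "(if y = \<beta> then 0 else avoid K \<beta> (Suc N) y) + pmf (kpow K (Suc N) y) \<beta> \<le> 1"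
      using Suc[of y] by (auto simp del: kpow.simps avoid.simps simp: pmf_le_1)
  qed
  finally show ?case by simp
qed

lemma sum_avoid_Suc:
  "(\<Sum>t<Suc n. avoid K \<beta> t x) = 1 + (\<integral>\<^sup>+ y. (if y = \<beta> then 0 else \<Sum>t<n. avoid K \<beta> t y) \<partial>K x)"
proof -
  have "(\<integral>\<^sup>+ y. (if y = \<beta> then 0 else \<Sum>t<n. avoid K \<beta> t y) \<partial>K x)
      = (\<integral>\<^sup>+ y. (\<Sum>t<n. if y = \<beta> then 0 else avoid K \<beta> t y) \<partial>K x)"
    by (intro nn_integral_cong) auto
  also have "\<dots> = (\<Sum>t<n. avoid K \<beta> (Suc t) x)"
    by (subst nn_integral_sum) simp_all
  finally show ?thesis
    by (subst sum.lessThan_Suc_shift) simp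
qed

text \<open>
  The mean hitting time, as a function of \<open>x\<close>, is the least nonnegative solution of the one-step equation for the
  chain stopped at \<open>\<beta>\<close>; any supersolution dominates it. Its partial sums satisfy the equation with
  one summand fewer on the right, so the bound follows by induction.
\<close>

lemma sum_avoid_le:
  fixes K :: "'x \<Rightarrow> 'x pmf"
  assumes drift: "\<And>x. (\<integral>\<^sup>+ y. (if y = \<beta> then 0 else h y) \<partial>K x) + \<eta> \<le> h x"
  shows "\<eta> * (\<Sum>t<n. avoid K \<beta> t x) \<le> h x"
proof (induction n arbitrary: x)
  case (Suc n)
  have "\<eta> * (\<Sum>t<Suc n. avoid K \<beta> t x)
      = (\<integral>\<^sup>+ y. (if y = \<beta> then 0 else \<eta> * (\<Sum>t<n. avoid K \<beta> t y)) \<partial>K x) + \<eta>"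
    unfolding sum_avoid_Suc
    by (simp add: distrib_left add.commute nn_integral_cmult[symmetric] if_distrib cong: if_cong)
  also have "\<dots> \<le> (\<integral>\<^sup>+ y. (if y = \<beta> then 0 else h y) \<partial>K x) + \<eta>"
    by (intro add_mono nn_integral_mono) (simp_all add: Suc)
  finally show ?case using drift[of x] by (rule order_trans)
qed simp

section \<open>Foster's criterion\<close>

text \<open>
  Drift over \<open>T\<close> steps towards a set \<open>C\<close> from which \<open>\<beta>\<close> is hit with probability at least \<open>p\<close> within a
  fixed number of steps. A supersolution for \<open>\<beta>\<close> is assembled from two functions. Summing the means of \<open>V\<close> over
  the first \<open>T\<close> steps turns the \<open>T\<close>-step drift into a one-step drift; and the sum \<open>\<phi>\<close> of the first few
  avoidance probabilities is a bounded function that decreases by at least \<open>p\<close> on \<open>C\<close> and nowhere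
  increases, which pays for the possible increase \<open>b\<close> of \<open>V\<close> there.
\<close>

theorem foster:
  fixes K :: "'x \<Rightarrow> 'x pmf" and V :: "'x \<Rightarrow> ennreal" and \<eta> b p :: real
  assumes drift: "\<And>x. (\<integral>\<^sup>+ y. V y \<partial>kpow K T x) + \<eta> \<le> V x + b * indicator C x"
    and pos: "\<eta> > 0" "b \<ge> 0" "p > 0"
    and fin: "\<And>k x. (\<integral>\<^sup>+ y. V y \<partial>kpow K k x) < \<infinity>"
    and access: "\<And>x. x \<in> C \<Longrightarrow> p \<le> pmf (kpow K (Suc N) x) \<beta>"
  shows "(\<Sum>t. avoid K \<beta> t x) < \<infinity>"
proof -
  define V' where "V' x = (\<Sum>k<T. \<integral>\<^sup>+ y. V y \<partial>kpow K k x)" for x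
  define \<phi> where "\<phi> x = (\<Sum>t<Suc N. avoid K \<beta> t x)" for x
  \<comment> \<open>the factor makes the decrease of \<open>\<phi>\<close> on \<open>C\<close> exactly compensate \<open>b\<close>\<close>
  define h where "h x = V' x + ennreal (b / p) * \<phi> x" for x
  have V_fin: "V x < \<infinity>" for x
    using fin[of 0 x] by simp
  have V'_fin: "V' x < \<infinity>" for x
    unfolding V'_def using fin by (simp add: ennreal_sum_less_top)
  have \<phi>_fin: "\<phi> x < \<infinity>" for x
    unfolding \<phi>_def using le_less_trans[OF avoid_le_1[of K \<beta> _ x] ennreal_one_less_top]
    by (simp add: ennreal_sum_less_top del: sum.lessThan_Suc avoid.simps)
  have V'_drift: "(\<integral>\<^sup>+ y. V' y \<partial>K x) + \<eta> \<le> V' x + b * indicator C x" for x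
  proof -
    have "V x + ((\<integral>\<^sup>+ y. V' y \<partial>K x) + \<eta>) = (\<Sum>k<Suc T. \<integral>\<^sup>+ y. V y \<partial>kpow K k x) + \<eta>"
      unfolding V'_def by (subst sum.lessThan_Suc_shift) (simp add: nn_integral_sum add.assoc)
    \<comment> \<open>shifting the sum by one step only exchanges the term for \<open>k = 0\<close> for the one for \<open>k = T\<close>\<close>
    also have "\<dots> = V' x + ((\<integral>\<^sup>+ y. V y \<partial>kpow K T x) + \<eta>)"
      by (simp add: V'_def add.assoc)
    also have "\<dots> \<le> V' x + (V x + b * indicator C x)"
      by (intro add_left_mono drift)
    also have "\<dots> = V x + (V' x + b * indicator C x)"
      by (simp add: add_ac)
    finally show ?thesis
      using V_fin[of x] unfolding ennreal_add_left_cancel_le by auto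
  qed
  have \<phi>_drift: "(\<integral>\<^sup>+ y. (if y = \<beta> then 0 else \<phi> y) \<partial>K x) + p * indicator C x \<le> \<phi> x" for x
  proof -
    let ?I = "\<integral>\<^sup>+ y. (if y = \<beta> then 0 else \<phi> y) \<partial>K x"
    have eq: "1 + ?I = \<phi> x + avoid K \<beta> (Suc N) x"
      using sum_avoid_Suc[of K \<beta> x "Suc N"] unfolding \<phi>_def by (simp del: avoid.simps)
    have "avoid K \<beta> (Suc N) x + p * indicator C x \<le> 1"
    proof (cases "x \<in> C")
      case True
      have "avoid K \<beta> (Suc N) x + ennreal p \<le> avoid K \<beta> (Suc N) x + pmf (kpow K (Suc N) x) \<beta>"
        using access[OF True] by (intro add_left_mono ennreal_leI)
      from order_trans[OF this avoid_add_kpow_le_1] show ?thesis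
        using True by (simp del: avoid.simps)
    next
      case False
      then show ?thesis using avoid_le_1[of K \<beta> "Suc N" x] by (simp del: avoid.simps)
    qed
    then have le: "\<phi> x + (avoid K \<beta> (Suc N) x + p * indicator C x) \<le> \<phi> x + 1"
      by (rule add_left_mono)
    have "1 + (?I + p * indicator C x) = (1 + ?I) + p * indicator C x"
      by (rule add.assoc[symmetric])
    also have "\<dots> = \<phi> x + (avoid K \<beta> (Suc N) x + p * indicator C x)"
      unfolding eq by (rule add.assoc)
    also note le
    finally show ?thesis
      by (simp only: add.commute[of "\<phi> x" 1] ennreal_add_left_cancel_le) simp
  qed
  have h_drift: "(\<integral>\<^sup>+ y. (if y = \<beta> then 0 else h y) \<partial>K x) + \<eta> \<le> h x" for x
  proof -
    have bp: "ennreal (b / p) * ennreal (p * c) = ennreal (b * c)" if "c \<ge> 0" for c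
      using pos that by (simp add: ennreal_mult[symmetric])
    have "(\<integral>\<^sup>+ y. (if y = \<beta> then 0 else h y) \<partial>K x)
        \<le> (\<integral>\<^sup>+ y. V' y + ennreal (b / p) * (if y = \<beta> then 0 else \<phi> y) \<partial>K x)"
      by (intro nn_integral_mono) (auto simp: h_def)
    also have "\<dots> = (\<integral>\<^sup>+ y. V' y \<partial>K x) + ennreal (b / p) * (\<integral>\<^sup>+ y. (if y = \<beta> then 0 else \<phi> y) \<partial>K x)"
      by (simp add: nn_integral_add nn_integral_cmult)
    finally have "(\<integral>\<^sup>+ y. (if y = \<beta> then 0 else h y) \<partial>K x) + \<eta>
      \<le> ((\<integral>\<^sup>+ y. V' y \<partial>K x) + \<eta>) + ennreal (b / p) * (\<integral>\<^sup>+ y. (if y = \<beta> then 0 else \<phi> y) \<partial>K x)"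
      by (simp add: add_ac add_right_mono add_left_mono)
    also have "\<dots> \<le> (V' x + b * indicator C x) + ennreal (b / p) * (\<integral>\<^sup>+ y. (if y = \<beta> then 0 else \<phi> y) \<partial>K x)"
      by (intro add_right_mono V'_drift)
    also have "\<dots> = V' x + ennreal (b / p) * ((\<integral>\<^sup>+ y. (if y = \<beta> then 0 else \<phi> y) \<partial>K x) + p * indicator C x)"
      by (simp add: distrib_left bp add_ac)
    also have "\<dots> \<le> h x"
      unfolding h_def by (intro add_left_mono mult_left_mono \<phi>_drift) simp
    finally show ?thesis .
  qed
  have "ennreal \<eta> * (\<Sum>t. avoid K \<beta> t x) \<le> h x"
    unfolding ennreal_suminf_cmult[symmetric]
    by (rule suminf_le_const[OF summableI])
       (use sum_avoid_le[OF h_drift] in \<open>simp add: sum_distrib_left[symmetric]\<close>)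
  moreover have "h x < \<infinity>"
    using V'_fin[of x] \<phi>_fin[of x] by (simp add: h_def ennreal_mult_less_top)
  ultimately have "ennreal \<eta> * (\<Sum>t. avoid K \<beta> t x) < \<infinity>"
    by (rule le_less_trans)
  then show ?thesis
    using pos by (auto simp: ennreal_mult_less_top)
qed

section \<open>Two independent copies\<close>

definition kprod :: "('x \<Rightarrow> 'x pmf) \<Rightarrow> 'x \<times> 'x \<Rightarrow> ('x \<times> 'x) pmf" where
  "kprod K z = pair_pmf (K (fst z)) (K (snd z))"

lemma kpow_kprod: "kpow (kprod K) t z = pair_pmf (kpow K t (fst z)) (kpow K t (snd z))"
proof (induction t arbitrary: z)
  case (Suc t)
  have "kpow (kprod K) (Suc t) z
      = K (fst z) \<bind> (\<lambda>x. K (snd z) \<bind> (\<lambda>y. kpow K t x \<bind> (\<lambda>x'. kpow K t y \<bind> (\<lambda>y'. return_pmf (x', y')))))"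
    by (simp add: Suc[abs_def] kprod_def pair_pmf_def bind_assoc_pmf bind_return_pmf)
  also have "\<dots> = K (fst z) \<bind> (\<lambda>x. kpow K t x \<bind> (\<lambda>x'. K (snd z) \<bind> (\<lambda>y. kpow K t y \<bind> (\<lambda>y'. return_pmf (x', y')))))"
    by (subst bind_commute_pmf) (rule refl)
  also have "\<dots> = pair_pmf (kpow K (Suc t) (fst z)) (kpow K (Suc t) (snd z))"
    by (simp add: pair_pmf_def bind_assoc_pmf)
  finally show ?case .
qed (simp add: prod_eq_iff)

text \<open>
  Run the two copies independently until both are at \<open>c\<close>, and together afterwards: the laws at time \<open>t\<close> differ
  at most by the probability of not having met. In terms of the kernel this is an induction on
  the first step, since from \<open>(c, c)\<close> on the two sides agree.
\<close>

lemma kpow_coupling: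
  "emeasure (kpow K t x) A \<le> emeasure (kpow K t y) A + avoid (kprod K) (c, c) t (x, y)"
proof (induction t arbitrary: x y)
  case 0
  then show ?case by (auto simp: indicator_def)
next
  case (Suc t)
  let ?d = "\<lambda>z. if z = (c, c) then 0 else avoid (kprod K) (c, c) t z"
  have "emeasure (kpow K (Suc t) x) A
      = (\<integral>\<^sup>+ z. emeasure (kpow K t (fst z)) A \<partial>pair_pmf (K x) (K y))"
    by (simp add: nn_integral_pair_pmf')
  also have "\<dots> \<le> (\<integral>\<^sup>+ z. emeasure (kpow K t (snd z)) A + ?d z \<partial>pair_pmf (K x) (K y))"
  proof (intro nn_integral_mono)
    fix z
    show "emeasure (kpow K t (fst z)) A \<le> emeasure (kpow K t (snd z)) A + ?d z"
      using Suc[of "fst z" "snd z"] by (cases "z = (c, c)") auto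
  qed
  also have "\<dots> = (\<integral>\<^sup>+ z. emeasure (kpow K t (snd z)) A \<partial>pair_pmf (K x) (K y)) + avoid (kprod K) (c, c) (Suc t) (x, y)"
    by (subst nn_integral_add) (simp_all add: kprod_def)
  also have "(\<integral>\<^sup>+ z. emeasure (kpow K t (snd z)) A \<partial>pair_pmf (K x) (K y)) = emeasure (kpow K (Suc t) y) A"
    by (simp add: nn_integral_pair_pmf')
  finally show ?case .
qed

lemma stationary_kpow: "\<pi> \<bind> K = \<pi> \<Longrightarrow> \<pi> \<bind> kpow K t = \<pi>"
proof (induction t)
  case (Suc t)
  have "kpow K (Suc t) = (\<lambda>x. K x \<bind> kpow K t)" by (rule ext) simp
  then show ?case using Suc by (simp add: bind_assoc_pmf[symmetric])
qed (simp add: kpow_0 bind_return_pmf')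

lemma avoid_tendsto_0:
  assumes "(\<Sum>t. avoid K \<beta> t x) < \<infinity>"
  shows "(\<lambda>t. avoid K \<beta> t x) \<longlonglongrightarrow> 0"
proof -
  have real: "avoid K \<beta> t x = ennreal (enn2real (avoid K \<beta> t x))" for t
    using avoid_le_1[of K \<beta> t x] by (metis ennreal_enn2real ennreal_one_less_top le_less_trans)
  have "summable (\<lambda>t. enn2real (avoid K \<beta> t x))"
    using assms real by (intro summable_suminf_not_top) (auto simp flip: real)
  then have "(\<lambda>t. ennreal (enn2real (avoid K \<beta> t x))) \<longlonglongrightarrow> ennreal 0"
    by (intro tendsto_ennrealI summable_LIMSEQ_zero)
  then show ?thesis using real by simp
qed

text \<open>
  Couple the chain started at \<open>x\<close> with one started from \<open>\<pi>\<close>. The mean time until they meet may be infinite for a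
  start from \<open>\<pi>\<close>, but the probability of not having met tends to 0 by dominated convergence.
\<close>

theorem kpow_tendsto_stationary:
  assumes meet: "\<And>z. (\<Sum>t. avoid (kprod K) (c, c) t z) < \<infinity>"
    and stat: "\<pi> \<bind> K = \<pi>"
  shows "(\<lambda>t. measure_pmf.prob (kpow K t x) A) \<longlonglongrightarrow> measure_pmf.prob \<pi> A"
proof -
  let ?d = "avoid (kprod K) (c, c)"
  define e1 where "e1 t = (\<integral>\<^sup>+ y. ?d t (x, y) \<partial>\<pi>)" for t
  define e2 where "e2 t = (\<integral>\<^sup>+ y. ?d t (y, x) \<partial>\<pi>)" for t
  have lim: "(\<lambda>t. \<integral>\<^sup>+ y. ?d t (g y) \<partial>\<pi>) \<longlonglongrightarrow> 0" for g
  proof -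
    have "(\<lambda>t. \<integral>\<^sup>+ y. ?d t (g y) \<partial>\<pi>) \<longlonglongrightarrow> (\<integral>\<^sup>+ y. 0 \<partial>\<pi>)"
      using avoid_tendsto_0[OF meet] avoid_le_1[of "kprod K" "(c, c)"]
      by (intro nn_integral_dominated_convergence[where w="\<lambda>_. 1"]) (simp_all add: AE_pmfI)
    then show ?thesis by simp
  qed
  have up: "emeasure (kpow K t x) A \<le> emeasure \<pi> A + e1 t" for t
  proof -
    have "emeasure (kpow K t x) A = (\<integral>\<^sup>+ y. emeasure (kpow K t x) A \<partial>\<pi>)" by simp
    also have "\<dots> \<le> (\<integral>\<^sup>+ y. emeasure (kpow K t y) A + ?d t (x, y) \<partial>\<pi>)"
      by (intro nn_integral_mono kpow_coupling)
    also have "\<dots> = emeasure (bind_pmf \<pi> (kpow K t)) A + e1 t"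
      by (subst nn_integral_add) (simp_all add: e1_def)
    finally show ?thesis using stationary_kpow[OF stat] by simp
  qed
  have lo: "emeasure \<pi> A \<le> emeasure (kpow K t x) A + e2 t" for t
  proof -
    have "emeasure \<pi> A = emeasure (bind_pmf \<pi> (kpow K t)) A"
      using stationary_kpow[OF stat, of t] by simp
    also have "\<dots> \<le> (\<integral>\<^sup>+ y. emeasure (kpow K t x) A + ?d t (y, x) \<partial>\<pi>)"
      unfolding emeasure_bind_pmf by (intro nn_integral_mono kpow_coupling)
    also have "\<dots> = emeasure (kpow K t x) A + e2 t"
      by (subst nn_integral_add) (simp_all add: e2_def)
    finally show ?thesis .
  qed
  have fin: "(\<integral>\<^sup>+ y. ?d t (g y) \<partial>\<pi>) \<noteq> \<infinity>" for t g
  proof -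
    have "(\<integral>\<^sup>+ y. ?d t (g y) \<partial>\<pi>) \<le> (\<integral>\<^sup>+ y. 1 \<partial>\<pi>)"
      by (intro nn_integral_mono avoid_le_1)
    then show ?thesis by (auto simp: top_unique)
  qed
  define r1 where "r1 t = enn2real (e1 t)" for t
  define r2 where "r2 t = enn2real (e2 t)" for t
  have r: "e1 t = ennreal (r1 t)" "e2 t = ennreal (r2 t)" "0 \<le> r1 t" "0 \<le> r2 t" for t
    using fin[of t] by (simp_all add: e1_def e2_def r1_def r2_def less_top)
  have lims: "r1 \<longlonglongrightarrow> 0" "r2 \<longlonglongrightarrow> 0"
    using lim[of "Pair x"] lim[of "\<lambda>y. (y, x)"]
    by (auto intro!: tendsto_enn2real simp: e1_def[abs_def] e2_def[abs_def] r1_def[abs_def] r2_def[abs_def])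
  let ?m = "\<lambda>t. measure_pmf.prob (kpow K t x) A"
  have "?m t \<le> measure_pmf.prob \<pi> A + r1 t" "measure_pmf.prob \<pi> A \<le> ?m t + r2 t" for t
    using up[of t] lo[of t] unfolding r measure_pmf.emeasure_eq_measure
    using r(3,4)[of t] by (simp_all flip: ennreal_plus)
  note bds = this
  have bd: "norm (?m t - measure_pmf.prob \<pi> A) \<le> r1 t + r2 t" for t
    using bds[of t] r(3,4)[of t] unfolding real_norm_def abs_le_iff by linarith
  have "(\<lambda>t. ?m t - measure_pmf.prob \<pi> A) \<longlonglongrightarrow> 0"
    by (rule Lim_null_comparison[OF always_eventually[rule_format]])
       (use bd tendsto_add[OF lims] in auto)
  then show ?thesis by (rule LIM_zero_cancel)
qed

section \<open>Markov chains on a countable state space\<close>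

text \<open>
  A Markov chain on a countable state space, given by one probability measure for each initial state. The Markov
  property is required for pasts that prescribe a set \<open>Z u\<close> for each time \<open>u \<le> t\<close>; this
  suffices for laws at fixed times and for hitting times.
\<close>

locale markov_process =
  fixes K :: "'x::countable \<Rightarrow> 'x pmf" and P :: "'x \<Rightarrow> 'w measure" and X :: "nat \<Rightarrow> 'w \<Rightarrow> 'x"
  assumes prob: "prob_space (P x)"
    and X_measurable [measurable]: "X t \<in> measurable (P x) (count_space UNIV)"
    and start: "AE \<omega> in P x. X 0 \<omega> = x"
    and transition: "emeasure (P x) {\<omega> \<in> space (P x). (\<forall>u\<le>t. X u \<omega> \<in> Z u) \<and> X (Suc t) \<omega> = y}
        = (\<integral>\<^sup>+ \<omega>. indicator {\<omega>. \<forall>u\<le>t. X u \<omega> \<in> Z u} \<omega> * ennreal (pmf (K (X t \<omega>)) y) \<partial>P x)"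
begin

abbreviation past :: "nat \<Rightarrow> (nat \<Rightarrow> 'x set) \<Rightarrow> 'w \<Rightarrow> ennreal" where
  "past t Z \<equiv> indicator {\<omega>. \<forall>u\<le>t. X u \<omega> \<in> Z u}"

lemma past_measurable [measurable]: "past t Z \<in> borel_measurable (P x)"
proof -
  have "Measurable.pred (P x) (\<lambda>\<omega>. \<forall>u\<in>{..t}. X u \<omega> \<in> Z u)"
    by (intro pred_intros_finite) auto
  then show ?thesis
    by (auto simp: indicator_def[abs_def] Ball_def intro!: measurable_If)
qed

lemma nn_integral_transition:
  "(\<integral>\<^sup>+ \<omega>. past t Z \<omega> * \<phi> (X (Suc t) \<omega>) \<partial>P x)
     = (\<integral>\<^sup>+ \<omega>. past t Z \<omega> * (\<integral>\<^sup>+ y. \<phi> y \<partial>K (X t \<omega>)) \<partial>P x)"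
proof -
  have "(\<integral>\<^sup>+ \<omega>. past t Z \<omega> * \<phi> (X (Suc t) \<omega>) \<partial>P x)
      = (\<integral>\<^sup>+ \<omega>. \<integral>\<^sup>+ y. past t Z \<omega> * indicator {y} (X (Suc t) \<omega>) * \<phi> y \<partial>count_space UNIV \<partial>P x)"
  proof (intro nn_integral_cong)
    fix \<omega>
    have "(\<integral>\<^sup>+ y. past t Z \<omega> * indicator {y} (X (Suc t) \<omega>) * \<phi> y \<partial>count_space UNIV)
        = (\<integral>\<^sup>+ y. past t Z \<omega> * \<phi> y * indicator {X (Suc t) \<omega>} y \<partial>count_space UNIV)"
      by (intro nn_integral_cong) (auto simp: indicator_def)
    then show "past t Z \<omega> * \<phi> (X (Suc t) \<omega>)
        = (\<integral>\<^sup>+ y. past t Z \<omega> * indicator {y} (X (Suc t) \<omega>) * \<phi> y \<partial>count_space UNIV)"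
      by simp
  qed
  also have "\<dots> = (\<integral>\<^sup>+ y. (\<integral>\<^sup>+ \<omega>. past t Z \<omega> * indicator {y} (X (Suc t) \<omega>) * \<phi> y \<partial>P x) \<partial>count_space UNIV)"
    by (rule nn_integral_count_space_nn_integral) auto
  also have "\<dots> = (\<integral>\<^sup>+ y. (\<integral>\<^sup>+ \<omega>. past t Z \<omega> * ennreal (pmf (K (X t \<omega>)) y) * \<phi> y \<partial>P x) \<partial>count_space UNIV)"
  proof (rule nn_integral_cong)
    fix y
    have "(\<integral>\<^sup>+ \<omega>. past t Z \<omega> * indicator {y} (X (Suc t) \<omega>) \<partial>P x)
        = (\<integral>\<^sup>+ \<omega>. indicator {\<omega> \<in> space (P x). (\<forall>u\<le>t. X u \<omega> \<in> Z u) \<and> X (Suc t) \<omega> = y} \<omega> \<partial>P x)"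
      by (intro nn_integral_cong) (auto simp: indicator_def)
    also have "\<dots> = emeasure (P x) {\<omega> \<in> space (P x). (\<forall>u\<le>t. X u \<omega> \<in> Z u) \<and> X (Suc t) \<omega> = y}"
    proof (rule nn_integral_indicator)
      have "Measurable.pred (P x) (\<lambda>\<omega>. (\<forall>u\<in>{..t}. X u \<omega> \<in> Z u) \<and> X (Suc t) \<omega> = y)"
        by (intro pred_intros_finite pred_intros_logic) auto
      then show "{\<omega> \<in> space (P x). (\<forall>u\<le>t. X u \<omega> \<in> Z u) \<and> X (Suc t) \<omega> = y} \<in> sets (P x)"
        by (simp add: pred_def Ball_def)
    qed
    also note transition
    finally show "(\<integral>\<^sup>+ \<omega>. past t Z \<omega> * indicator {y} (X (Suc t) \<omega>) * \<phi> y \<partial>P x)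
        = (\<integral>\<^sup>+ \<omega>. past t Z \<omega> * ennreal (pmf (K (X t \<omega>)) y) * \<phi> y \<partial>P x)"
      by (subst (1 2) nn_integral_multc) auto
  qed
  also have "\<dots> = (\<integral>\<^sup>+ \<omega>. (\<integral>\<^sup>+ y. past t Z \<omega> * ennreal (pmf (K (X t \<omega>)) y) * \<phi> y \<partial>count_space UNIV) \<partial>P x)"
    by (rule nn_integral_count_space_nn_integral[symmetric]) auto
  also have "\<dots> = (\<integral>\<^sup>+ \<omega>. past t Z \<omega> * (\<integral>\<^sup>+ y. \<phi> y \<partial>K (X t \<omega>)) \<partial>P x)"
    unfolding nn_integral_measure_pmf by (simp add: mult.assoc nn_integral_cmult)
  finally show ?thesis .
qed

lemma nn_integral_X: "(\<integral>\<^sup>+ \<omega>. \<phi> (X t \<omega>) \<partial>P x) = (\<integral>\<^sup>+ y. \<phi> y \<partial>kpow K t x)"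
proof (induction t arbitrary: \<phi>)
  case 0
  have "(\<integral>\<^sup>+ \<omega>. \<phi> (X 0 \<omega>) \<partial>P x) = (\<integral>\<^sup>+ \<omega>. \<phi> x \<partial>P x)"
    using start[of x] by (intro nn_integral_cong_AE) (auto elim: eventually_mono)
  then show ?case by (simp add: prob_space.emeasure_space_1[OF prob])
next
  case (Suc t)
  have "(\<integral>\<^sup>+ \<omega>. \<phi> (X (Suc t) \<omega>) \<partial>P x) = (\<integral>\<^sup>+ \<omega>. (\<integral>\<^sup>+ y. \<phi> y \<partial>K (X t \<omega>)) \<partial>P x)"
    using nn_integral_transition[where t=t and Z="\<lambda>_. UNIV" and \<phi>=\<phi>] by simp
  also have "\<dots> = (\<integral>\<^sup>+ y. \<phi> y \<partial>kpow K (Suc t) x)"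
    unfolding Suc[of "\<lambda>z. \<integral>\<^sup>+ y. \<phi> y \<partial>K z"] kpow_Suc_right by simp
  finally show ?case .
qed

lemma prob_at_eq: "prob_at P X x t C = measure_pmf.prob (kpow K t x) C"
proof -
  have "emeasure (P x) {\<omega> \<in> space (P x). X t \<omega> \<in> C}
      = (\<integral>\<^sup>+ \<omega>. indicator {\<omega> \<in> space (P x). X t \<omega> \<in> C} \<omega> \<partial>P x)"
    by (rule nn_integral_indicator[symmetric]) measurable
  also have "\<dots> = (\<integral>\<^sup>+ \<omega>. indicator C (X t \<omega>) \<partial>P x)"
    by (intro nn_integral_cong) (auto split: split_indicator)
  also have "\<dots> = emeasure (kpow K t x) C"
    by (subst nn_integral_X) simp
  finally show ?thesis by (simp add: prob_at_def measure_def)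
qed

text \<open>
  As a prescription for the past, \<open>after_start c\<close> expresses that \<open>c\<close> is not visited after time 0.
\<close>

definition after_start :: "'x \<Rightarrow> nat \<Rightarrow> 'x set" where
  "after_start c u = (if u = 0 then UNIV else - {c})"

lemma after_start_simps [simp]:
  "after_start c 0 = UNIV" "u \<ge> 1 \<Longrightarrow> after_start c u = - {c}" "after_start c (Suc u) = - {c}"
  by (simp_all add: after_start_def)

text \<open>
  The hitting time is the number of \<open>t\<close> with no visit at the times \<open>1, \<dots>, t\<close>, also when it is infinite.
\<close>

lemma hitting_time_eq:
  "hitting_time X \<beta> \<omega> = (\<Sum>t. indicator {\<omega>. \<forall>u\<le>t. X u \<omega> \<in> after_start \<beta> u} \<omega>)"
proof -
  let ?A = "\<lambda>t. \<forall>u\<le>t. X u \<omega> \<in> after_start \<beta> u"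
  show ?thesis
  proof (cases "\<exists>t. t \<ge> 1 \<and> X t \<omega> = \<beta>")
    case False
    then have "?A t" for t by (auto simp: after_start_def)
    then have "(\<Sum>t. indicator {\<omega>. \<forall>u\<le>t. X u \<omega> \<in> after_start \<beta> u} \<omega>) = (\<Sum>t. 1 :: ennreal)"
      by (simp add: indicator_def)
    also have "\<dots> = top"
      using infinite_UNIV_nat by (subst nn_integral_count_space_nat[symmetric]) simp
    finally show ?thesis
      using False by (simp add: hitting_time_def)
  next
    case True
    define n where "n = (LEAST t. t \<ge> 1 \<and> X t \<omega> = \<beta>)"
    have n: "n \<ge> 1" "X n \<omega> = \<beta>" and least: "\<And>t. t \<ge> 1 \<Longrightarrow> X t \<omega> = \<beta> \<Longrightarrow> n \<le> t"
      using LeastI_ex[OF True] by (auto simp: n_def intro: Least_le)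
    have "?A t \<longleftrightarrow> t < n" for t
    proof
      assume "?A t"
      then show "t < n" using n by (auto simp: after_start_def not_le[symmetric])
    next
      assume "t < n"
      then have "X u \<omega> \<noteq> \<beta>" if "1 \<le> u" "u \<le> t" for u
        using least[of u] that by linarith
      then show "?A t" by (auto simp: after_start_def)
    qed
    then have "(\<Sum>t. indicator {\<omega>. \<forall>u\<le>t. X u \<omega> \<in> after_start \<beta> u} \<omega>)
        = (\<Sum>t. indicator {..<n} t :: ennreal)"
      by (simp add: indicator_def)
    also have "\<dots> = (\<Sum>t<n. indicator {..<n} t :: ennreal)"
      by (rule suminf_finite) auto
    also have "\<dots> = of_nat n" by simp
    also have "of_nat n = hitting_time X \<beta> \<omega>"
      unfolding hitting_time_def
      by (rule antisym) (use n least in \<open>auto intro!: INF_greatest INF_lower\<close>)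
    finally show ?thesis by simp
  qed
qed

text \<open>
  Having avoided \<open>\<beta>\<close> up to time \<open>t\<close> and then for \<open>s\<close> more steps: the Markov property moves one step
  from the second phase to the first, so the value depends on \<open>t + s\<close> only.
\<close>

lemma nn_integral_past_avoid:
  assumes "\<And>u. u \<ge> 1 \<Longrightarrow> Z u = - {\<beta>}" "Z 0 = UNIV"
  shows "(\<integral>\<^sup>+ \<omega>. past t Z \<omega> * avoid K \<beta> s (X t \<omega>) \<partial>P x) = avoid K \<beta> (t + s) x"
proof (induction t arbitrary: s)
  case 0
  have "(\<integral>\<^sup>+ \<omega>. past 0 Z \<omega> * avoid K \<beta> s (X 0 \<omega>) \<partial>P x) = (\<integral>\<^sup>+ \<omega>. avoid K \<beta> s (X 0 \<omega>) \<partial>P x)"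
    using assms by simp
  then show ?case by (subst (asm) nn_integral_X) simp
next
  case (Suc t)
  have "past (Suc t) Z \<omega> * avoid K \<beta> s (X (Suc t) \<omega>)
      = past t Z \<omega> * (if X (Suc t) \<omega> = \<beta> then 0 else avoid K \<beta> s (X (Suc t) \<omega>))" for \<omega>
    using assms by (auto simp: indicator_def le_Suc_eq)
  then show ?case
    using nn_integral_transition[where t=t and Z=Z and \<phi>="\<lambda>y. if y = \<beta> then 0 else avoid K \<beta> s y"]
      Suc[of "Suc s"] by simp
qed

lemma nn_integral_hitting_time: "(\<integral>\<^sup>+ \<omega>. hitting_time X \<beta> \<omega> \<partial>P x) = (\<Sum>t. avoid K \<beta> t x)"
proof -
  have "(\<integral>\<^sup>+ \<omega>. hitting_time X \<beta> \<omega> \<partial>P x)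
      = (\<Sum>t. \<integral>\<^sup>+ \<omega>. past t (after_start \<beta>) \<omega> \<partial>P x)"
    unfolding hitting_time_eq by (rule nn_integral_suminf) measurable
  also have "\<dots> = (\<Sum>t. avoid K \<beta> t x)"
    using nn_integral_past_avoid[where Z="after_start \<beta>" and \<beta>=\<beta> and s=0] by simp
  finally show ?thesis .
qed

text \<open>
  The probability that an excursion from \<open>c\<close> has not yet returned at time \<open>t\<close> and is at \<open>y\<close>.
\<close>

definition excursion_density :: "'x \<Rightarrow> nat \<Rightarrow> 'x \<Rightarrow> ennreal" where
  "excursion_density c t y = (\<integral>\<^sup>+ \<omega>. past t (after_start c) \<omega> * indicator {y} (X t \<omega>) \<partial>P c)"

lemma nn_integral_excursion_density:
  "(\<integral>\<^sup>+ y. excursion_density c t y * \<phi> y \<partial>count_space UNIV)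
     = (\<integral>\<^sup>+ \<omega>. past t (after_start c) \<omega> * \<phi> (X t \<omega>) \<partial>P c)"
proof -
  let ?p = "past t (after_start c)"
  have "(\<integral>\<^sup>+ y. excursion_density c t y * \<phi> y \<partial>count_space UNIV)
      = (\<integral>\<^sup>+ y. (\<integral>\<^sup>+ \<omega>. ?p \<omega> * indicator {y} (X t \<omega>) * \<phi> y \<partial>P c) \<partial>count_space UNIV)"
    unfolding excursion_density_def by (intro nn_integral_cong nn_integral_multc[symmetric]) measurable
  also have "\<dots> = (\<integral>\<^sup>+ \<omega>. (\<integral>\<^sup>+ y. ?p \<omega> * indicator {y} (X t \<omega>) * \<phi> y \<partial>count_space UNIV) \<partial>P c)"
    by (rule nn_integral_count_space_nn_integral[symmetric]) auto
  also have "\<dots> = (\<integral>\<^sup>+ \<omega>. ?p \<omega> * \<phi> (X t \<omega>) \<partial>P c)"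
  proof (rule nn_integral_cong)
    fix \<omega>
    have "(\<integral>\<^sup>+ y. ?p \<omega> * indicator {y} (X t \<omega>) * \<phi> y \<partial>count_space UNIV)
        = (\<integral>\<^sup>+ y. ?p \<omega> * \<phi> y * indicator {X t \<omega>} y \<partial>count_space UNIV)"
      by (intro nn_integral_cong) (auto simp: indicator_def)
    then show "(\<integral>\<^sup>+ y. ?p \<omega> * indicator {y} (X t \<omega>) * \<phi> y \<partial>count_space UNIV) = ?p \<omega> * \<phi> (X t \<omega>)"
      by simp
  qed
  finally show ?thesis .
qed

text \<open>
  The mean number \<open>m y\<close> of visits to \<open>y\<close> during an excursion from \<open>c\<close> is an invariant measure: moving the
  excursion one step ahead loses its initial point \<open>c\<close> and gains its final point, which is \<open>c\<close>
  again because the excursion is almost surely finite. The total mass of \<open>m\<close> is the mean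
  return time, so \<open>m\<close> can be normalised.
\<close>

theorem stationary_exists:
  assumes rec: "(\<Sum>t. avoid K c t c) < \<infinity>"
  obtains \<pi> where "\<pi> \<bind> K = \<pi>" "set_pmf \<pi> \<subseteq> {y. \<exists>t. y \<in> set_pmf (kpow K t c)}"
proof -
  let ?Z = "after_start c"
  note ed = excursion_density_def[of c] and nned = nn_integral_excursion_density[of c]
  define m where "m y = (\<Sum>t. excursion_density c t y)" for y
  define tot where "tot = (\<Sum>t. avoid K c t c)"
  have past_avoid: "(\<integral>\<^sup>+ \<omega>. past t ?Z \<omega> \<partial>P c) = avoid K c t c" for t
    using nn_integral_past_avoid[where Z="?Z" and \<beta>=c and s=0] by simp
  have m_tot: "(\<integral>\<^sup>+ y. m y \<partial>count_space UNIV) = tot"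
    unfolding m_def tot_def using nned[of _ "\<lambda>_. 1"] by (simp add: nn_integral_suminf past_avoid del: after_start_simps)
  have tot: "tot < \<infinity>" "tot \<noteq> 0"
  proof -
    have "(\<Sum>t<Suc 0. avoid K c t c) \<le> tot"
      unfolding tot_def by (rule sum_le_suminf) auto
    then show "tot < \<infinity>" "tot \<noteq> 0" using rec by (auto simp: tot_def)
  qed
  have ed_0: "excursion_density c 0 z = indicator {c} z" for z
  proof -
    have "excursion_density c 0 z = (\<integral>\<^sup>+ \<omega>. indicator {z} c \<partial>P c)"
      unfolding ed using start[of c] by (intro nn_integral_cong_AE) (auto elim: eventually_mono)
    then show ?thesis by (simp add: prob_space.emeasure_space_1[OF prob] indicator_def)
  qed
  have m_K: "(\<integral>\<^sup>+ y. m y * pmf (K y) z \<partial>count_space UNIV) = m z" for z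
  proof -
    define d where "d t = (\<integral>\<^sup>+ \<omega>. past t ?Z \<omega> * indicator {z} (X (Suc t) \<omega>) \<partial>P c)" for t
    have "(\<integral>\<^sup>+ y. m y * pmf (K y) z \<partial>count_space UNIV)
        = (\<Sum>t. \<integral>\<^sup>+ y. excursion_density c t y * pmf (K y) z \<partial>count_space UNIV)"
      unfolding m_def by (simp add: nn_integral_suminf[symmetric])
    also have "\<dots> = (\<Sum>t. d t)"
      unfolding nned d_def by (subst nn_integral_transition) (simp add: emeasure_pmf_single)
    also have "\<dots> = m z"
    proof (cases "z = c")
      case False
      then have "d t = excursion_density c (Suc t) z" for t
        unfolding d_def ed by (intro nn_integral_cong) (auto simp: indicator_def le_Suc_eq)
      then have "(\<Sum>t. d t) = (\<Sum>t. excursion_density c (Suc t) z)" by simp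
      also have "\<dots> = m z"
      proof -
        have "(\<lambda>t. excursion_density c t z) sums ((\<Sum>t. excursion_density c (Suc t) z) + excursion_density c 0 z)"
          by (intro sums_Suc summable_sums) simp
        then show ?thesis using False by (simp add: m_def ed_0 sums_iff)
      qed
      finally show ?thesis .
    next
      case True
      have "d t + avoid K c (Suc t) c = avoid K c t c" for t
      proof -
        have "d t + avoid K c (Suc t) c
            = (\<integral>\<^sup>+ \<omega>. past t ?Z \<omega> * indicator {z} (X (Suc t) \<omega>) + past (Suc t) ?Z \<omega> \<partial>P c)"
          unfolding d_def past_avoid[symmetric] by (rule nn_integral_add[symmetric]) auto
        also have "\<dots> = (\<integral>\<^sup>+ \<omega>. past t ?Z \<omega> \<partial>P c)"
          using True by (intro nn_integral_cong) (auto simp: indicator_def le_Suc_eq)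
        finally show ?thesis by (simp only: past_avoid)
      qed
      note step = this
      \<comment> \<open>\<open>d t\<close> is the probability of returning to \<open>c\<close> exactly at time \<open>t + 1\<close>\<close>
      have part: "(\<Sum>t<n. d t) + avoid K c n c = 1" for n
      proof (induction n)
        case (Suc n)
        have "(\<Sum>t<Suc n. d t) + avoid K c (Suc n) c = (\<Sum>t<n. d t) + (d n + avoid K c (Suc n) c)"
          by (simp only: sum.lessThan_Suc add.assoc)
        then show ?case using Suc by (simp only: step)
      qed simp
      have "(\<lambda>n. (\<Sum>t<n. d t) + avoid K c n c) \<longlonglongrightarrow> (\<Sum>t. d t) + 0"
        by (intro tendsto_add summable_LIMSEQ avoid_tendsto_0 rec) simp
      then have "(\<Sum>t. d t) = 1"
        unfolding part by (simp add: LIMSEQ_const_iff)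
      moreover have "excursion_density c t c = indicator {0} t" for t
      proof (cases t)
        case (Suc n)
        have "excursion_density c t c = (\<integral>\<^sup>+ \<omega>. 0 \<partial>P c)"
          unfolding ed using Suc by (intro nn_integral_cong) (auto simp: indicator_def)
        then show ?thesis using Suc by simp
      qed (simp add: ed_0)
      then have "m c = (\<Sum>t\<in>{0}. 1)"
        unfolding m_def by (subst suminf_finite[of "{0}"]) auto
      ultimately show ?thesis using True by simp
    qed
    finally show ?thesis .
  qed
  define f where "f y = enn2real (m y / tot)" for y
  have "m y \<le> tot" for y
    unfolding m_tot[symmetric] using nn_integral_ge_point[of y UNIV m] by simp
  then have "m y / tot \<le> tot / tot" for y by (rule divide_right_mono_ennreal)
  moreover have tot1: "tot / tot = 1" using tot by (intro ennreal_divide_self) auto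
  ultimately have f: "ennreal (f y) = m y / tot" for y
    unfolding f_def by (intro ennreal_enn2real) (metis ennreal_one_less_top le_less_trans)
  have f_sum: "(\<integral>\<^sup>+ y. f y \<partial>count_space UNIV) = 1"
    unfolding f by (simp add: nn_integral_divide m_tot tot1)
  define \<pi> where "\<pi> = embed_pmf f"
  have \<pi>: "pmf \<pi> y = f y" for y
    unfolding \<pi>_def by (rule pmf_embed_pmf[OF _ f_sum]) (simp add: f_def)
  have "\<pi> \<bind> K = \<pi>"
  proof (rule pmf_eqI)
    fix z
    have "ennreal (pmf (\<pi> \<bind> K) z) = (\<integral>\<^sup>+ y. m y / tot * pmf (K y) z \<partial>count_space UNIV)"
      by (simp add: ennreal_pmf_bind nn_integral_measure_pmf \<pi> f)
    also have "\<dots> = (\<integral>\<^sup>+ y. m y * pmf (K y) z / tot \<partial>count_space UNIV)"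
      by (intro nn_integral_cong) (simp add: divide_ennreal_def mult_ac)
    also have "\<dots> = pmf \<pi> z"
      by (simp add: nn_integral_divide m_K \<pi> f)
    finally show "pmf (\<pi> \<bind> K) z = pmf \<pi> z" by simp
  qed
  moreover have "set_pmf \<pi> \<subseteq> {y. \<exists>t. y \<in> set_pmf (kpow K t c)}"
  proof
    fix y assume "y \<in> set_pmf \<pi>"
    then have "m y \<noteq> 0" using f[of y] by (auto simp: set_pmf_iff \<pi> f_def)
    then obtain t where t: "excursion_density c t y \<noteq> 0" unfolding m_def by fastforce
    have "excursion_density c t y \<le> (\<integral>\<^sup>+ \<omega>. indicator {y} (X t \<omega>) \<partial>P c)"
      unfolding ed by (intro nn_integral_mono) (auto simp: indicator_def)
    also have "\<dots> = pmf (kpow K t c) y"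
      by (subst nn_integral_X) (simp add: emeasure_pmf_single)
    finally show "y \<in> {y. \<exists>t. y \<in> set_pmf (kpow K t c)}"
      using t by (auto simp: set_pmf_iff intro!: exI[of _ t])
  qed
  ultimately show ?thesis by (rule that)
qed

text \<open>
  On a closed set the balance equations are those of the kernel, and a series against a distribution carried by
  the set is an expectation.
\<close>

lemma stationary_distribution_iff:
  assumes closed: "\<And>x. x \<in> S \<Longrightarrow> set_pmf (K x) \<subseteq> S"
  shows "stationary_distribution P X S \<pi> \<longleftrightarrow> set_pmf \<pi> \<subseteq> S \<and> \<pi> \<bind> K = \<pi>"
proof (cases "set_pmf \<pi> \<subseteq> S")
  case True
  have *: "((\<lambda>x. pmf \<pi> x * prob_at P X x 1 {y}) has_sum pmf (\<pi> \<bind> K) y) S" for y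
  proof -
    have eq: "prob_at P X x 1 {y} = pmf (K x) y" for x
      unfolding prob_at_eq One_nat_def kpow_1 by (simp add: measure_pmf_single)
    have "Infinite_Set_Sum.abs_summable_on (\<lambda>x. pmf \<pi> x * pmf (K x) y) S"
      by (rule abs_summable_on_comparison_test'[OF pmf_abs_summable[of \<pi>]])
         (simp add: mult_left_le pmf_le_1)
    then have "((\<lambda>x. pmf \<pi> x * pmf (K x) y) has_sum (infsetsum (\<lambda>x. pmf \<pi> x * pmf (K x) y) S)) S"
      using abs_summable_summable[of "\<lambda>x. pmf \<pi> x * pmf (K x) y" S] abs_summable_equivalent[of "\<lambda>x. pmf \<pi> x * pmf (K x) y" S]
      by (metis has_sum_infsum infsetsum_infsum)
    moreover have "infsetsum (\<lambda>x. pmf \<pi> x * pmf (K x) y) S = pmf (\<pi> \<bind> K) y"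
      unfolding pmf_bind pmf_expectation_eq_infsetsum using True
      by (intro infsetsum_cong_neutral) (auto simp: pmf_eq_0_set_pmf subset_iff)
    ultimately show ?thesis unfolding eq by simp
  qed
  show ?thesis
  proof
    assume st: "stationary_distribution P X S \<pi>"
    have "pmf (\<pi> \<bind> K) y = pmf \<pi> y" for y
    proof (cases "y \<in> S")
      case True
      with st have "((\<lambda>x. pmf \<pi> x * prob_at P X x 1 {y}) has_sum pmf \<pi> y) S"
        by (simp add: stationary_distribution_def)
      with * show ?thesis by (rule has_sum_unique)
    next
      case False
      then have "y \<notin> set_pmf (\<pi> \<bind> K)" "y \<notin> set_pmf \<pi>" using \<open>set_pmf \<pi> \<subseteq> S\<close> closed by auto
      then show ?thesis by (metis pmf_eq_0_set_pmf)
    qed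
    then show "set_pmf \<pi> \<subseteq> S \<and> \<pi> \<bind> K = \<pi>" using True by (simp add: pmf_eqI)
  next
    assume "set_pmf \<pi> \<subseteq> S \<and> \<pi> \<bind> K = \<pi>"
    then show "stationary_distribution P X S \<pi>"
      using * by (simp add: stationary_distribution_def)
  qed
qed (simp add: stationary_distribution_def)

text \<open>
  The upper bound on the drift from arbitrary states is what makes the pair of two independent copies recurrent. If
  only one copy is outside the sublevel set, its decrease \<open>3\<eta>\<close> has to outweigh the increase of the other,
  which is at most \<open>\<eta>\<close>. That \<open>c\<close> is accessible in every large enough number of steps allows the
  copies to be at \<open>c\<close> at the same time.
\<close>

theorem foster_lyapunov:
  fixes V :: "'x \<Rightarrow> nat" and \<eta> :: real
  assumes sublevel: "finite {x. V x \<le> L}"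
    and pos: "\<eta> > 0"
    and drift: "\<And>x. (\<integral>\<^sup>+ \<omega>. V (X T \<omega>) \<partial>P x) \<le> of_nat (V x) + ennreal \<eta>"
      "\<And>x. V x > L \<Longrightarrow> (\<integral>\<^sup>+ \<omega>. V (X T \<omega>) \<partial>P x) + ennreal (3 * \<eta>) \<le> of_nat (V x)"
    and fin: "\<And>t x. (\<integral>\<^sup>+ \<omega>. V (X t \<omega>) \<partial>P x) < \<infinity>"
    and access: "\<And>x. \<exists>N\<^sub>0. \<forall>N\<ge>N\<^sub>0. c \<in> set_pmf (kpow K N x)"
    and S: "\<And>y. y \<in> S \<longleftrightarrow> (\<exists>t. y \<in> set_pmf (kpow K t c))"
  shows "positive_recurrent P X S \<and>
         (\<exists>!\<pi>. stationary_distribution P X S \<pi>) \<and>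
         (\<forall>\<pi>. stationary_distribution P X S \<pi> \<longrightarrow>
            (\<forall>x\<in>S. \<forall>C\<subseteq>S. (\<lambda>t. prob_at P X x t C) \<longlonglongrightarrow> measure_pmf.prob \<pi> C))"
proof -
  let ?C = "{x. V x \<le> L}"
  note int_V = nn_integral_X[where \<phi>="\<lambda>y. of_nat (V y)"]
  note fin' = fin[unfolded int_V] and drift' = drift[unfolded int_V]
  have cS: "c \<in> S" using S[of c] by (auto intro: exI[of _ 0])
  have closed: "set_pmf (K x) \<subseteq> S" if "x \<in> S" for x
  proof
    fix y assume "y \<in> set_pmf (K x)"
    moreover from that S obtain t where "x \<in> set_pmf (kpow K t c)" by blast
    ultimately have "y \<in> set_pmf (kpow K (Suc t) c)" unfolding kpow_Suc_right by auto
    then show "y \<in> S" using S by blast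
  qed
  have common: "\<exists>N\<^sub>0. \<forall>N\<ge>N\<^sub>0. \<forall>x\<in>?C. c \<in> set_pmf (kpow K N x)"
  proof -
    from access obtain N0 where N0: "\<And>x N. N \<ge> N0 x \<Longrightarrow> c \<in> set_pmf (kpow K N x)" by metis
    have "N0 x \<le> Max (N0 ` ?C)" if "x \<in> ?C" for x using sublevel that by simp
    then show ?thesis using N0 by (metis order_trans)
  qed
  have uniform: "\<exists>N p. p > 0 \<and> (\<forall>x\<in>?C. p \<le> pmf (kpow K (Suc N) x) y)" if y: "y \<in> S" for y
  proof -
    from common obtain N0 where N0: "\<And>x N. N \<ge> N0 \<Longrightarrow> x \<in> ?C \<Longrightarrow> c \<in> set_pmf (kpow K N x)" by blast
    from y S obtain t where t: "y \<in> set_pmf (kpow K t c)" by blast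
    have mem: "y \<in> set_pmf (kpow K (Suc N0 + t) x)" if "x \<in> ?C" for x
      unfolding kpow_add using t N0[of "Suc N0" x] that by auto
    define p where "p = Min (insert 1 ((\<lambda>x. pmf (kpow K (Suc (N0 + t)) x) y) ` ?C))"
    have "p > 0" unfolding p_def using sublevel mem by (subst Min_gr_iff) (auto simp: pmf_positive)
    moreover have "p \<le> pmf (kpow K (Suc (N0 + t)) x) y" if "x \<in> ?C" for x
      unfolding p_def using sublevel that by (intro Min_le) auto
    ultimately show ?thesis by blast
  qed
  define r where "r x = enn2real (\<integral>\<^sup>+ y. V y \<partial>kpow K T x)" for x
  have r: "(\<integral>\<^sup>+ y. V y \<partial>kpow K T x) = ennreal (r x)" "0 \<le> r x" for x
    using fin'[where t=T and x=x] by (simp_all add: r_def less_top)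
  have r_le: "r x \<le> V x + \<eta>" for x
    using drift'(1)[of x] pos unfolding r unfolding ennreal_of_nat_eq_real_of_nat
    by (simp flip: ennreal_plus)
  have r_out: "r x + 3 * \<eta> \<le> V x" if "x \<notin> ?C" for x
    using drift'(2)[of x] pos that r(2)[of x] unfolding r unfolding ennreal_of_nat_eq_real_of_nat
    by (simp flip: ennreal_plus)
  have avoid_fin: "(\<Sum>t. avoid K y t x) < \<infinity>" if y: "y \<in> S" for x y
  proof -
    from uniform[OF y] obtain N p where p: "p > 0" "\<forall>x\<in>?C. p \<le> pmf (kpow K (Suc N) x) y" by blast
    show ?thesis
    proof (rule foster[where V="\<lambda>x. of_nat (V x)" and \<eta>="3 * \<eta>" and b="4 * \<eta>" and C="?C" and T=T and p=p and N=N])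
      show "(\<integral>\<^sup>+ y. of_nat (V y) \<partial>kpow K T x) + ennreal (3 * \<eta>) \<le> of_nat (V x) + ennreal (4 * \<eta> * indicator ?C x)" for x
        using r_le[of x] r_out[of x] r(2)[of x] pos unfolding r unfolding ennreal_of_nat_eq_real_of_nat
        by (cases "x \<in> ?C") (simp_all flip: ennreal_plus)
      show "(\<integral>\<^sup>+ y. of_nat (V y) \<partial>kpow K k x) < \<infinity>" for k x by (rule fin')
      show "p \<le> pmf (kpow K (Suc N) x) y" if "x \<in> ?C" for x using p that by blast
    qed (use pos p in auto)
  qed
  have meet: "(\<Sum>t. avoid (kprod K) (c, c) t z) < \<infinity>" for z
  proof -
    from uniform[OF cS] obtain N p where p: "p > 0" "\<And>x. x \<in> ?C \<Longrightarrow> p \<le> pmf (kpow K (Suc N) x) c" by blast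
    let ?V = "\<lambda>z. of_nat (V (fst z)) + of_nat (V (snd z)) :: ennreal"
    have int: "(\<integral>\<^sup>+ y. ?V y \<partial>kpow (kprod K) t z)
        = (\<integral>\<^sup>+ y. V y \<partial>kpow K t (fst z)) + (\<integral>\<^sup>+ y. V y \<partial>kpow K t (snd z))" for t z
      unfolding kpow_kprod by (simp add: nn_integral_pair_pmf' nn_integral_add)
    show ?thesis
    proof (rule foster[where V="?V" and \<eta>="2 * \<eta>" and b="4 * \<eta>" and C="?C \<times> ?C" and T=T and p="p * p" and N=N])
      show "(\<integral>\<^sup>+ y. ?V y \<partial>kpow (kprod K) t z) < \<infinity>" for t z
        unfolding int using fin'[of t "fst z"] fin'[of t "snd z"] by simp
      show "p * p \<le> pmf (kpow (kprod K) (Suc N) z) (c, c)" if "z \<in> ?C \<times> ?C" for z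
        unfolding kpow_kprod pmf_pair using p that by (intro mult_mono) (auto simp del: kpow.simps)
      show "(\<integral>\<^sup>+ y. ?V y \<partial>kpow (kprod K) T z) + ennreal (2 * \<eta>)
          \<le> ?V z + ennreal (4 * \<eta> * indicator (?C \<times> ?C) z)" for z
      proof -
        have "r (fst z) + r (snd z) + 2 * \<eta> \<le> V (fst z) + V (snd z) + 4 * \<eta> * indicator (?C \<times> ?C) z"
        proof (cases "z \<in> ?C \<times> ?C")
          case True
          then show ?thesis using r_le[of "fst z"] r_le[of "snd z"] by simp
        next
          case False
          then consider "fst z \<notin> ?C" | "snd z \<notin> ?C" by (metis mem_Times_iff)
          then have "r (fst z) + r (snd z) + 2 * \<eta> \<le> V (fst z) + V (snd z)"
            using r_le[of "fst z"] r_le[of "snd z"] r_out[of "fst z"] r_out[of "snd z"] by cases linarith+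
          then show ?thesis using False by simp
        qed
        then have "ennreal (r (fst z) + r (snd z) + 2 * \<eta>)
            \<le> ennreal (V (fst z) + V (snd z) + 4 * \<eta> * indicator (?C \<times> ?C) z)"
          by (rule ennreal_leI)
        moreover have "(\<integral>\<^sup>+ y. ?V y \<partial>kpow (kprod K) T z) = ennreal (r (fst z)) + ennreal (r (snd z))"
          by (simp only: int r(1))
        ultimately show ?thesis
          using pos r(2)[of "fst z"] r(2)[of "snd z"] unfolding ennreal_of_nat_eq_real_of_nat
          by (cases "z \<in> ?C \<times> ?C") (simp_all add: ennreal_plus)
      qed
    qed (use pos p in auto)
  qed
  have S_eq: "{y. \<exists>t. y \<in> set_pmf (kpow K t c)} = S"
    unfolding set_eq_iff mem_Collect_eq S by simp
  obtain \<pi> where \<pi>: "\<pi> \<bind> K = \<pi>" "set_pmf \<pi> \<subseteq> S"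
    by (rule stationary_exists[OF avoid_fin[OF cS, of c], unfolded S_eq])
  have conv: "(\<lambda>t. prob_at P X x t C) \<longlonglongrightarrow> measure_pmf.prob \<pi>' C" if "stationary_distribution P X S \<pi>'" for \<pi>' x C
  proof -
    have "\<pi>' \<bind> K = \<pi>'" using that stationary_distribution_iff[OF closed] by simp
    then show ?thesis unfolding prob_at_eq by (rule kpow_tendsto_stationary[OF meet])
  qed
  have "\<exists>!\<pi>. stationary_distribution P X S \<pi>"
  proof (rule ex1I)
    show st: "stationary_distribution P X S \<pi>"
      using \<pi> stationary_distribution_iff[OF closed] by simp
    fix \<pi>' assume st': "stationary_distribution P X S \<pi>'"
    show "\<pi>' = \<pi>"
      using LIMSEQ_unique[OF conv[OF st', where x=c] conv[OF st, where x=c]]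
      by (intro pmf_eqI) (simp flip: measure_pmf_single)
  qed
  moreover have "positive_recurrent P X S"
    unfolding positive_recurrent_def nn_integral_hitting_time by (intro ballI avoid_fin)
  ultimately show ?thesis by (intro conjI allI impI ballI conv)
qed

end

section \<open>Work along a path of the queues\<close>

text \<open>
  The multiple of the deviation \<open>D\<close> by which the work of a subsystem of \<open>k\<close> servers can exceed its linear growth.
  In the step for \<open>Suc k\<close> servers, the bracket with \<open>/ \<delta>\<close> bounds the block length divided by \<open>D\<close>;
  per slot of a block, \<open>Suc k * smax\<close> accounts for the threshold above which some server stays busy, and
  \<open>2 * \<rho>\<close> for the arrivals of two blocks.
\<close>

primrec burst_const :: "real \<Rightarrow> nat \<Rightarrow> nat \<Rightarrow> real \<Rightarrow> real" where
  "burst_const \<rho> smax 0 \<delta> = 0"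
| "burst_const \<rho> smax (Suc k) \<delta> =
     (real (Suc k * smax) + 2 * \<rho>) * (2 * (burst_const \<rho> smax k (\<delta> / 2) + 2 + real (Suc k) + real (Suc k * smax)) / \<delta> + 1) + 2"

lemma burst_const_nonneg: "\<rho> \<ge> 0 \<Longrightarrow> \<delta> > 0 \<Longrightarrow> burst_const \<rho> smax k \<delta> \<ge> 0"
  by (induction k arbitrary: \<delta>) simp_all

text \<open>
  The deterministic part of the model: one path of queues \<open>q\<close>, last idle server \<open>l\<close>, batches \<open>a\<close>, routed
  jobs \<open>r\<close> and capacities \<open>s\<close>. How a batch is divided among idle servers is left open.
\<close>

locale queue_path =
  fixes q :: "nat \<Rightarrow> 'n::finite \<Rightarrow> nat" and l :: "nat \<Rightarrow> 'n"
    and a :: "nat \<Rightarrow> nat" and r s :: "nat \<Rightarrow> 'n \<Rightarrow> nat" and smax :: nat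
  assumes q_Suc: "q (Suc t) i = q t i + r (Suc t) i - s (Suc t) i"
    and sum_r: "(\<Sum>i\<in>UNIV. r (Suc t) i) = a (Suc t)"
    and s_le: "s (Suc t) i \<le> smax"
    and r_idle: "idle (q t) \<noteq> {} \<Longrightarrow> i \<notin> idle (q t) \<Longrightarrow> r (Suc t) i = 0"
    and l_idle: "idle (q t) \<noteq> {} \<Longrightarrow> l (Suc t) \<in> idle (q t)"
    and r_busy: "idle (q t) = {} \<Longrightarrow> i \<noteq> l (Suc t) \<Longrightarrow> r (Suc t) i = 0"
    and l_busy: "idle (q t) = {} \<Longrightarrow> l (Suc t) = l t"
begin

definition work :: "'n set \<Rightarrow> nat \<Rightarrow> real" where
  "work S t = (\<Sum>i\<in>S. real (q t i))"

text \<open>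
  On this time interval the servers outside \<open>S\<close> are busy and receive nothing, so that \<open>S\<close> by itself behaves like
  a complete system: every arrival goes to \<open>S\<close>, and an idle server is in \<open>S\<close>.
\<close>

definition confined :: "'n set \<Rightarrow> nat \<Rightarrow> nat \<Rightarrow> bool" where
  "confined S t1 t2 \<longleftrightarrow> (\<forall>i\<in>-S. (\<forall>t\<in>{t1..t2}. q t i > 0) \<and> (\<forall>t\<in>{t1<..t2}. r t i = 0))"

text \<open>
  Only one side of each deviation matters: too many arrivals and too little service.
\<close>

definition deviation_le :: "real \<Rightarrow> ('n \<Rightarrow> real) \<Rightarrow> real \<Rightarrow> nat \<Rightarrow> nat \<Rightarrow> bool" where
  "deviation_le \<rho> \<mu> D t1 t2 \<longleftrightarrow> (\<forall>u v. t1 \<le> u \<longrightarrow> u \<le> v \<longrightarrow> v \<le> t2 \<longrightarrow>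
     (\<Sum>t\<in>{u<..v}. real (a t)) \<le> \<rho> * real (v - u) + D \<and>
     (\<forall>i. \<mu> i * real (v - u) - D \<le> (\<Sum>t\<in>{u<..v}. real (s t i))))"

lemma work_empty [simp]: "work {} t = 0" by (simp add: work_def)
lemma work_nonneg [simp]: "0 \<le> work S t" by (simp add: work_def sum_nonneg)

lemma confined_mono: "confined S t1 t2 \<Longrightarrow> t1 \<le> u \<Longrightarrow> v \<le> t2 \<Longrightarrow> confined S u v"
  by (auto simp: confined_def)

lemma deviation_le_mono: "deviation_le \<rho> \<mu> D t1 t2 \<Longrightarrow> t1 \<le> u \<Longrightarrow> v \<le> t2 \<Longrightarrow> deviation_le \<rho> \<mu> D u v"
  by (auto simp: deviation_le_def)

lemma confined_UNIV [simp]: "confined UNIV t1 t2"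
  by (simp add: confined_def)

lemma queue_decrease: "q t i \<le> q (t + k) i + k * smax"
proof (induction k)
  case (Suc k)
  have "q (t + k) i \<le> q (t + Suc k) i + smax"
    using q_Suc[of "t + k" i] s_le[of "t + k" i] by simp
  then show ?case using Suc by simp
qed simp

lemma queue_step_eq:
  "q (Suc t) i > 0 \<Longrightarrow> real (q (Suc t) i) = real (q t i) + real (r (Suc t) i) - real (s (Suc t) i)"
  using q_Suc[of t i] by linarith

lemma queue_step_le: "real (q (Suc t) i) \<le> real (q t i) + real (r (Suc t) i) - real (s (Suc t) i) + real smax"
  using q_Suc[of t i] s_le[of t i] by linarith

lemma sum_r_confined:
  assumes "confined S t1 t2" "t1 \<le> t" "t < t2"
  shows "(\<Sum>i\<in>S. real (r (Suc t) i)) = real (a (Suc t))"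
proof -
  have "(\<Sum>i\<in>S. r (Suc t) i) = (\<Sum>i\<in>UNIV. r (Suc t) i)"
    using assms by (intro sum.mono_neutral_left) (auto simp: confined_def)
  then show ?thesis by (simp add: sum_r flip: of_nat_sum)
qed

lemma work_growth:
  assumes "confined S t1 t2" "t1 \<le> t2"
  shows "work S t2 \<le> work S t1 + (\<Sum>t\<in>{t1<..t2}. real (a t))"
  using assms(2,1)
proof (induction t2 rule: dec_induct)
  case (step t)
  have "work S (Suc t) \<le> work S t + (\<Sum>i\<in>S. real (r (Suc t) i))"
    unfolding work_def sum.distrib[symmetric]
    by (intro sum_mono) (simp add: q_Suc)
  moreover have "{t1<..Suc t} = insert (Suc t) {t1<..t}" using step by auto
  ultimately show ?case
    using step confined_mono[OF step.prems, of t1 t] sum_r_confined[OF step.prems, of t] by simp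
qed simp

text \<open>
  Service is lost in a slot only if the queue is empty at its end.
\<close>

lemma work_no_idle:
  assumes "confined S t1 t2" "t1 \<le> t2"
    and busy: "\<And>t i. t1 < t \<Longrightarrow> t \<le> t2 \<Longrightarrow> i \<in> S \<Longrightarrow> q t i > 0"
  shows "work S t2 = work S t1 + (\<Sum>t\<in>{t1<..t2}. real (a t)) - (\<Sum>i\<in>S. \<Sum>t\<in>{t1<..t2}. real (s t i))"
  using assms(2,1,3)
proof (induction t2 rule: dec_induct)
  case (step t)
  have "work S (Suc t) = (\<Sum>i\<in>S. real (q t i) + real (r (Suc t) i) - real (s (Suc t) i))"
    unfolding work_def by (intro sum.cong queue_step_eq step.prems(2)) (use step in auto)
  also have "\<dots> = work S t + real (a (Suc t)) - (\<Sum>i\<in>S. real (s (Suc t) i))"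
    using sum_r_confined[OF step.prems(1), of t] step by (simp add: work_def sum.distrib sum_subtractf)
  finally have "work S (Suc t) = work S t + real (a (Suc t)) - (\<Sum>i\<in>S. real (s (Suc t) i))" .
  moreover have "{t1<..Suc t} = insert (Suc t) {t1<..t}" using step by auto
  moreover have "work S t = work S t1 + (\<Sum>t\<in>{t1<..t}. real (a t)) - (\<Sum>i\<in>S. \<Sum>t\<in>{t1<..t}. real (s t i))"
    using step.prems by (intro step.IH) (auto intro: confined_mono)
  ultimately show ?case by (simp add: sum.distrib)
qed (simp add: sum_subtractf)

text \<open>
  Up to the first slot that ends with an idle server, capacity is lost only in that last slot, and then at most
  \<open>smax\<close> per server.
\<close>

lemma work_until_idle:
  fixes D \<rho> :: real
  assumes conf: "confined S t1 t2" and le: "t1 \<le> t2" and dev: "deviation_le \<rho> \<mu> D t1 t2"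
    and busy: "\<And>t i. t1 \<le> t \<Longrightarrow> t < t2 \<Longrightarrow> i \<in> S \<Longrightarrow> q t i > 0"
  shows "work S t2 \<le> work S t1 + (\<rho> - sum \<mu> S) * real (t2 - t1) + (1 + card S) * D + card S * smax"
proof (cases "t1 = t2")
  case True
  have "D \<ge> 0" using dev[unfolded deviation_le_def, rule_format, of t1 t1] True by simp
  then show ?thesis using True by simp
next
  case False
  define t where "t = t2 - 1"
  have t: "t2 = Suc t" "t1 \<le> t" using False le by (auto simp: t_def)
  have "work S t = work S t1 + (\<Sum>t\<in>{t1<..t}. real (a t)) - (\<Sum>i\<in>S. \<Sum>t\<in>{t1<..t}. real (s t i))"
    using t by (intro work_no_idle confined_mono[OF conf] busy) auto
  moreover have "work S t2 \<le> (\<Sum>i\<in>S. real (q t i) + real (r (Suc t) i) - real (s (Suc t) i) + real smax)"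
    unfolding work_def t(1) by (intro sum_mono queue_step_le)
  moreover have "\<dots> = work S t + real (a (Suc t)) - (\<Sum>i\<in>S. real (s (Suc t) i)) + card S * smax"
    using sum_r_confined[OF conf t(2)] t(1) by (simp add: work_def sum.distrib sum_subtractf)
  moreover have "{t1<..t2} = insert (Suc t) {t1<..t}" using t by auto
  ultimately have "work S t2 \<le> work S t1 + (\<Sum>t\<in>{t1<..t2}. real (a t))
      - (\<Sum>i\<in>S. \<Sum>t\<in>{t1<..t2}. real (s t i)) + card S * smax"
    by (simp add: sum.distrib)
  moreover have "(\<Sum>t\<in>{t1<..t2}. real (a t)) \<le> \<rho> * real (t2 - t1) + D"
    using dev le by (simp add: deviation_le_def)
  moreover have "(\<Sum>i\<in>S. \<mu> i * real (t2 - t1) - D) \<le> (\<Sum>i\<in>S. \<Sum>t\<in>{t1<..t2}. real (s t i))"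
    using dev le by (intro sum_mono) (simp add: deviation_le_def)
  ultimately show ?thesis
    by (simp add: sum_subtractf sum_distrib_right[symmetric] algebra_simps)
qed

text \<open>
  The persistence of the policy: once a server has been idle, the last idle server is one that was idle since then,
  hence never the busy server \<open>j\<close>. So \<open>j\<close> receives nothing any more.
\<close>

lemma confined_remove:
  assumes conf: "confined S t1 t2" and idle: "idle (q t1) \<noteq> {}"
    and busy: "\<And>t. t1 \<le> t \<Longrightarrow> t \<le> t2 \<Longrightarrow> q t j > 0"
  shows "confined (S - {j}) t1 t2"
proof -
  have l: "l (Suc t) \<noteq> j" if "t1 \<le> t" "t < t2" for t
    using that
  proof (induction t rule: dec_induct)
    case base
    then show ?case using l_idle[OF idle] busy[of t1] by (auto simp: idle_def)
  next
    case (step t)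
    then show ?case
      using l_idle[of "Suc t"] l_busy[of "Suc t"] busy[of "Suc t"] by (cases "idle (q (Suc t)) = {}") (auto simp: idle_def)
  qed
  have "r t j = 0" if "t \<in> {t1<..t2}" for t
  proof -
    define u where "u = t - 1"
    have u: "t = Suc u" "t1 \<le> u" "u < t2" using that by (auto simp: u_def)
    show ?thesis
      using r_idle[of u j] r_busy[of u j] l[OF u(2,3)] busy[of u] u by (cases "idle (q u) = {}") (auto simp: idle_def)
  qed
  then show ?thesis using conf busy by (auto simp: confined_def)
qed

lemma queue_drains:
  assumes "t1 \<le> t2" and "\<And>t. t1 \<le> t \<Longrightarrow> t \<le> t2 \<Longrightarrow> q t j > 0" and "\<And>t. t1 < t \<Longrightarrow> t \<le> t2 \<Longrightarrow> r t j = 0"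
  shows "real (q t2 j) = real (q t1 j) - (\<Sum>t\<in>{t1<..t2}. real (s t j))"
  using assms
proof (induction t2 rule: dec_induct)
  case (step t)
  have "{t1<..Suc t} = insert (Suc t) {t1<..t}" using step by auto
  moreover have "real (q t j) = real (q t1 j) - (\<Sum>t\<in>{t1<..t}. real (s t j))"
    using step by simp
  moreover have "real (q (Suc t) j) = real (q t j) - real (s (Suc t) j)"
    using queue_step_eq[of t j] step.prems(1)[of "Suc t"] step.prems(2)[of "Suc t"] step.hyps by simp
  ultimately show ?case by simp
qed simp

text \<open>
  Split the interval at the first idle slot \<open>e\<close>. Before \<open>e\<close>, the work changes at rate \<open>\<rho> - \<mu>\<^sub>S\<close>.
  After \<open>e\<close>, server \<open>j\<close> drains at rate \<open>\<mu>\<^sub>j\<close> and the rest grows at rate at most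
  \<open>max 0 (\<rho> - \<mu>\<^sub>S + \<mu>\<^sub>j)\<close>, by the assumption \<open>sub\<close> on the smaller system; the sum is the larger of
  \<open>\<rho> - \<mu>\<^sub>S\<close> and \<open>- \<mu>\<^sub>j\<close>.
\<close>

lemma drift_with_busy_server:
  fixes D C \<delta> \<rho> :: real
  assumes conf: "confined S t1 t2" and le: "t1 \<le> t2" and dev: "deviation_le \<rho> \<mu> D t1 t2"
    and j: "j \<in> S" "q t1 j > (t2 - t1) * smax"
    and D: "D \<ge> 1" and \<delta>: "\<delta> \<ge> 0"
    and sub: "\<And>e. t1 \<le> e \<Longrightarrow> e \<le> t2 \<Longrightarrow> confined (S - {j}) e t2 \<Longrightarrow>
      work (S - {j}) t2 \<le> work (S - {j}) e + (max 0 (\<rho> - sum \<mu> (S - {j})) + \<delta>) * real (t2 - e) + C * D"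
    and C: "C \<ge> 0"
  shows "work S t2 \<le> work S t1 + (max (\<rho> - sum \<mu> S) (- \<mu> j) + \<delta>) * real (t2 - t1)
    + (C + 2 + card S + card S * smax) * D"
proof -
  define g where "g = max (\<rho> - sum \<mu> S) (- \<mu> j)"
  have busy: "q t j > 0" if "t1 \<le> t" "t \<le> t2" for t
  proof -
    have "(t - t1) * smax \<le> (t2 - t1) * smax" using that by (intro mult_right_mono diff_le_mono) auto
    moreover have "q t1 j \<le> q t j + (t - t1) * smax" using queue_decrease[of t1 j "t - t1"] that by simp
    ultimately show ?thesis using j(2) by linarith
  qed
  have first: "work S e \<le> work S t1 + g * real (e - t1) + (1 + card S + card S * smax) * D"
    if e: "t1 \<le> e" "e \<le> t2" and b: "\<And>t i. t1 \<le> t \<Longrightarrow> t < e \<Longrightarrow> i \<in> S \<Longrightarrow> q t i > 0" for e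
  proof -
    have "work S e \<le> work S t1 + (\<rho> - sum \<mu> S) * real (e - t1) + (1 + card S) * D + card S * smax"
      by (rule work_until_idle[OF confined_mono[OF conf] e(1) deviation_le_mono[OF dev] b]) (use e in auto)
    moreover have "(\<rho> - sum \<mu> S) * real (e - t1) \<le> g * real (e - t1)"
      by (intro mult_right_mono) (auto simp: g_def)
    moreover have "real (card S * smax) * 1 \<le> real (card S * smax) * D"
      by (intro mult_left_mono D) simp
    ultimately show ?thesis by (simp add: algebra_simps)
  qed
  show ?thesis
  proof (cases "\<exists>t. t1 \<le> t \<and> t < t2 \<and> (\<exists>i\<in>S. q t i = 0)")
    case False
    then have "work S t2 \<le> work S t1 + g * real (t2 - t1) + (1 + card S + card S * smax) * D"
      using le by (intro first) auto
    moreover have "0 \<le> \<delta> * real (t2 - t1) + (C + 1) * D" using \<delta> C D by simp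
    ultimately show ?thesis by (simp add: g_def algebra_simps)
  next
    case True
    define e where "e = (LEAST t. t1 \<le> t \<and> t < t2 \<and> (\<exists>i\<in>S. q t i = 0))"
    have e: "t1 \<le> e" "e < t2" "\<exists>i\<in>S. q e i = 0"
      using LeastI_ex[OF True] by (auto simp: e_def)
    have least: "q t i > 0" if "t1 \<le> t" "t < e" "i \<in> S" for t i
      using not_less_Least[of t "\<lambda>t. t1 \<le> t \<and> t < t2 \<and> (\<exists>i\<in>S. q t i = 0)"] that e by (force simp: e_def)
    have conf': "confined (S - {j}) e t2"
      using e busy by (intro confined_remove confined_mono[OF conf]) (auto simp: idle_def)
    have A: "work (S - {j}) t2 \<le> work (S - {j}) e + (max 0 (\<rho> - sum \<mu> (S - {j})) + \<delta>) * real (t2 - e) + C * D"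
      using e by (intro sub conf') auto
    have "real (q t2 j) = real (q e j) - (\<Sum>t\<in>{e<..t2}. real (s t j))"
      using e busy conf' by (intro queue_drains) (auto simp: confined_def)
    moreover have "\<mu> j * real (t2 - e) - D \<le> (\<Sum>t\<in>{e<..t2}. real (s t j))"
      using dev e by (simp add: deviation_le_def)
    ultimately have B: "real (q t2 j) \<le> real (q e j) - \<mu> j * real (t2 - e) + D" by linarith
    have split: "work S t = work (S - {j}) t + real (q t j)" for t
      unfolding work_def using j(1) by (subst sum.remove[of S j]) auto
    have "sum \<mu> S = sum \<mu> (S - {j}) + \<mu> j"
      using j(1) by (subst sum.remove[of S j]) auto
    then have g: "max 0 (\<rho> - sum \<mu> (S - {j})) - \<mu> j = g" by (auto simp: g_def)
    have C': "work S t2 \<le> work S e + (g + \<delta>) * real (t2 - e) + (C + 1) * D"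
      using A B unfolding split g[symmetric] by (simp add: algebra_simps)
    have "work S e \<le> work S t1 + g * real (e - t1) + (1 + card S + card S * smax) * D"
      using e least by (intro first) auto
    moreover have "g * real (t2 - t1) = g * real (e - t1) + g * real (t2 - e)"
      using e by (simp add: of_nat_diff algebra_simps)
    moreover have "\<delta> * real (t2 - e) \<le> \<delta> * real (t2 - t1)"
      using e \<delta> by (intro mult_left_mono) auto
    ultimately show ?thesis using C' by (simp add: g_def[symmetric] algebra_simps)
  qed
qed

text \<open>
  Each application of the previous lemma costs a multiple of \<open>D\<close>, so it must not be used too often. In blocks of
  length \<open>b\<close> proportional to \<open>D / \<delta>\<close> this cost is absorbed by an extra growth rate \<open>\<delta> / 2\<close>.
  A block that starts with more work than \<open>M\<close> has a server that stays busy in it. Otherwise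
  the work after the block is at most \<open>M\<close> plus one block of arrivals, independently of the past.
\<close>

lemma work_bound:
  fixes D \<delta> \<rho> :: real
  assumes conf: "confined S t1 t2" and le: "t1 \<le> t2" and dev: "deviation_le \<rho> \<mu> D t1 t2"
    and D: "D \<ge> 1" and \<delta>: "\<delta> > 0" and \<rho>: "\<rho> \<ge> 0" and \<mu>: "\<And>i. \<mu> i \<ge> 0"
  shows "work S t2 \<le> work S t1 + (max 0 (\<rho> - sum \<mu> S) + \<delta>) * real (t2 - t1)
           + burst_const \<rho> smax (card S) \<delta> * D"
  using conf le dev \<delta>
proof (induction "card S" arbitrary: S t1 t2 \<delta>)
  case 0
  then have "S = {}" by simp
  then show ?case using 0 by simp
next
  case (Suc k)
  define g where "g = max 0 (\<rho> - sum \<mu> S)"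
  define C where "C = burst_const \<rho> smax k (\<delta> / 2)"
  define C1 where "C1 = C + 2 + Suc k + Suc k * smax"
  define b where "b = nat \<lceil>2 * C1 * D / \<delta>\<rceil>"
  note conf = Suc.prems(1) and le = Suc.prems(2) and dev = Suc.prems(3) and \<delta> = Suc.prems(4)
  have k: "card S = Suc k" using Suc.hyps(2) by simp
  have C: "C \<ge> 0" unfolding C_def using \<rho> \<delta> by (intro burst_const_nonneg) auto
  have C1: "C1 \<ge> 2" unfolding C1_def using C by simp
  have quot: "2 * C1 * D / \<delta> > 0" using C1 D \<delta> by simp
  then have b_pos: "b > 0" unfolding b_def by (simp del: zero_less_divide_iff)
  have b_lower: "2 * C1 * D / \<delta> \<le> b" unfolding b_def by (rule of_nat_ceiling)
  have b_upper: "b \<le> (2 * C1 / \<delta> + 1) * D"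
  proof -
    have "real b \<le> 2 * C1 * D / \<delta> + 1" unfolding b_def using quot by linarith
    then show ?thesis using D by (simp add: algebra_simps)
  qed
  define M where "M = real (Suc k * (b * smax))"
  define G where "G = \<rho> * b + D"
  have G: "G \<ge> 0" using \<rho> D by (simp add: G_def)
  have growth: "work S v \<le> work S u + G" if "t1 \<le> u" "u \<le> v" "v \<le> t2" "v - u \<le> b" for u v
  proof -
    have "work S v \<le> work S u + (\<Sum>t\<in>{u<..v}. real (a t))"
      using that by (intro work_growth confined_mono[OF conf]) auto
    moreover have "(\<Sum>t\<in>{u<..v}. real (a t)) \<le> \<rho> * real (v - u) + D"
      using dev that by (simp add: deviation_le_def)
    moreover have "\<rho> * real (v - u) \<le> \<rho> * b" using that \<rho> by (intro mult_left_mono) auto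
    ultimately show ?thesis by (simp add: G_def)
  qed
  have block: "work S (u + b) \<le> work S u + (g + \<delta>) * b"
    if u: "t1 \<le> u" "u + b \<le> t2" and large: "work S u > M" for u
  proof -
    have "\<exists>j\<in>S. q u j > b * smax"
    proof (rule ccontr)
      assume "\<not> (\<exists>j\<in>S. q u j > b * smax)"
      then have "work S u \<le> (\<Sum>i\<in>S. real (b * smax))"
        unfolding work_def by (intro sum_mono) (simp add: not_less del: of_nat_mult)
      then show False using large k by (simp add: M_def algebra_simps)
    qed
    then obtain j where j: "j \<in> S" "q u j > b * smax" by blast
    have "work S (u + b) \<le> work S u + (max (\<rho> - sum \<mu> S) (- \<mu> j) + \<delta> / 2) * real (u + b - u)
        + (C + 2 + card S + card S * smax) * D"
    proof (rule drift_with_busy_server)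
      show "confined S u (u + b)" "deviation_le \<rho> \<mu> D u (u + b)"
        using u conf dev by (auto intro: confined_mono deviation_le_mono)
      fix e assume e: "u \<le> e" "e \<le> u + b" "confined (S - {j}) e (u + b)"
      have "k = card (S - {j})" using k j by simp
      from Suc.hyps(1)[OF this e(3,2) deviation_le_mono[OF dev], of "\<delta> / 2"]
      show "work (S - {j}) (u + b) \<le> work (S - {j}) e
          + (max 0 (\<rho> - sum \<mu> (S - {j})) + \<delta> / 2) * real (u + b - e) + C * D"
        using u e \<delta> k j by (simp add: C_def)
    qed (use j D \<delta> C in auto)
    moreover have "max (\<rho> - sum \<mu> S) (- \<mu> j) * real b \<le> g * real b"
      using \<mu>[of j] by (intro mult_right_mono) (auto simp: g_def)
    moreover have "C1 * D \<le> \<delta> / 2 * b" using b_lower \<delta> by (simp add: field_simps)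
    ultimately show ?thesis using k by (simp add: C1_def algebra_simps)
  qed
  have blocks: "work S (t1 + m * b) \<le> max (work S t1) M + G + (g + \<delta>) * real (m * b)" if "t1 + m * b \<le> t2" for m
    using that
  proof (induction m)
    case 0
    then show ?case using G by simp
  next
    case (Suc m)
    show ?case
    proof (cases "work S (t1 + m * b) > M")
      case True
      then show ?thesis using block[of "t1 + m * b"] Suc by (simp add: algebra_simps)
    next
      case False
      have "0 \<le> (g + \<delta>) * real (Suc m * b)" using \<delta> by (simp add: g_def)
      then show ?thesis using growth[of "t1 + m * b" "t1 + Suc m * b"] False Suc.prems by (simp add: algebra_simps)
    qed
  qed
  define m where "m = (t2 - t1) div b"
  have m: "t1 + m * b \<le> t2" "t2 - (t1 + m * b) \<le> b"
  proof -
    have "t2 - t1 = m * b + (t2 - t1) mod b" by (simp add: m_def)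
    moreover have "(t2 - t1) mod b < b" using b_pos by simp
    ultimately show "t1 + m * b \<le> t2" "t2 - (t1 + m * b) \<le> b" using le by linarith+
  qed
  have "work S t2 \<le> max (work S t1) M + 2 * G + (g + \<delta>) * real (m * b)"
    using blocks[OF m(1)] growth[of "t1 + m * b" t2] m by simp
  moreover have "(g + \<delta>) * real (m * b) \<le> (g + \<delta>) * real (t2 - t1)"
  proof -
    have "m * b \<le> t2 - t1" using m le by linarith
    then show ?thesis using \<delta> by (intro mult_left_mono of_nat_mono) (auto simp: g_def)
  qed
  moreover have "max (work S t1) M \<le> work S t1 + M" by (simp add: M_def)
  moreover have "M + 2 * G \<le> burst_const \<rho> smax (card S) \<delta> * D"
  proof -
    have "M + 2 * G = (real (Suc k * smax) + 2 * \<rho>) * b + 2 * D"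
      by (simp add: M_def G_def algebra_simps)
    also have "\<dots> \<le> (real (Suc k * smax) + 2 * \<rho>) * ((2 * C1 / \<delta> + 1) * D) + 2 * D"
      using \<rho> by (intro add_right_mono mult_left_mono b_upper) simp
    also have "\<dots> = burst_const \<rho> smax (card S) \<delta> * D"
      unfolding k by (simp add: C1_def C_def algebra_simps)
    finally show ?thesis .
  qed
  ultimately have "work S t2 \<le> work S t1 + (g + \<delta>) * real (t2 - t1) + burst_const \<rho> smax (card S) \<delta> * D"
    by linarith
  then show ?case by (simp only: g_def)
qed

lemma total_work_bound:
  fixes D \<delta> \<rho> :: real
  assumes dev: "deviation_le \<rho> \<mu> D 0 T" and D: "D \<ge> 1" and \<delta>: "\<delta> > 0" and \<rho>: "\<rho> \<ge> 0"
    and \<mu>: "\<And>i. \<mu> i \<ge> 0" and load: "\<rho> \<le> sum \<mu> UNIV"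
  shows "work UNIV T \<le> work UNIV 0 + \<delta> * T + burst_const \<rho> smax CARD('n) \<delta> * D"
  using work_bound[OF confined_UNIV le0[of T] dev D \<delta> \<rho> \<mu>] load by simp

lemma total_work_drift:
  fixes D \<delta> \<rho> :: real
  assumes dev: "deviation_le \<rho> \<mu> D 0 T" and D: "D \<ge> 1" and \<delta>: "\<delta> > 0" and \<rho>: "\<rho> \<ge> 0"
    and \<mu>: "\<And>i. \<mu> i \<ge> \<epsilon>" "\<epsilon> \<ge> 0" and load: "\<rho> + \<epsilon> \<le> sum \<mu> UNIV"
    and large: "(\<Sum>i\<in>UNIV. q 0 i) > CARD('n) * (T * smax)"
  shows "work UNIV T \<le> work UNIV 0 + (\<delta> - \<epsilon>) * T
    + (burst_const \<rho> smax (CARD('n) - 1) \<delta> + 2 + CARD('n) + CARD('n) * smax) * D"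
proof -
  have "\<exists>j. q 0 j > T * smax"
  proof (rule ccontr)
    assume "\<not> (\<exists>j. q 0 j > T * smax)"
    then have "(\<Sum>i\<in>UNIV. q 0 i) \<le> (\<Sum>i\<in>(UNIV :: 'n set). T * smax)"
      by (intro sum_mono) (simp add: not_less)
    then show False using large by simp
  qed
  then obtain j where j: "q 0 j > T * smax" by blast
  have \<mu>0: "\<mu> i \<ge> 0" for i using \<mu>(1)[of i] \<mu>(2) by linarith
  have "work UNIV T \<le> work UNIV 0 + (max (\<rho> - sum \<mu> UNIV) (- \<mu> j) + \<delta>) * real (T - 0)
    + (burst_const \<rho> smax (CARD('n) - 1) \<delta> + 2 + CARD('n) + CARD('n) * smax) * D"
  proof (rule drift_with_busy_server[OF confined_UNIV _ dev])
    fix e assume e: "e \<le> T" "confined (UNIV - {j}) e T"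
    have "card (UNIV - {j}) = CARD('n) - 1" by (simp add: card_Diff_singleton)
    then show "work (UNIV - {j}) T \<le> work (UNIV - {j}) e
       + (max 0 (\<rho> - sum \<mu> (UNIV - {j})) + \<delta>) * real (T - e) + burst_const \<rho> smax (CARD('n) - 1) \<delta> * D"
      using work_bound[OF e(2,1) deviation_le_mono[OF dev] D \<delta> \<rho> \<mu>0] by simp
  qed (use j D \<delta> \<rho> in \<open>auto intro: burst_const_nonneg\<close>)
  moreover have "(max (\<rho> - sum \<mu> UNIV) (- \<mu> j) + \<delta>) * real T \<le> (\<delta> - \<epsilon>) * T"
    using load \<mu>(1)[of j] by (intro mult_right_mono) auto
  ultimately show ?thesis by simp
qed

end

section \<open>Deviations of i.i.d. sums from their means\<close>

context prob_space
begin

lemma indep_var_of_indep_vars: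
  assumes ind: "indep_vars (\<lambda>_. N) Y I" and st: "s \<in> I" "t \<in> I" "s \<noteq> t"
    and g: "g \<in> measurable N borel"
  shows "indep_var borel (\<lambda>\<omega>. g (Y s \<omega>)) borel (\<lambda>\<omega>. g (Y t \<omega>))"
proof -
  have comp: "(\<lambda>x. g (x u)) \<in> measurable (PiM {u} (\<lambda>_. N)) borel" for u
    by (rule measurable_compose[OF measurable_component_singleton[of u "{u}" "\<lambda>_. N"] g]) simp
  have "indep_var (PiM {s} (\<lambda>_. N)) (\<lambda>\<omega>. restrict (\<lambda>i. Y i \<omega>) {s}) (PiM {t} (\<lambda>_. N)) (\<lambda>\<omega>. restrict (\<lambda>i. Y i \<omega>) {t})"
    by (rule indep_var_restrict[OF ind]) (use st in auto)
  from indep_var_compose[OF this comp comp] show ?thesis by (simp add: comp_def)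
qed

text \<open>
  The second moment of the centred sum is \<open>n\<close> times the variance, by pairwise uncorrelatedness, and
  \<open>2 |x| \<le> x\<^sup>2 / c + c\<close> with \<open>c = sqrt T\<close> turns this into a bound on the mean absolute value.
\<close>

lemma iid_mean_deviation:
  fixes Y :: "nat \<Rightarrow> 'a \<Rightarrow> nat" and p :: "nat pmf"
  assumes ind: "indep_vars (\<lambda>_. count_space UNIV) Y {1..}"
    and law: "\<And>t. t \<ge> 1 \<Longrightarrow> distr M (count_space UNIV) (Y t) = measure_pmf p"
    and int: "integrable (measure_pmf p) (\<lambda>k. real k)" "integrable (measure_pmf p) (\<lambda>k. (real k)\<^sup>2)"
    and n: "n \<le> T" "T > 0"
  defines "m \<equiv> measure_pmf.expectation p (\<lambda>k. real k)"
  shows "integrable M (\<lambda>\<omega>. \<bar>(\<Sum>t\<in>{0<..n}. real (Y t \<omega>)) - m * n\<bar>)"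
    and "expectation (\<lambda>\<omega>. \<bar>(\<Sum>t\<in>{0<..n}. real (Y t \<omega>)) - m * n\<bar>)
      \<le> (measure_pmf.expectation p (\<lambda>k. (real k - m)\<^sup>2) + 1) / 2 * sqrt T"
proof -
  define v where "v = measure_pmf.expectation p (\<lambda>k. (real k - m)\<^sup>2)"
  define W where "W t \<omega> = real (Y t \<omega>) - m" for t \<omega>
  define S where "S n \<omega> = (\<Sum>t\<in>{0<..n}. W t \<omega>)" for n \<omega>
  have Y: "Y t \<in> measurable M (count_space UNIV)" if "t \<ge> 1" for t
    using ind that by (auto simp: indep_vars_def)
  have int_p: "integrable (measure_pmf p) (\<lambda>k. real k - m)" "integrable (measure_pmf p) (\<lambda>k. (real k - m)\<^sup>2)"
    using int by (simp_all add: power2_diff)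
  have W_int: "integrable M (W t)" "integrable M (\<lambda>\<omega>. (W t \<omega>)\<^sup>2)"
    and W_exp: "expectation (W t) = 0" "expectation (\<lambda>\<omega>. (W t \<omega>)\<^sup>2) = v" if t: "t \<ge> 1" for t
  proof -
    have i: "integrable (distr M (count_space UNIV) (Y t)) g \<longleftrightarrow> integrable M (\<lambda>\<omega>. g (Y t \<omega>))"
      "integral\<^sup>L (distr M (count_space UNIV) (Y t)) g = expectation (\<lambda>\<omega>. g (Y t \<omega>))" for g :: "nat \<Rightarrow> real"
      using Y[OF t] by (simp_all add: integrable_distr_eq integral_distr)
    note i = i[unfolded law[OF t]]
    show "integrable M (W t)" "integrable M (\<lambda>\<omega>. (W t \<omega>)\<^sup>2)"
      using int_p i(1)[of "\<lambda>k. real k - m"] i(1)[of "\<lambda>k. (real k - m)\<^sup>2"] by (simp_all add: W_def[abs_def])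
    have "measure_pmf.expectation p (\<lambda>k. real k - m) = 0" using int by (simp add: m_def)
    then show "expectation (W t) = 0" "expectation (\<lambda>\<omega>. (W t \<omega>)\<^sup>2) = v"
      using i(2)[of "\<lambda>k. real k - m"] i(2)[of "\<lambda>k. (real k - m)\<^sup>2"] by (simp_all add: W_def[abs_def] v_def)
  qed
  have cross: "integrable M (\<lambda>\<omega>. W s \<omega> * W t \<omega>)" "expectation (\<lambda>\<omega>. W s \<omega> * W t \<omega>) = 0"
    if "s \<ge> 1" "t \<ge> 1" "s \<noteq> t" for s t
  proof -
    have iv: "indep_var borel (W s) borel (W t)"
      unfolding W_def[abs_def] by (rule indep_var_of_indep_vars[OF ind]) (use that in auto)
    show "integrable M (\<lambda>\<omega>. W s \<omega> * W t \<omega>)"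
      by (rule indep_var_integrable[OF iv]) (use that W_int in auto)
    show "expectation (\<lambda>\<omega>. W s \<omega> * W t \<omega>) = 0"
      using indep_var_lebesgue_integral[OF iv] that W_int(1) W_exp(1) by simp
  qed
  have S: "integrable M (S n) \<and> integrable M (\<lambda>\<omega>. (S n \<omega>)\<^sup>2) \<and> expectation (\<lambda>\<omega>. (S n \<omega>)\<^sup>2) = n * v" for n
  proof (induction n)
    case (Suc n)
    have "{0<..Suc n} = insert (Suc n) {0<..n}" by auto
    then have SS: "S (Suc n) \<omega> = S n \<omega> + W (Suc n) \<omega>" for \<omega> by (simp add: S_def add.commute)
    have SW: "integrable M (\<lambda>\<omega>. S n \<omega> * W (Suc n) \<omega>)" "expectation (\<lambda>\<omega>. S n \<omega> * W (Suc n) \<omega>) = 0"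
      unfolding S_def sum_distrib_right using cross by (auto intro!: Bochner_Integration.integrable_sum)
    have "(S (Suc n) \<omega>)\<^sup>2 = (S n \<omega>)\<^sup>2 + 2 * (S n \<omega> * W (Suc n) \<omega>) + (W (Suc n) \<omega>)\<^sup>2" for \<omega>
      unfolding SS by (simp add: power2_sum)
    moreover have "integrable M (S (Suc n))"
      using SS[abs_def] Suc W_int(1)[of "Suc n"] by (simp cong: integrable_cong)
    ultimately show ?case
      using Suc SW W_int(2)[of "Suc n"] W_exp(2)[of "Suc n"] by (simp add: algebra_simps)
  qed (simp add: S_def)
  have S_eq: "(\<Sum>t\<in>{0<..n}. real (Y t \<omega>)) - m * n = S n \<omega>" for \<omega>
    by (simp add: S_def W_def sum_subtractf)
  show "integrable M (\<lambda>\<omega>. \<bar>(\<Sum>t\<in>{0<..n}. real (Y t \<omega>)) - m * n\<bar>)"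
    unfolding S_eq using S by (intro integrable_abs) simp
  have c: "sqrt T > 0" using n by simp
  have amgm: "\<bar>x\<bar> \<le> (x\<^sup>2 / sqrt T + sqrt T) / 2" for x
  proof -
    have "0 \<le> (\<bar>x\<bar> - sqrt T)\<^sup>2 / sqrt T" using c by simp
    also have "(\<bar>x\<bar> - sqrt T)\<^sup>2 / sqrt T = x\<^sup>2 / sqrt T + sqrt T - 2 * \<bar>x\<bar>"
      using c by (simp add: power2_eq_square field_simps)
    finally show ?thesis by simp
  qed
  have "expectation (\<lambda>\<omega>. \<bar>S n \<omega>\<bar>) \<le> expectation (\<lambda>\<omega>. ((S n \<omega>)\<^sup>2 / sqrt T + sqrt T) / 2)"
    using S by (intro integral_mono integrable_abs amgm) simp_all
  also have "\<dots> = (n * v / sqrt T + sqrt T) / 2"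
    using S[of n] by (simp add: prob_space)
  also have "\<dots> \<le> (T * v / sqrt T + sqrt T) / 2"
    using n c by (intro divide_right_mono add_right_mono mult_right_mono) (auto simp: v_def)
  also have "T * v / sqrt T = v * sqrt T"
    using n by (simp add: real_div_sqrt field_simps)
  finally show "expectation (\<lambda>\<omega>. \<bar>(\<Sum>t\<in>{0<..n}. real (Y t \<omega>)) - m * n\<bar>)
      \<le> (measure_pmf.expectation p (\<lambda>k. (real k - m)\<^sup>2) + 1) / 2 * sqrt T"
    unfolding S_eq v_def[symmetric] by (simp add: algebra_simps)
qed

end

text \<open>
  For a monotone function, closeness to a line on a grid of mesh \<open>m\<close> gives closeness everywhere. This
  replaces a maximal inequality for the partial sums.
\<close>

lemma grid_deviation:
  fixes c :: "nat \<Rightarrow> real"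
  assumes mono: "mono c" and \<rho>: "\<rho> \<ge> 0" and m: "m > 0"
    and grid: "\<And>g. g \<le> G \<Longrightarrow> \<bar>c (g * m) - \<rho> * real (g * m)\<bar> \<le> d"
    and u: "u \<le> G * m"
  shows "\<bar>c u - \<rho> * real u\<bar> \<le> d + \<rho> * real m"
proof -
  define g where "g = u div m"
  have gm: "g * m \<le> u" "u < Suc g * m"
    using m by (simp_all add: g_def dividend_less_div_times)
  have g: "g \<le> G" unfolding g_def using u m by (metis div_le_mono nonzero_mult_div_cancel_right not_gr_zero)
  have lower: "\<rho> * real u \<le> \<rho> * real (g * m) + \<rho> * real m"
  proof -
    have "real u \<le> real (g * m + m)" using gm(2) unfolding of_nat_le_iff by simp
    then have "real u \<le> real (g * m) + real m" by simp
    then show ?thesis using \<rho> by (metis distrib_left mult_left_mono)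
  qed
  have upper: "\<rho> * real (g * m) \<le> \<rho> * real u" using gm(1) \<rho> by (intro mult_left_mono of_nat_mono)
  have "c (g * m) \<le> c u" using mono gm by (simp add: monoD)
  moreover have "c u \<le> \<rho> * real u + d + \<rho> * real m"
  proof (cases "u = g * m")
    case True
    have "0 \<le> \<rho> * real m" using \<rho> by simp
    with True show ?thesis using grid[OF g] by simp
  next
    case False
    then have "g * m < G * m" using gm(1) u by linarith
    then have "Suc g \<le> G" using m by simp
    from grid[OF this] have "c (Suc g * m) \<le> \<rho> * real (g * m) + \<rho> * real m + d" by (simp add: algebra_simps)
    moreover have "c u \<le> c (Suc g * m)" using mono gm by (simp add: monoD)
    ultimately show ?thesis using upper by linarith
  qed
  ultimately show ?thesis using grid[OF g] lower by linarith
qed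

section \<open>Transition law of the chain\<close>

lemma emeasure_split_countable:
  fixes X :: "'w \<Rightarrow> 'x::countable"
  assumes X: "X \<in> measurable M (count_space UNIV)" and P: "{\<omega> \<in> space M. P \<omega>} \<in> sets M"
  shows "emeasure M {\<omega> \<in> space M. P \<omega>} = (\<integral>\<^sup>+ x. emeasure M {\<omega> \<in> space M. P \<omega> \<and> X \<omega> = x} \<partial>count_space UNIV)"
proof -
  have "{\<omega> \<in> space M. P \<omega>} = (\<Union>x. {\<omega> \<in> space M. P \<omega> \<and> X \<omega> = x})" by auto
  moreover have "emeasure M (\<Union>x. {\<omega> \<in> space M. P \<omega> \<and> X \<omega> = x})
      = (\<integral>\<^sup>+ x. emeasure M {\<omega> \<in> space M. P \<omega> \<and> X \<omega> = x} \<partial>count_space UNIV)"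
  proof (rule emeasure_UN_countable)
    fix x
    have "{\<omega> \<in> space M. P \<omega> \<and> X \<omega> = x} = {\<omega> \<in> space M. P \<omega>} \<inter> (X -` {x} \<inter> space M)" by auto
    then show "{\<omega> \<in> space M. P \<omega> \<and> X \<omega> = x} \<in> sets M"
      using P measurable_sets[OF X, of "{x}"] by simp
  qed (auto simp: disjoint_family_on_def)
  ultimately show ?thesis by simp
qed

lemma measurable_pair_countable:
  fixes X :: "'w \<Rightarrow> 'x::countable" and Y :: "'w \<Rightarrow> 'y::countable"
  assumes "X \<in> measurable M (count_space UNIV)" "Y \<in> measurable M (count_space UNIV)"
  shows "(\<lambda>\<omega>. (X \<omega>, Y \<omega>)) \<in> measurable M (count_space UNIV)"
  using measurable_Pair[OF assms] by (simp add: pair_measure_countable)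

lemma measurable_fun_countable:
  fixes X :: "'n::finite \<Rightarrow> 'w \<Rightarrow> 'x::countable"
  assumes "\<And>i. X i \<in> measurable M (count_space UNIV)"
  shows "(\<lambda>\<omega> i. X i \<omega>) \<in> measurable M (count_space UNIV)"
  unfolding measurable_count_space_eq2_countable
proof (intro conjI ballI)
  fix v :: "'n \<Rightarrow> 'x"
  have "(\<lambda>\<omega> i. X i \<omega>) -` {v} \<inter> space M = {\<omega> \<in> space M. \<forall>i\<in>UNIV. X i \<omega> = v i}" by (auto simp: fun_eq_iff)
  also have "\<dots> \<in> sets M"
    by (intro sets.sets_Collect_finite_All) (use measurable_sets[OF assms, of "{_}"] in \<open>auto simp: vimage_def Int_def conj_commute\<close>)
  finally show "(\<lambda>\<omega> i. X i \<omega>) -` {v} \<inter> space M \<in> sets M" .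
qed auto

lemma prob_space_pmf_exists:
  fixes X :: "'w \<Rightarrow> 'x::countable"
  assumes "prob_space M" and X: "X \<in> measurable M (count_space UNIV)"
  shows "\<exists>p. \<forall>y. ennreal (pmf p y) = emeasure M {\<omega> \<in> space M. X \<omega> = y}"
proof -
  interpret prob_space M by fact
  let ?f = "\<lambda>y. measure M {\<omega> \<in> space M. X \<omega> = y}"
  have sum: "(\<integral>\<^sup>+ y. ennreal (?f y) \<partial>count_space UNIV) = 1"
    using emeasure_split_countable[OF X, of "\<lambda>_. True"] emeasure_space_1 by (simp add: emeasure_eq_measure)
  show ?thesis
    using pmf_embed_pmf[of ?f, OF _ sum] by (auto simp: emeasure_eq_measure intro!: exI[of _ "embed_pmf ?f"])
qed

text \<open>
  Given the state, the next one is a function of quantities with countably many values: the server drawn, the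
  batch size, the capacities, and the value \<open>w\<close> of the splitting rule, which takes the place of the real-valued
  splitting variable.
\<close>

definition next_state :: "'n state \<Rightarrow> 'n \<times> nat \<times> ('n \<Rightarrow> nat) \<times> ('n \<Rightarrow> nat) \<Rightarrow> 'n state" where
  "next_state = (\<lambda>(q, l) (j, k, v, w). let l' = if idle q = {} then l else j in
     (\<lambda>i. q i + routed (\<lambda>_ _ _. w) q l' k 0 i - v i, l'))"

text \<open>
  The conditional law of the arguments of \<open>next_state\<close>, given the state. The factor for the server drawn reflects
  that it equals \<open>first\<close> when no server is idle.
\<close>

definition innovation_weight ::
  "nat pmf \<Rightarrow> ('n::finite \<Rightarrow> nat pmf) \<Rightarrow> real measure \<Rightarrow> (('n \<Rightarrow> nat) \<Rightarrow> nat \<Rightarrow> real \<Rightarrow> ('n \<Rightarrow> nat)) \<Rightarrow> 'n \<Rightarrow>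
   'n state \<Rightarrow> 'n \<times> nat \<times> ('n \<Rightarrow> nat) \<times> ('n \<Rightarrow> nat) \<Rightarrow> real" where
  "innovation_weight arr_law srv_law spl_law f first = (\<lambda>(q, l) (j, k, v, w).
     (if idle q = {} then indicator {first} j else pmf (pmf_of_set (idle q)) j) *
     (pmf arr_law k * (\<Prod>i\<in>UNIV. pmf (srv_law i) (v i)) * measure spl_law {b. f q k b = w}))"

context pi_split_chain
begin

abbreviation X :: "nat \<Rightarrow> 'w \<Rightarrow> 'n state" where "X t \<omega> \<equiv> (Q t \<omega>, LI t \<omega>)"

lemma driving_measurable:
  assumes "t \<ge> 1"
  shows "a t \<in> measurable M (count_space UNIV)" "s i t \<in> measurable M (count_space UNIV)" "B t \<in> borel_measurable M"
  using arrivals_iid(1) services_iid(1)[of i] splitting_iid(1) assms by (auto simp: indep_vars_def)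

lemma slot_measurable: "t \<ge> 1 \<Longrightarrow> slot a s B t \<in> measurable M slot_space"
  unfolding slot_def[abs_def] slot_space_def
  by (intro measurable_Pair driving_measurable measurable_fun_countable[where X="\<lambda>i. s i t"])

lemma LI_Suc: "\<omega> \<in> space M \<Longrightarrow> LI (Suc t) \<omega> = (if idle (Q t \<omega>) = {} then LI t \<omega> else \<xi> (Suc t) \<omega>)"
  using LI_step[of "Suc t" \<omega>] by simp

lemma Q_Suc: "\<omega> \<in> space M \<Longrightarrow>
    Q (Suc t) \<omega> i = Q t \<omega> i + routed f (Q t \<omega>) (LI (Suc t) \<omega>) (a (Suc t) \<omega>) (B (Suc t) \<omega>) i - s i (Suc t) \<omega>"
  using Q_step[of "Suc t" \<omega>] by simp

definition innovation :: "nat \<Rightarrow> 'w \<Rightarrow> 'n \<times> nat \<times> ('n \<Rightarrow> nat) \<times> ('n \<Rightarrow> nat)" where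
  "innovation t \<omega> = (\<xi> (Suc t) \<omega>, a (Suc t) \<omega>, (\<lambda>i. s i (Suc t) \<omega>), f (Q t \<omega>) (a (Suc t) \<omega>) (B (Suc t) \<omega>))"

lemma X_Suc: "\<omega> \<in> space M \<Longrightarrow> X (Suc t) \<omega> = next_state (X t \<omega>) (innovation t \<omega>)"
  by (simp add: next_state_def innovation_def Let_def LI_Suc Q_Suc routed_def fun_eq_iff)

lemma innovation_measurable:
  assumes f: "splitting_rule f" and X: "X t \<in> measurable G (count_space UNIV)"
    and \<xi>: "\<xi> (Suc t) \<in> measurable G (count_space UNIV)"
    and a: "a (Suc t) \<in> measurable G (count_space UNIV)"
    and s: "\<And>i. s i (Suc t) \<in> measurable G (count_space UNIV)"
    and B: "B (Suc t) \<in> borel_measurable G"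
  shows "innovation t \<in> measurable G (count_space UNIV)"
proof -
  have Q: "Q t \<in> measurable G (count_space UNIV)"
    using measurable_compose[OF X, of fst "count_space UNIV"] by simp
  have f': "(\<lambda>(q, k, b). f q k b) \<in> measurable (count_space UNIV \<Otimes>\<^sub>M count_space UNIV \<Otimes>\<^sub>M borel) (count_space UNIV)"
    using f unfolding splitting_rule_def by (rule conjunct1)
  have "(\<lambda>\<omega>. f (Q t \<omega>) (a (Suc t) \<omega>) (B (Suc t) \<omega>)) \<in> measurable G (count_space UNIV)"
    using measurable_compose[OF measurable_Pair[OF Q measurable_Pair[OF a B]] f'] by simp
  from measurable_pair_countable[OF \<xi> measurable_pair_countable[OF a
        measurable_pair_countable[OF measurable_fun_countable[of "\<lambda>i. s i (Suc t)", OF s] this]]]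
  show ?thesis unfolding innovation_def[abs_def] .
qed

text \<open>
  Stated for an arbitrary sigma-algebra \<open>G\<close>, so that it also shows that the state is a function of the initial
  condition and the past driving variables.
\<close>

lemma X_measurable_filtration:
  assumes f: "splitting_rule f" and G: "space G = space M" and X0: "X 0 \<in> measurable G (count_space UNIV)"
    and drv: "\<And>u. 1 \<le> u \<Longrightarrow> u \<le> t \<Longrightarrow> \<xi> u \<in> measurable G (count_space UNIV)"
      "\<And>u. 1 \<le> u \<Longrightarrow> u \<le> t \<Longrightarrow> a u \<in> measurable G (count_space UNIV)"
      "\<And>u i. 1 \<le> u \<Longrightarrow> u \<le> t \<Longrightarrow> s i u \<in> measurable G (count_space UNIV)"
      "\<And>u. 1 \<le> u \<Longrightarrow> u \<le> t \<Longrightarrow> B u \<in> borel_measurable G"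
  shows "X t \<in> measurable G (count_space UNIV)"
  using drv
proof (induction t)
  case (Suc t)
  have Xt: "X t \<in> measurable G (count_space UNIV)" by (intro Suc.IH Suc.prems) auto
  then have "innovation t \<in> measurable G (count_space UNIV)"
    by (intro innovation_measurable f Suc.prems) auto
  then have "(\<lambda>\<omega>. (\<lambda>(x, z). next_state x z) (X t \<omega>, innovation t \<omega>)) \<in> measurable G (count_space UNIV)"
    by (rule measurable_compose[OF measurable_pair_countable[OF Xt]]) simp
  then show ?case
    by (rule measurable_cong[THEN iffD1, rotated]) (simp add: X_Suc G)
qed (use X0 in simp)

lemma X_measurable: "splitting_rule f \<Longrightarrow> X t \<in> measurable M (count_space UNIV)"
  by (rule X_measurable_filtration) (auto simp: initial_measurable \<xi>_measurable driving_measurable)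

lemma slot_law:
  assumes t: "t \<ge> 1" and Z: "Z \<in> sets borel"
  shows "prob {\<omega> \<in> space M. a t \<omega> = k \<and> (\<forall>i. s i t \<omega> = v i) \<and> B t \<omega> \<in> Z}
    = pmf arr_law k * (\<Prod>i\<in>UNIV. pmf (srv_law i) (v i)) * measure spl_law Z"
proof -
  define A where "A k' = (case k' of Initial \<Rightarrow> space M | Arrivals \<Rightarrow> a t -` {k} \<inter> space M
    | Services i \<Rightarrow> s i t -` {v i} \<inter> space M | Splitting \<Rightarrow> B t -` Z \<inter> space M)" for k'
  define J where "J = insert Arrivals (insert Splitting (range (Services :: 'n \<Rightarrow> 'n source)))"
  have comp: "Y t -` Z \<inter> space M \<in> sets (vimage_algebra (space M) (\<lambda>\<omega>. \<lambda>t\<in>{1..}. Y t \<omega>) (PiM {1..} (\<lambda>_. N)))"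
    if "Z \<in> sets N" "\<And>t \<omega>. t \<ge> 1 \<Longrightarrow> \<omega> \<in> space M \<Longrightarrow> Y t \<omega> \<in> space N" for Y :: "nat \<Rightarrow> 'w \<Rightarrow> 'z" and N Z
  proof -
    have "(\<lambda>x. x t) -` Z \<inter> space (PiM {1..} (\<lambda>_. N)) \<in> sets (PiM {1..} (\<lambda>_. N))"
      using t that by (intro measurable_sets[OF measurable_component_singleton]) auto
    from in_vimage_algebra[OF this, of "\<lambda>\<omega>. \<lambda>t\<in>{1..}. Y t \<omega>" "space M"]
    show ?thesis
      by (rule back_subst[of "\<lambda>S. S \<in> _"]) (use t that(2) in \<open>auto simp: space_PiM PiE_def\<close>)
  qed
  have "prob (\<Inter>j\<in>J. A j) = (\<Prod>j\<in>J. prob (A j))"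
  proof (rule indep_setsD[OF sources_independent])
    show "\<forall>j\<in>J. A j \<in> (case j of
           Initial \<Rightarrow> sets (vimage_algebra (space M) (\<lambda>\<omega>. (Q 0 \<omega>, LI 0 \<omega>)) (count_space UNIV))
         | Arrivals \<Rightarrow> sets (vimage_algebra (space M) (\<lambda>\<omega>. \<lambda>t\<in>{1..}. a t \<omega>)
                                (PiM {1..} (\<lambda>_. count_space UNIV)))
         | Services i \<Rightarrow> sets (vimage_algebra (space M) (\<lambda>\<omega>. \<lambda>t\<in>{1..}. s i t \<omega>)
                                (PiM {1..} (\<lambda>_. count_space UNIV)))
         | Splitting \<Rightarrow> sets (vimage_algebra (space M) (\<lambda>\<omega>. \<lambda>t\<in>{1..}. B t \<omega>)
                                (PiM {1..} (\<lambda>_. borel))))"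
      using comp[of "{k}" "count_space UNIV" a] comp[of "{v _}" "count_space UNIV" "s _"] comp[of Z borel B] Z
      by (auto simp: J_def A_def)
  qed (auto simp: J_def)
  also have "(\<Inter>j\<in>J. A j) = {\<omega> \<in> space M. a t \<omega> = k \<and> (\<forall>i. s i t \<omega> = v i) \<and> B t \<omega> \<in> Z}"
    by (auto simp: J_def A_def)
  also have "(\<Prod>j\<in>J. prob (A j)) = prob (A Arrivals) * (prob (A Splitting) * (\<Prod>i\<in>UNIV. prob (A (Services i))))"
    unfolding J_def by (subst prod.insert; (subst prod.insert)?) (auto simp: prod.reindex inj_on_def)
  also have "prob (A Arrivals) = pmf arr_law k"
    using arrivals_iid(2)[OF t] measure_distr[OF driving_measurable(1)[OF t], of "{k}"]
    by (simp add: A_def measure_pmf_single)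
  also have "prob (A Splitting) = measure spl_law Z"
    using splitting_iid(2)[OF t] measure_distr[OF driving_measurable(3)[OF t] Z] by (simp add: A_def)
  also have "(\<Prod>i\<in>UNIV. prob (A (Services i))) = (\<Prod>i\<in>UNIV. pmf (srv_law i) (v i))"
  proof (rule prod.cong[OF refl])
    fix i
    show "prob (A (Services i)) = pmf (srv_law i) (v i)"
      using services_iid(2)[OF t] measure_distr[OF driving_measurable(2)[OF t], of "{v i}" i]
      by (simp add: A_def measure_pmf_single)
  qed
  finally show ?thesis by (simp add: mult_ac)
qed

end

text \<open>
  Integrate the conditional probability of \<open>B\<close> over \<open>A\<close>.
\<close>

lemma (in prob_space) prob_Int_cond_exp_const:
  assumes sub: "subalgebra M F" and A: "A \<in> sets F" and B: "B \<in> sets M"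
    and h: "h \<in> borel_measurable M" "\<And>\<omega>. \<omega> \<in> space M \<Longrightarrow> h \<omega> = (indicator B \<omega> :: real)"
    and ce: "AE \<omega> in M. \<omega> \<in> A \<longrightarrow> real_cond_exp M F h \<omega> = p"
  shows "prob (A \<inter> B) = prob A * p"
proof -
  interpret F: finite_measure_subalgebra M F
    by unfold_locales (rule sub)
  have A_M: "A \<in> sets M" using sub A by (auto simp: subalgebra_def)
  then have A_sp: "A \<inter> space M = A" using sets.sets_into_space by blast
  have h_int: "integrable M h"
  proof (rule integrable_const_bound[where B=1])
    show "AE \<omega> in M. norm (h \<omega>) \<le> 1"
      by (rule AE_I2) (simp only: h(2), simp split: split_indicator)
  qed (rule h(1))
  have "prob (A \<inter> B) = (\<integral>\<omega>. indicator (A \<inter> B) \<omega> \<partial>M)"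
    unfolding Bochner_Integration.integral_indicator using A_sp by (intro arg_cong[where f=prob]) blast
  also have "\<dots> = (LINT \<omega>:A|M. h \<omega>)"
    unfolding set_lebesgue_integral_def
    by (intro Bochner_Integration.integral_cong) (auto simp: indicator_def h(2))
  also have "\<dots> = (LINT \<omega>:A|M. real_cond_exp M F h \<omega>)"
    by (rule F.real_cond_exp_intA[OF h_int A])
  also have "\<dots> = (LINT \<omega>:A|M. p)"
    by (rule set_lebesgue_integral_cong_AE[OF A_M]) (use ce in auto)
  also have "\<dots> = prob A * p"
    unfolding set_lebesgue_integral_def by (simp add: A_sp)
  finally show ?thesis .
qed

context pi_split_chain
begin

abbreviation history :: "nat \<Rightarrow> (nat \<Rightarrow> 'n state set) \<Rightarrow> 'w \<Rightarrow> bool" where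
  "history t Z \<omega> \<equiv> \<forall>u\<le>t. X u \<omega> \<in> Z u"

lemma history_sets:
  assumes X: "\<And>u. u \<le> t \<Longrightarrow> X u \<in> measurable G (count_space UNIV)" and G: "space G = space M"
  shows "{\<omega> \<in> space M. history t Z \<omega>} \<in> sets G"
proof -
  have "{\<omega> \<in> space G. \<forall>u\<in>{..t}. X u \<omega> \<in> Z u} \<in> sets G"
  proof (rule sets.sets_Collect_finite_All)
    fix u assume "u \<in> {..t}"
    then have "X u -` Z u \<inter> space G \<in> sets G" by (intro measurable_sets[OF X]) auto
    then show "{\<omega> \<in> space G. X u \<omega> \<in> Z u} \<in> sets G"
      by (rule back_subst[of "\<lambda>S. S \<in> _"]) auto
  qed simp
  then show ?thesis
    by (rule back_subst[of "\<lambda>S. S \<in> _"]) (auto simp: G)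
qed

lemma slot_measurable_generated:
  assumes "t \<ge> 1" and V: "slot a s B t \<in> measurable V slot_space"
  shows "a t \<in> measurable V (count_space UNIV)" "s i t \<in> measurable V (count_space UNIV)" "B t \<in> borel_measurable V"
proof -
  have 1: "fst \<in> measurable slot_space (count_space UNIV)"
    and 2: "(\<lambda>x. fst (snd x) i) \<in> measurable slot_space (count_space UNIV)"
    and 3: "(\<lambda>x. snd (snd x)) \<in> measurable slot_space borel"
    unfolding slot_space_def
    by (rule measurable_fst, rule measurable_compose[OF measurable_compose[OF measurable_snd measurable_fst], of "\<lambda>v. v i"],
        simp, rule measurable_compose[OF measurable_snd measurable_snd])
  show "a t \<in> measurable V (count_space UNIV)"
    using measurable_compose[OF V 1] by (simp add: slot_def)
  show "s i t \<in> measurable V (count_space UNIV)"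
    using measurable_compose[OF V 2] by (simp add: slot_def)
  show "B t \<in> borel_measurable V"
    using measurable_compose[OF V 3] by (simp add: slot_def)
qed

text \<open>
  The history and the server drawn are determined by the initial state, the earlier slots and the draws up to the
  current one, and the current slot is independent of all of these.
\<close>

lemma slot_independent_of_history:
  assumes f: "splitting_rule f" and Z: "Z' \<in> sets borel"
  shows "prob {\<omega> \<in> space M. (history t Z \<omega> \<and> \<xi> (Suc t) \<omega> = j) \<and>
           (a (Suc t) \<omega> = k \<and> (\<forall>i. s i (Suc t) \<omega> = v i) \<and> B (Suc t) \<omega> \<in> Z')}
    = prob {\<omega> \<in> space M. history t Z \<omega> \<and> \<xi> (Suc t) \<omega> = j} *
      (pmf arr_law k * (\<Prod>i\<in>UNIV. pmf (srv_law i) (v i)) * measure spl_law Z')"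
proof -
  define V1 where "V1 = vimage_algebra (space M) (slot a s B (Suc t)) slot_space"
  define g where "g \<omega> = ((Q 0 \<omega>, LI 0 \<omega>), \<lambda>u\<in>{1..<Suc t}. slot a s B u \<omega>, \<lambda>u\<in>{1..Suc t}. \<xi> u \<omega>)" for \<omega>
  define N where "N = (count_space UNIV :: 'n state measure) \<Otimes>\<^sub>M PiM {1..<Suc t} (\<lambda>_. slot_space :: (nat \<times> ('n \<Rightarrow> nat) \<times> real) measure)
               \<Otimes>\<^sub>M PiM {1..Suc t} (\<lambda>_. count_space UNIV :: 'n measure)"
  define V2 where "V2 = vimage_algebra (space M) g N"
  have sp: "space V1 = space M" "space V2 = space M" by (simp_all add: V1_def V2_def)
  have indep: "indep_set (sets V1) (sets V2)"
    using slot_independent_past[of "Suc t"] by (simp add: V1_def V2_def g_def[abs_def] N_def)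
  have slot_sp: "space slot_space = UNIV" by (simp add: slot_space_def space_pair_measure)
  have slot1: "slot a s B (Suc t) \<in> measurable V1 slot_space"
    unfolding V1_def by (rule measurable_vimage_algebra1) (simp add: slot_sp)
  note s1 = slot_measurable_generated[OF _ slot1]
  have g: "g \<in> measurable V2 N"
    unfolding V2_def by (rule measurable_vimage_algebra1) (auto simp: g_def N_def space_pair_measure space_PiM slot_sp)
  have X0: "X 0 \<in> measurable V2 (count_space UNIV)"
    using measurable_compose[OF g, of fst "count_space UNIV"] by (simp add: N_def g_def)
  have slot2: "slot a s B u \<in> measurable V2 slot_space" if "1 \<le> u" "u \<le> t" for u
  proof -
    have "(\<lambda>x. fst (snd x) u) \<in> measurable N slot_space"
      unfolding N_def using that
      by (intro measurable_compose[OF measurable_compose[OF measurable_snd measurable_fst] measurable_component_singleton]) auto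
    from measurable_compose[OF g this] show ?thesis using that by (simp add: g_def)
  qed
  have \<xi>2: "\<xi> u \<in> measurable V2 (count_space UNIV)" if "1 \<le> u" "u \<le> Suc t" for u
  proof -
    have "(\<lambda>x. snd (snd x) u) \<in> measurable N (count_space UNIV)"
      unfolding N_def using that
      by (intro measurable_compose[OF measurable_compose[OF measurable_snd measurable_snd] measurable_component_singleton]) auto
    from measurable_compose[OF g this] show ?thesis using that by (simp add: g_def)
  qed
  have X2: "X u \<in> measurable V2 (count_space UNIV)" if "u \<le> t" for u
  proof (rule X_measurable_filtration[OF f sp(2) X0])
    fix r assume r: "1 \<le> r" "r \<le> u"
    then have "r \<le> t" "r \<le> Suc t" using that by auto
    from slot_measurable_generated[OF r(1) slot2[OF r(1) this(1)]] \<xi>2[OF r(1) this(2)]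
    show "\<xi> r \<in> measurable V2 (count_space UNIV)" "a r \<in> measurable V2 (count_space UNIV)"
      "s i r \<in> measurable V2 (count_space UNIV)" "B r \<in> borel_measurable V2" for i
      by auto
  qed
  have "{\<omega> \<in> space M. history t Z \<omega>} \<inter> (\<xi> (Suc t) -` {j} \<inter> space V2) \<in> sets V2"
    by (intro sets.Int history_sets X2 sp measurable_sets[OF \<xi>2]) auto
  then have E2: "{\<omega> \<in> space M. history t Z \<omega> \<and> \<xi> (Suc t) \<omega> = j} \<in> sets V2"
    by (rule back_subst[of "\<lambda>S. S \<in> _"]) (auto simp: sp)
  have "(a (Suc t) -` {k} \<inter> space V1) \<inter> ((\<lambda>\<omega> i. s i (Suc t) \<omega>) -` {v} \<inter> space V1) \<inter> (B (Suc t) -` Z' \<inter> space V1) \<in> sets V1"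
    using Z by (intro sets.Int measurable_sets[OF s1(1)] measurable_sets[OF s1(3)]
        measurable_sets[OF measurable_fun_countable[of "\<lambda>i. s i (Suc t)", OF s1(2)]]) auto
  then have E1: "{\<omega> \<in> space M. a (Suc t) \<omega> = k \<and> (\<forall>i. s i (Suc t) \<omega> = v i) \<and> B (Suc t) \<omega> \<in> Z'} \<in> sets V1"
    by (rule back_subst[of "\<lambda>S. S \<in> _"]) (auto simp: sp fun_eq_iff)
  have "{\<omega> \<in> space M. (history t Z \<omega> \<and> \<xi> (Suc t) \<omega> = j) \<and>
           (a (Suc t) \<omega> = k \<and> (\<forall>i. s i (Suc t) \<omega> = v i) \<and> B (Suc t) \<omega> \<in> Z')}
    = {\<omega> \<in> space M. a (Suc t) \<omega> = k \<and> (\<forall>i. s i (Suc t) \<omega> = v i) \<and> B (Suc t) \<omega> \<in> Z'} \<inter>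
      {\<omega> \<in> space M. history t Z \<omega> \<and> \<xi> (Suc t) \<omega> = j}" by blast
  then show ?thesis
    using indep_setD[OF indep E1 E2] slot_law[of "Suc t" Z' k v] Z by simp
qed

lemma last_idle_uniform:
  assumes f: "splitting_rule f" and q: "idle q \<noteq> {}" and Z: "Z t \<subseteq> {q} \<times> UNIV"
  shows "prob {\<omega> \<in> space M. history t Z \<omega> \<and> \<xi> (Suc t) \<omega> = j}
    = prob {\<omega> \<in> space M. history t Z \<omega>} * pmf (pmf_of_set (idle q)) j"
proof -
  define g where "g \<omega> = (\<lambda>u\<in>{..<Suc t}. X u \<omega>, slot a s B (Suc t) \<omega>)" for \<omega>
  define N where "N = PiM {..<Suc t} (\<lambda>_. count_space UNIV :: 'n state measure) \<Otimes>\<^sub>M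
     (slot_space :: (nat \<times> ('n \<Rightarrow> nat) \<times> real) measure)"
  define F where "F = vimage_algebra (space M) g N"
  let ?A = "{\<omega> \<in> space M. history t Z \<omega>}"
  let ?p = "pmf (pmf_of_set (idle q)) j"
  let ?h = "\<lambda>\<omega>. if \<xi> (Suc t) \<omega> = j then 1 else 0 :: real"
  have spF: "space F = space M" by (simp add: F_def)
  have gM: "g \<in> measurable M N"
    unfolding g_def[abs_def] N_def using X_measurable[OF f]
    by (intro measurable_Pair measurable_restrict slot_measurable) auto
  have gF: "g \<in> measurable F N"
    unfolding F_def using measurable_space[OF gM] by (intro measurable_vimage_algebra1) auto
  have "sets F \<subseteq> sets M"
    unfolding F_def using measurable_space[OF gM] by (subst sets_vimage_algebra2) (auto intro: measurable_sets[OF gM])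
  then have sub: "subalgebra M F" by (simp add: subalgebra_def spF)
  have XF: "X u \<in> measurable F (count_space UNIV)" if "u \<le> t" for u
  proof -
    have "(\<lambda>x. fst x u) \<in> measurable N (count_space UNIV)"
      unfolding N_def using that
      by (intro measurable_compose[OF measurable_fst measurable_component_singleton]) auto
    from measurable_compose[OF gF this] show ?thesis using that by (simp add: g_def)
  qed
  have A: "?A \<in> sets F" by (intro history_sets XF spF)
  have h_meas: "{\<omega> \<in> space M. \<xi> (Suc t) \<omega> = j} \<in> sets M"
    using measurable_sets[OF \<xi>_measurable[of "Suc t"], of "{j}"]
    by (rule back_subst[of "\<lambda>S. S \<in> _"]) auto
  have h_meas': "?h \<in> borel_measurable M"
    by (rule measurable_compose[OF \<xi>_measurable[of "Suc t"], of "\<lambda>x. if x = j then 1 else 0 :: real" borel]) auto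
  have "AE \<omega> in M. idle (Q t \<omega>) \<noteq> {} \<longrightarrow> real_cond_exp M F ?h \<omega> = pmf (pmf_of_set (idle (Q t \<omega>))) j"
    using \<xi>_uniform[of "Suc t" j] unfolding F_def N_def g_def[abs_def] diff_Suc_1 by simp
  then have ce: "AE \<omega> in M. history t Z \<omega> \<longrightarrow> real_cond_exp M F ?h \<omega> = ?p"
  proof (rule eventually_mono, intro impI)
    fix \<omega>
    assume *: "idle (Q t \<omega>) \<noteq> {} \<longrightarrow> real_cond_exp M F ?h \<omega> = pmf (pmf_of_set (idle (Q t \<omega>))) j"
      and "history t Z \<omega>"
    then have "X t \<omega> \<in> Z t" by blast
    then have "Q t \<omega> = q" using Z by blast
    then show "real_cond_exp M F ?h \<omega> = ?p" using * q by simp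
  qed
  have "{\<omega> \<in> space M. history t Z \<omega> \<and> \<xi> (Suc t) \<omega> = j} = ?A \<inter> {\<omega> \<in> space M. \<xi> (Suc t) \<omega> = j}" by blast
  also have "prob \<dots> = prob ?A * ?p"
    by (rule prob_Int_cond_exp_const[OF sub A h_meas, where h="?h"])
       (use ce h_meas' in \<open>auto elim: eventually_mono simp: indicator_def\<close>)
  finally show ?thesis .
qed

end

context pi_split_chain
begin

lemma splitting_sets: "splitting_rule f \<Longrightarrow> {b. f q k b = w} \<in> sets borel"
proof -
  assume "splitting_rule f"
  then have f': "(\<lambda>(q, k, b). f q k b) \<in> measurable (count_space UNIV \<Otimes>\<^sub>M count_space UNIV \<Otimes>\<^sub>M borel) (count_space UNIV)"
    unfolding splitting_rule_def by (rule conjunct1)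
  have "(\<lambda>b. (q, k, b)) \<in> measurable borel (count_space UNIV \<Otimes>\<^sub>M count_space UNIV \<Otimes>\<^sub>M borel)"
    by (rule measurable_compose[OF measurable_Pair1' measurable_Pair1']) simp_all
  from measurable_sets[OF measurable_compose[OF this f'], of "{w}"]
  show ?thesis by (rule back_subst[of "\<lambda>S. S \<in> _"]) auto
qed

text \<open>
  The slot is independent of history and draw jointly, and the draw depends on the history through the set of idle
  servers only; so the joint law of the innovation is a product.
\<close>

lemma innovation_law:
  assumes f: "splitting_rule f" and Z: "Z t \<subseteq> {x}"
  shows "emeasure M {\<omega> \<in> space M. history t Z \<omega> \<and> innovation t \<omega> = z}
    = emeasure M {\<omega> \<in> space M. history t Z \<omega>} * ennreal (innovation_weight arr_law srv_law spl_law f first x z)"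
proof -
  obtain q l where x: "x = (q, l)" by (cases x)
  obtain j k v w where z: "z = (j, k, v, w)" by (metis prod.collapse)
  have at: "Q t \<omega> = q" if "history t Z \<omega>" for \<omega>
  proof -
    from that have "X t \<omega> \<in> Z t" by blast
    then show ?thesis using Z x by blast
  qed
  have "{\<omega> \<in> space M. history t Z \<omega> \<and> innovation t \<omega> = z}
     = {\<omega> \<in> space M. (history t Z \<omega> \<and> \<xi> (Suc t) \<omega> = j) \<and>
           (a (Suc t) \<omega> = k \<and> (\<forall>i. s i (Suc t) \<omega> = v i) \<and> B (Suc t) \<omega> \<in> {b. f q k b = w})}"
    unfolding z innovation_def prod.inject fun_eq_iff[of "\<lambda>i. s i _ _"] using at by blast
  then have "prob {\<omega> \<in> space M. history t Z \<omega> \<and> innovation t \<omega> = z}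
     = prob {\<omega> \<in> space M. history t Z \<omega> \<and> \<xi> (Suc t) \<omega> = j} *
      (pmf arr_law k * (\<Prod>i\<in>UNIV. pmf (srv_law i) (v i)) * measure spl_law {b. f q k b = w})"
    by (simp only: slot_independent_of_history[OF f splitting_sets[OF f]])
  moreover have "prob {\<omega> \<in> space M. history t Z \<omega> \<and> \<xi> (Suc t) \<omega> = j}
     = prob {\<omega> \<in> space M. history t Z \<omega>} * (if idle q = {} then indicator {first} j else pmf (pmf_of_set (idle q)) j)"
  proof (cases "idle q = {}")
    case True
    have \<xi>: "\<xi> (Suc t) \<omega> = first" if "\<omega> \<in> space M" "history t Z \<omega>" for \<omega>
      using \<xi>_default[of "Suc t" \<omega>] that(1) at[OF that(2)] True by simp
    show ?thesis
    proof (cases "j = first")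
      case j: True
      have "{\<omega> \<in> space M. history t Z \<omega> \<and> \<xi> (Suc t) \<omega> = j} = {\<omega> \<in> space M. history t Z \<omega>}"
        using \<xi> j by blast
      then show ?thesis using True j by (simp only: if_True indicator_def) simp
    next
      case False
      have "{\<omega> \<in> space M. history t Z \<omega> \<and> \<xi> (Suc t) \<omega> = j} = {}"
        using \<xi> False by blast
      then show ?thesis using True False by (simp only: if_True) simp
    qed
  next
    case False
    then show ?thesis using last_idle_uniform[OF f False, of Z t j] Z x by (simp only: if_False) blast
  qed
  ultimately have "prob {\<omega> \<in> space M. history t Z \<omega> \<and> innovation t \<omega> = z}
      = prob {\<omega> \<in> space M. history t Z \<omega>} * innovation_weight arr_law srv_law spl_law f first x z"
    unfolding x z innovation_weight_def prod.case by (simp only: mult.assoc)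
  then show ?thesis
    unfolding emeasure_eq_measure by (simp only: ennreal_mult'[OF measure_nonneg])
qed

definition transition_prob :: "'n state \<Rightarrow> 'n state \<Rightarrow> ennreal" where
  "transition_prob x y = (\<integral>\<^sup>+ z. ennreal (innovation_weight arr_law srv_law spl_law f first x z)
     * indicator {z. next_state x z = y} z \<partial>count_space UNIV)"

lemma history_step:
  assumes f: "splitting_rule f" and Z: "Z t \<subseteq> {x}"
  shows "emeasure M {\<omega> \<in> space M. history t Z \<omega> \<and> X (Suc t) \<omega> = y}
    = emeasure M {\<omega> \<in> space M. history t Z \<omega>} * transition_prob x y"
proof -
  let ?H = "{\<omega> \<in> space M. history t Z \<omega>}"
  have H: "?H \<in> sets M" by (rule history_sets[OF X_measurable[OF f]]) (rule refl)
  have "X (Suc t) -` {y} \<inter> space M \<in> sets M" by (rule measurable_sets[OF X_measurable[OF f]]) simp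
  with H have "?H \<inter> (X (Suc t) -` {y} \<inter> space M) \<in> sets M" by (rule sets.Int)
  then have HX: "{\<omega> \<in> space M. history t Z \<omega> \<and> X (Suc t) \<omega> = y} \<in> sets M"
    by (rule back_subst[of "\<lambda>S. S \<in> _"]) blast
  have I: "innovation t \<in> measurable M (count_space UNIV)"
    by (intro innovation_measurable f X_measurable \<xi>_measurable driving_measurable) simp_all
  have at: "X t \<omega> = x" if "history t Z \<omega>" for \<omega>
  proof -
    from that have "X t \<omega> \<in> Z t" by blast
    then show ?thesis using Z by blast
  qed
  have "emeasure M {\<omega> \<in> space M. history t Z \<omega> \<and> X (Suc t) \<omega> = y}
     = (\<integral>\<^sup>+ z. emeasure M {\<omega> \<in> space M. (history t Z \<omega> \<and> X (Suc t) \<omega> = y) \<and> innovation t \<omega> = z} \<partial>count_space UNIV)"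
    by (rule emeasure_split_countable[OF I HX])
  also have "\<dots> = (\<integral>\<^sup>+ z. emeasure M ?H * (ennreal (innovation_weight arr_law srv_law spl_law f first x z)
     * indicator {z. next_state x z = y} z) \<partial>count_space UNIV)"
  proof (rule nn_integral_cong)
    fix z
    show "emeasure M {\<omega> \<in> space M. (history t Z \<omega> \<and> X (Suc t) \<omega> = y) \<and> innovation t \<omega> = z}
       = emeasure M ?H * (ennreal (innovation_weight arr_law srv_law spl_law f first x z)
     * indicator {z. next_state x z = y} z)"
    proof (cases "next_state x z = y")
      case True
      have "{\<omega> \<in> space M. (history t Z \<omega> \<and> X (Suc t) \<omega> = y) \<and> innovation t \<omega> = z}
         = {\<omega> \<in> space M. history t Z \<omega> \<and> innovation t \<omega> = z}"
        using X_Suc[of _ t] at True by auto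
      then show ?thesis using innovation_law[where t=t and Z=Z and x=x and z=z, OF f Z] True by simp
    next
      case False
      have E: "{\<omega> \<in> space M. (history t Z \<omega> \<and> X (Suc t) \<omega> = y) \<and> innovation t \<omega> = z} = {}"
        using X_Suc[of _ t] at False by auto
      show ?thesis unfolding E using False by simp
    qed
  qed
  also have "\<dots> = emeasure M ?H * transition_prob x y"
    unfolding transition_prob_def by (rule nn_integral_cmult) simp
  finally show ?thesis .
qed

lemma service_range:
  assumes "\<And>i. set_pmf (srv_law i) \<subseteq> {1..smax}"
  shows "AE \<omega> in M. \<forall>t\<ge>1. \<forall>i. s i t \<omega> \<in> {1..smax}"
proof -
  have "AE \<omega> in M. s i t \<omega> \<in> {1..smax}" if "t \<ge> 1" for i t
  proof -
    have "AE x in distr M (count_space UNIV) (s i t). x \<in> {1..smax}"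
      unfolding services_iid(2)[OF that] AE_measure_pmf_iff using assms by blast
    then show ?thesis
      by (subst (asm) AE_distr_iff[OF driving_measurable(2)[OF that]]) auto
  qed
  then show ?thesis by (simp add: AE_all_countable AE_finite_all)
qed

text \<open>
  Each single violation has probability 0, and there are only countably many times, queue vectors and servers.
\<close>

lemma last_idle_is_idle:
  assumes f: "splitting_rule f"
  shows "AE \<omega> in M. \<forall>t. idle (Q t \<omega>) \<noteq> {} \<longrightarrow> LI (Suc t) \<omega> \<in> idle (Q t \<omega>)"
proof -
  have null_event: "AE \<omega> in M. \<not> (Q t \<omega> = q \<and> \<xi> (Suc t) \<omega> = j)" if q: "idle q \<noteq> {}" "j \<notin> idle q" for t q j
  proof -
    define Z :: "nat \<Rightarrow> 'n state set" where "Z u = (if u = t then {q} \<times> UNIV else UNIV)" for u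
    have "prob {\<omega> \<in> space M. history t Z \<omega> \<and> \<xi> (Suc t) \<omega> = j} = 0"
      using last_idle_uniform[OF f q(1), of Z t j] q by (simp add: Z_def)
    moreover have "{\<omega> \<in> space M. history t Z \<omega> \<and> \<xi> (Suc t) \<omega> = j} = {\<omega> \<in> space M. Q t \<omega> = q \<and> \<xi> (Suc t) \<omega> = j}"
      by (auto simp: Z_def)
    ultimately have null: "prob {\<omega> \<in> space M. Q t \<omega> = q \<and> \<xi> (Suc t) \<omega> = j} = 0" by simp
    have "(\<lambda>\<omega>. ((Q t \<omega>, LI t \<omega>), \<xi> (Suc t) \<omega>)) -` {((q', l), j') | q' l j'. q' = q \<and> j' = j} \<inter> space M \<in> sets M"
      by (rule measurable_sets[OF measurable_pair_countable[OF X_measurable[OF f] \<xi>_measurable]]) auto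
    then have "{\<omega> \<in> space M. Q t \<omega> = q \<and> \<xi> (Suc t) \<omega> = j} \<in> sets M"
      by (rule back_subst[of "\<lambda>S. S \<in> _"]) auto
    with null have "{\<omega> \<in> space M. Q t \<omega> = q \<and> \<xi> (Suc t) \<omega> = j} \<in> null_sets M"
      by (simp add: null_setsI emeasure_eq_measure)
    then show ?thesis by (rule AE_I') blast
  qed
  then have "AE \<omega> in M. \<forall>t q j. idle q \<noteq> {} \<and> j \<notin> idle q \<longrightarrow> \<not> (Q t \<omega> = q \<and> \<xi> (Suc t) \<omega> = j)"
  proof (intro AE_all_countable[THEN iffD2] allI)
    fix t q j
    show "AE \<omega> in M. idle q \<noteq> {} \<and> j \<notin> idle q \<longrightarrow> \<not> (Q t \<omega> = q \<and> \<xi> (Suc t) \<omega> = j)"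
      using null_event[of q j t] by (cases "idle q \<noteq> {} \<and> j \<notin> idle q") auto
  qed
  then show ?thesis
    using AE_space by eventually_elim (auto simp: LI_Suc)
qed

lemma AE_queue_path:
  assumes f: "splitting_rule f" and srv: "\<And>i. set_pmf (srv_law i) \<subseteq> {1..smax}"
  shows "AE \<omega> in M. queue_path (\<lambda>t. Q t \<omega>) (\<lambda>t. LI t \<omega>) (\<lambda>t. a t \<omega>)
     (\<lambda>t. routed f (Q (t - 1) \<omega>) (LI t \<omega>) (a t \<omega>) (B t \<omega>)) (\<lambda>t i. s i t \<omega>) smax"
  using service_range[OF srv] last_idle_is_idle[OF f] AE_space
proof eventually_elim
  case (elim \<omega>)
  show ?case
  proof
    fix t i
    show "Q (Suc t) \<omega> i = Q t \<omega> i + routed f (Q (Suc t - 1) \<omega>) (LI (Suc t) \<omega>) (a (Suc t) \<omega>) (B (Suc t) \<omega>) i - s i (Suc t) \<omega>"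
      using Q_Suc[of \<omega> t i] elim by simp
    show "(\<Sum>i\<in>UNIV. routed f (Q (Suc t - 1) \<omega>) (LI (Suc t) \<omega>) (a (Suc t) \<omega>) (B (Suc t) \<omega>) i) = a (Suc t) \<omega>"
    proof (cases "idle (Q t \<omega>) = {}")
      case True
      then have "(\<Sum>i\<in>UNIV. routed f (Q t \<omega>) (LI (Suc t) \<omega>) (a (Suc t) \<omega>) (B (Suc t) \<omega>) i)
         = (\<Sum>i\<in>UNIV. if i = LI (Suc t) \<omega> then a (Suc t) \<omega> else 0)"
        by (intro sum.cong) (auto simp: routed_def)
      then show ?thesis by simp
    next
      case False
      then obtain j where "Q t \<omega> j = 0" by (auto simp: idle_def)
      then have "0 \<in> range (Q t \<omega>)" by (metis rangeI)
      then have "Min (range (Q t \<omega>)) = 0" by (metis Min_le finite finite_imageI le_zero_eq)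
      then have zero: "f (Q t \<omega>) k b i = 0" if "i \<notin> idle (Q t \<omega>)" for k b i
        using f that by (auto simp: splitting_rule_def idle_def)
      have "(\<Sum>i\<in>UNIV. routed f (Q t \<omega>) (LI (Suc t) \<omega>) (a (Suc t) \<omega>) (B (Suc t) \<omega>) i)
         = (\<Sum>i\<in>UNIV. f (Q t \<omega>) (a (Suc t) \<omega>) (B (Suc t) \<omega>) i)"
        using False zero by (intro sum.cong) (auto simp: routed_def)
      then show ?thesis using f by (simp add: splitting_rule_def)
    qed
    show "s i (Suc t) \<omega> \<le> smax" using elim by auto
    show "idle (Q t \<omega>) \<noteq> {} \<Longrightarrow> i \<notin> idle (Q t \<omega>) \<Longrightarrow>
        routed f (Q (Suc t - 1) \<omega>) (LI (Suc t) \<omega>) (a (Suc t) \<omega>) (B (Suc t) \<omega>) i = 0"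
      by (simp add: routed_def)
    show "idle (Q t \<omega>) \<noteq> {} \<Longrightarrow> LI (Suc t) \<omega> \<in> idle (Q t \<omega>)" using elim by blast
    show "idle (Q t \<omega>) = {} \<Longrightarrow> i \<noteq> LI (Suc t) \<omega> \<Longrightarrow>
        routed f (Q (Suc t - 1) \<omega>) (LI (Suc t) \<omega>) (a (Suc t) \<omega>) (B (Suc t) \<omega>) i = 0"
      by (simp add: routed_def)
    show "idle (Q t \<omega>) = {} \<Longrightarrow> LI (Suc t) \<omega> = LI t \<omega>" using LI_Suc[of \<omega> t] elim by simp
  qed
qed

end

section \<open>Drift of the total work\<close>

definition variance_of :: "nat pmf \<Rightarrow> real" where
  "variance_of p = measure_pmf.expectation p (\<lambda>k. (real k - measure_pmf.expectation p (\<lambda>k. real k))\<^sup>2)"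

text \<open>
  A constant that depends on the laws only: the same bound holds for every initial state.
\<close>

definition fluctuation_const :: "nat pmf \<Rightarrow> ('n::finite \<Rightarrow> nat pmf) \<Rightarrow> real" where
  "fluctuation_const arr_law srv_law =
     1 + 2 * (variance_of arr_law + 1 + (\<Sum>i\<in>UNIV. variance_of (srv_law i) + 1)) +
     2 * (measure_pmf.expectation arr_law (\<lambda>k. real k) + (\<Sum>i\<in>UNIV. measure_pmf.expectation (srv_law i) (\<lambda>k. real k)))"

lemma service_mean:
  assumes "set_pmf p \<subseteq> {1..smax::nat}"
  shows "integrable (measure_pmf p) (\<lambda>k. real k)" "integrable (measure_pmf p) (\<lambda>k. (real k)\<^sup>2)"
    "1 \<le> measure_pmf.expectation p (\<lambda>k. real k)"
proof -
  have fin: "finite (set_pmf p)" using assms by (rule finite_subset) simp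
  then show int: "integrable (measure_pmf p) (\<lambda>k. real k)" "integrable (measure_pmf p) (\<lambda>k. (real k)\<^sup>2)"
    by (simp_all add: integrable_measure_pmf_finite)
  have "measure_pmf.expectation p (\<lambda>_. 1) \<le> measure_pmf.expectation p (\<lambda>k. real k)"
    using assms int by (intro integral_mono_AE) (auto simp: AE_measure_pmf_iff)
  then show "1 \<le> measure_pmf.expectation p (\<lambda>k. real k)" by simp
qed

lemma increment_deviation:
  fixes Y :: "nat \<Rightarrow> nat"
  assumes \<rho>: "\<rho> \<ge> 0" and m: "m > 0"
    and grid: "\<And>g. g \<le> G \<Longrightarrow> \<bar>(\<Sum>t\<in>{0<..g * m}. real (Y t)) - \<rho> * real (g * m)\<bar> \<le> d"
    and uv: "u \<le> v" "v \<le> G * m"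
  shows "\<bar>(\<Sum>t\<in>{u<..v}. real (Y t)) - \<rho> * real (v - u)\<bar> \<le> 2 * (d + \<rho> * real m)"
proof -
  define c where "c u = (\<Sum>t\<in>{0<..u}. real (Y t))" for u
  have mono: "mono c" unfolding c_def by (intro monoI sum_mono2) auto
  have "{0<..v} = {0<..u} \<union> {u<..v}" using uv by auto
  then have "c v = c u + (\<Sum>t\<in>{u<..v}. real (Y t))"
    unfolding c_def by (subst sum.union_disjoint[symmetric]) auto
  moreover have "\<bar>c u - \<rho> * real u\<bar> \<le> d + \<rho> * real m" "\<bar>c v - \<rho> * real v\<bar> \<le> d + \<rho> * real m"
    using uv grid_deviation[OF mono \<rho> m grid[folded c_def]] by simp_all
  ultimately show ?thesis using uv(1) by (simp add: of_nat_diff right_diff_distrib)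
qed

context pi_split_chain
begin

text \<open>
  Over \<open>G ^ 4\<close> slots with a grid of \<open>G\<close> blocks of length \<open>G ^ 3\<close>, each grid point has mean deviation of order
  \<open>G ^ 2\<close>, and a block has length \<open>G ^ 3\<close>. Summing over the grid and adding the block length, the
  deviation on all subintervals has mean of order \<open>G ^ 3\<close>, which is small compared with the time span.
\<close>

lemma fluctuation_bound:
  fixes G :: nat
  assumes arr: "integrable (measure_pmf arr_law) (\<lambda>k. real k)" "integrable (measure_pmf arr_law) (\<lambda>k. (real k)\<^sup>2)"
    and srv: "\<And>i. set_pmf (srv_law i) \<subseteq> {1..smax}" and G: "G > 0"
  defines "\<rho> \<equiv> measure_pmf.expectation arr_law (\<lambda>k. real k)"
    and "\<mu> \<equiv> \<lambda>i. measure_pmf.expectation (srv_law i) (\<lambda>k. real k)"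
  shows "\<exists>D. integrable M D \<and> (\<forall>\<omega>. D \<omega> \<ge> 1) \<and> expectation D \<le> fluctuation_const arr_law srv_law * G ^ 3 \<and>
    (\<forall>\<omega> u v. u \<le> v \<longrightarrow> v \<le> G ^ 4 \<longrightarrow>
      (\<Sum>t\<in>{u<..v}. real (a t \<omega>)) \<le> \<rho> * real (v - u) + D \<omega> \<and>
      (\<forall>i. \<mu> i * real (v - u) - D \<omega> \<le> (\<Sum>t\<in>{u<..v}. real (s i t \<omega>))))"
proof -
  define m where "m = G ^ 3"
  define A where "A g \<omega> = \<bar>(\<Sum>t\<in>{0<..g * m}. real (a t \<omega>)) - \<rho> * real (g * m)\<bar>" for g \<omega>
  define S where "S i g \<omega> = \<bar>(\<Sum>t\<in>{0<..g * m}. real (s i t \<omega>)) - \<mu> i * real (g * m)\<bar>" for i g \<omega>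
  define d where "d \<omega> = (\<Sum>g\<le>G. A g \<omega> + (\<Sum>i\<in>UNIV. S i g \<omega>))" for \<omega>
  define D where "D \<omega> = 1 + 2 * d \<omega> + 2 * (\<rho> + sum \<mu> UNIV) * m" for \<omega>
  have m: "m > 0" "G * m = G ^ 4" using G by (simp_all add: m_def power_numeral_reduce)
  have \<rho>: "\<rho> \<ge> 0" unfolding \<rho>_def by (rule Bochner_Integration.integral_nonneg) simp
  have \<mu>: "\<mu> i \<ge> 0" for i unfolding \<mu>_def by (rule Bochner_Integration.integral_nonneg) simp
  have \<mu>_le: "\<mu> i \<le> sum \<mu> UNIV" for i using \<mu> by (intro member_le_sum) auto
  have AS: "A g \<omega> \<ge> 0" "S i g \<omega> \<ge> 0" for i g \<omega> by (simp_all add: A_def S_def)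
  have dA: "A g \<omega> \<le> d \<omega>" and dS: "S i g \<omega> \<le> d \<omega>" if "g \<le> G" for g i \<omega>
  proof -
    have "A g \<omega> + (\<Sum>i\<in>UNIV. S i g \<omega>) \<le> d \<omega>"
      unfolding d_def
      by (rule member_le_sum[of g "{..G}" "\<lambda>g. A g \<omega> + (\<Sum>i\<in>UNIV. S i g \<omega>)"])
         (use that AS in \<open>auto intro!: add_nonneg_nonneg sum_nonneg\<close>)
    moreover have "S i g \<omega> \<le> (\<Sum>i\<in>UNIV. S i g \<omega>)" using AS by (intro member_le_sum) auto
    moreover have "0 \<le> (\<Sum>i\<in>UNIV. S i g \<omega>)" using AS by (intro sum_nonneg) auto
    ultimately show "A g \<omega> \<le> d \<omega>" "S i g \<omega> \<le> d \<omega>" using AS(1)[of g \<omega>] by linarith+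
  qed
  have d0: "d \<omega> \<ge> 0" for \<omega> using dA[of 0 \<omega>] AS(1)[of 0 \<omega>] by linarith
  have D1: "D \<omega> \<ge> 1" for \<omega> using d0[of \<omega>] \<rho> \<mu> by (simp add: D_def sum_nonneg)
  have dev: "(\<Sum>t\<in>{u<..v}. real (a t \<omega>)) \<le> \<rho> * real (v - u) + D \<omega>"
    "\<mu> i * real (v - u) - D \<omega> \<le> (\<Sum>t\<in>{u<..v}. real (s i t \<omega>))" if uv: "u \<le> v" "v \<le> G ^ 4" for u v i \<omega>
  proof -
    have vm: "v \<le> G * m" using uv(2) m(2) by simp
    have "\<bar>(\<Sum>t\<in>{u<..v}. real (a t \<omega>)) - \<rho> * real (v - u)\<bar> \<le> 2 * (d \<omega> + \<rho> * real m)"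
      by (rule increment_deviation[OF \<rho> m(1) dA[unfolded A_def] uv(1) vm])
    moreover have "\<bar>(\<Sum>t\<in>{u<..v}. real (s i t \<omega>)) - \<mu> i * real (v - u)\<bar> \<le> 2 * (d \<omega> + \<mu> i * real m)"
      by (rule increment_deviation[OF \<mu> m(1) dS[unfolded S_def] uv(1) vm])
    moreover have "\<rho> * m \<le> (\<rho> + sum \<mu> UNIV) * m" "\<mu> i * m \<le> (\<rho> + sum \<mu> UNIV) * m"
      using \<rho> \<mu>_le[of i] \<mu> by (auto intro!: mult_right_mono sum_nonneg)
    ultimately show "(\<Sum>t\<in>{u<..v}. real (a t \<omega>)) \<le> \<rho> * real (v - u) + D \<omega>"
      "\<mu> i * real (v - u) - D \<omega> \<le> (\<Sum>t\<in>{u<..v}. real (s i t \<omega>))"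
      unfolding D_def by (simp_all add: algebra_simps)
  qed
  have sqrt: "sqrt (real G ^ 4) = (real G)\<^sup>2"
    by (rule real_sqrt_unique) (simp_all add: power_mult[symmetric])
  have gm: "g * m \<le> G ^ 4" if "g \<le> G" for g using that m by (metis mult_le_mono1)
  have G4: "G ^ 4 > 0" using G by simp
  have A_exp: "integrable M (A g)" "expectation (A g) \<le> (variance_of arr_law + 1) / 2 * G ^ 2" if "g \<le> G" for g
    using iid_mean_deviation[OF arrivals_iid arr gm[OF that] G4]
    unfolding A_def[abs_def] \<rho>_def variance_of_def by (simp_all add: sqrt)
  have S_exp: "integrable M (S i g)" "expectation (S i g) \<le> (variance_of (srv_law i) + 1) / 2 * G ^ 2" if "g \<le> G" for i g
    using iid_mean_deviation[OF services_iid service_mean(1,2)[OF srv] gm[OF that] G4]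
    unfolding S_def[abs_def] \<mu>_def variance_of_def by (simp_all add: sqrt)
  define V where "V = variance_of arr_law + 1 + (\<Sum>i\<in>UNIV. variance_of (srv_law i) + 1)"
  have V: "V \<ge> 0" unfolding V_def variance_of_def
    by (intro add_nonneg_nonneg sum_nonneg Bochner_Integration.integral_nonneg) simp_all
  have d_int: "integrable M d"
    unfolding d_def[abs_def] using A_exp S_exp by (intro Bochner_Integration.integrable_sum Bochner_Integration.integrable_add) auto
  have "expectation d = (\<Sum>g\<le>G. expectation (A g) + (\<Sum>i\<in>UNIV. expectation (S i g)))"
    unfolding d_def[abs_def] using A_exp S_exp by (simp add: Bochner_Integration.integral_sum Bochner_Integration.integral_add)
  also have "\<dots> \<le> (\<Sum>g\<le>G. (variance_of arr_law + 1) / 2 * G ^ 2 + (\<Sum>i\<in>UNIV. (variance_of (srv_law i) + 1) / 2 * G ^ 2))"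
    using A_exp S_exp by (intro sum_mono add_mono) auto
  also have "\<dots> = real (Suc G) * (V / 2 * G ^ 2)"
    by (simp add: V_def sum_distrib_right sum_divide_distrib add_divide_distrib distrib_right)
  also have "\<dots> \<le> (2 * real G) * (V / 2 * G ^ 2)"
    using G V by (intro mult_right_mono) auto
  finally have d_exp: "expectation d \<le> V * G ^ 3" by (simp add: power_numeral_reduce mult_ac)
  have D_int: "integrable M D" unfolding D_def[abs_def] using d_int by simp
  have "expectation D = 1 + 2 * expectation d + 2 * (\<rho> + sum \<mu> UNIV) * m"
    unfolding D_def[abs_def] using d_int by (simp add: prob_space)
  also have "\<dots> \<le> real (G ^ 3) + 2 * (V * G ^ 3) + 2 * (\<rho> + sum \<mu> UNIV) * m"
  proof -
    have "1 \<le> real (G ^ 3)" using G by (simp add: one_le_power)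
    then show ?thesis using d_exp by simp
  qed
  also have "\<dots> = fluctuation_const arr_law srv_law * G ^ 3"
    by (simp add: fluctuation_const_def V_def m_def \<rho>_def \<mu>_def algebra_simps)
  finally have "expectation D \<le> fluctuation_const arr_law srv_law * G ^ 3" .
  then show ?thesis
    by (intro exI[of _ D] conjI allI impI D_int D1 dev)
qed

abbreviation total :: "'n state \<Rightarrow> nat" where "total x \<equiv> (\<Sum>i\<in>UNIV. fst x i)"

lemma nn_integral_total_le:
  assumes h: "integrable M h" and le: "AE \<omega> in M. real (total (X t \<omega>)) \<le> h \<omega>"
  shows "(\<integral>\<^sup>+ \<omega>. of_nat (total (X t \<omega>)) \<partial>M) \<le> ennreal (expectation h)"
proof -
  have "(\<integral>\<^sup>+ \<omega>. of_nat (total (X t \<omega>)) \<partial>M) \<le> (\<integral>\<^sup>+ \<omega>. ennreal (h \<omega>) \<partial>M)"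
    using le by (intro nn_integral_mono_AE) (auto elim!: eventually_mono simp: ennreal_of_nat_eq_real_of_nat ennreal_leI)
  also have "\<dots> = ennreal (expectation h)"
  proof (rule nn_integral_eq_integral[OF h])
    show "AE \<omega> in M. 0 \<le> h \<omega>"
      using le by (rule eventually_mono) (rule order_trans[OF of_nat_0_le_iff])
  qed
  finally show ?thesis .
qed

text \<open>
  Means of the two pathwise bounds for the whole system: no initial state leads to more than a small rise, and a state
  with some queue above \<open>G ^ 4 * smax\<close>, which therefore stays busy, leads to a fall.
\<close>

lemma total_bounds:
  fixes G :: nat and \<delta> \<epsilon> :: real
  assumes f: "splitting_rule f" and start: "AE \<omega> in M. X 0 \<omega> = x"
    and arr: "integrable (measure_pmf arr_law) (\<lambda>k. real k)" "integrable (measure_pmf arr_law) (\<lambda>k. (real k)\<^sup>2)"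
    and srv: "\<And>i. set_pmf (srv_law i) \<subseteq> {1..smax}" and G: "G > 0" and \<delta>: "\<delta> > 0"
    and \<epsilon>: "0 \<le> \<epsilon>" "\<epsilon> \<le> 1" "measure_pmf.expectation arr_law (\<lambda>k. real k) + \<epsilon>
      \<le> (\<Sum>i\<in>UNIV. measure_pmf.expectation (srv_law i) (\<lambda>k. real k))"
  defines "\<rho> \<equiv> measure_pmf.expectation arr_law (\<lambda>k. real k)"
    and "F \<equiv> fluctuation_const arr_law srv_law * G ^ 3"
  shows "(\<integral>\<^sup>+ \<omega>. of_nat (total (X (G ^ 4) \<omega>)) \<partial>M)
      \<le> ennreal (total x + \<delta> * G ^ 4 + burst_const \<rho> smax CARD('n) \<delta> * F)" (is ?all)
    and "total x > CARD('n) * (G ^ 4 * smax) \<Longrightarrow> (\<integral>\<^sup>+ \<omega>. of_nat (total (X (G ^ 4) \<omega>)) \<partial>M)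
      \<le> ennreal (total x + (\<delta> - \<epsilon>) * G ^ 4
          + (burst_const \<rho> smax (CARD('n) - 1) \<delta> + 2 + CARD('n) + CARD('n) * smax) * F)" (is "_ \<Longrightarrow> ?large")
proof -
  define \<mu> where "\<mu> i = measure_pmf.expectation (srv_law i) (\<lambda>k. real k)" for i
  obtain D where D: "integrable M D" "\<And>\<omega>. D \<omega> \<ge> 1" "expectation D \<le> F"
    and dev: "\<And>\<omega> u v. u \<le> v \<Longrightarrow> v \<le> G ^ 4 \<Longrightarrow>
      (\<Sum>t\<in>{u<..v}. real (a t \<omega>)) \<le> \<rho> * real (v - u) + D \<omega> \<and>
      (\<forall>i. \<mu> i * real (v - u) - D \<omega> \<le> (\<Sum>t\<in>{u<..v}. real (s i t \<omega>)))"
    using fluctuation_bound[OF arr srv G] unfolding \<rho>_def F_def \<mu>_def by blast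
  have \<rho>: "\<rho> \<ge> 0" unfolding \<rho>_def by (rule Bochner_Integration.integral_nonneg) simp
  have \<mu>: "\<mu> i \<ge> 1" for i unfolding \<mu>_def by (rule service_mean(3)[OF srv])
  have \<mu>0: "\<mu> i \<ge> 0" and \<mu>\<epsilon>: "\<mu> i \<ge> \<epsilon>" for i using \<mu>[of i] \<epsilon> by linarith+
  have load: "\<rho> + \<epsilon> \<le> sum \<mu> UNIV" using \<epsilon>(3) by (simp add: \<rho>_def \<mu>_def)
  define C1 where "C1 = burst_const \<rho> smax CARD('n) \<delta>"
  define C2 where "C2 = burst_const \<rho> smax (CARD('n) - 1) \<delta> + 2 + CARD('n) + CARD('n) * smax"
  have C: "C1 \<ge> 0" "C2 \<ge> 0" using burst_const_nonneg[OF \<rho> \<delta>] by (simp_all add: C1_def C2_def)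
  have path: "AE \<omega> in M. real (total (X (G ^ 4) \<omega>)) \<le> total x + \<delta> * G ^ 4 + C1 * D \<omega> \<and>
     (total x > CARD('n) * (G ^ 4 * smax) \<longrightarrow> real (total (X (G ^ 4) \<omega>)) \<le> total x + (\<delta> - \<epsilon>) * G ^ 4 + C2 * D \<omega>)"
    using AE_queue_path[OF f srv] start
  proof eventually_elim
    case (elim \<omega>)
    interpret queue_path "\<lambda>t. Q t \<omega>" "\<lambda>t. LI t \<omega>" "\<lambda>t. a t \<omega>"
      "\<lambda>t. routed f (Q (t - 1) \<omega>) (LI t \<omega>) (a t \<omega>) (B t \<omega>)" "\<lambda>t i. s i t \<omega>" smax
      by (rule elim(1))
    have d: "deviation_le \<rho> \<mu> (D \<omega>) 0 (G ^ 4)"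
      unfolding deviation_le_def using dev by blast
    have w: "work UNIV t = real (total (X t \<omega>))" for t
      by (simp add: work_def)
    have x: "total (X 0 \<omega>) = total x" using elim(2) by simp
    have A: "work UNIV (G ^ 4) \<le> work UNIV 0 + \<delta> * real (G ^ 4) + C1 * D \<omega>"
      unfolding C1_def by (rule total_work_bound[OF d D(2) \<delta> \<rho> \<mu>0]) (use load \<epsilon>(1) in linarith)
    have B: "work UNIV (G ^ 4) \<le> work UNIV 0 + (\<delta> - \<epsilon>) * real (G ^ 4) + C2 * D \<omega>"
      if "total x > CARD('n) * (G ^ 4 * smax)"
      unfolding C2_def
      by (rule total_work_drift[OF d D(2) \<delta> \<rho> \<mu>\<epsilon> \<epsilon>(1) load]) (use that x in simp)
    show ?case using A B unfolding w x by simp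
  qed
  have "(\<integral>\<^sup>+ \<omega>. of_nat (total (X (G ^ 4) \<omega>)) \<partial>M) \<le> ennreal (expectation (\<lambda>\<omega>. total x + \<delta> * G ^ 4 + C1 * D \<omega>))"
    by (rule nn_integral_total_le) (use path D(1) in \<open>auto elim: eventually_mono\<close>)
  also have "\<dots> \<le> ennreal (total x + \<delta> * G ^ 4 + C1 * F)"
    using D(1,3) C by (intro ennreal_leI) (simp add: prob_space mult_left_mono)
  finally show ?all by (simp add: C1_def)
  assume large: "total x > CARD('n) * (G ^ 4 * smax)"
  have "(\<integral>\<^sup>+ \<omega>. of_nat (total (X (G ^ 4) \<omega>)) \<partial>M) \<le> ennreal (expectation (\<lambda>\<omega>. total x + (\<delta> - \<epsilon>) * G ^ 4 + C2 * D \<omega>))"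
    by (rule nn_integral_total_le) (use path D(1) large in \<open>auto elim: eventually_mono\<close>)
  also have "\<dots> \<le> ennreal (total x + (\<delta> - \<epsilon>) * G ^ 4 + C2 * F)"
    using D(1,3) C by (intro ennreal_leI) (simp add: prob_space mult_left_mono)
  finally show ?large by (simp add: C2_def)
qed

lemma total_finite:
  assumes f: "splitting_rule f" and start: "AE \<omega> in M. X 0 \<omega> = x"
    and arr: "integrable (measure_pmf arr_law) (\<lambda>k. real k)"
    and srv: "\<And>i. set_pmf (srv_law i) \<subseteq> {1..smax}"
  shows "(\<integral>\<^sup>+ \<omega>. of_nat (total (X t \<omega>)) \<partial>M) < \<infinity>"
proof -
  have a_int: "integrable M (\<lambda>\<omega>. real (a u \<omega>))" if "u \<ge> 1" for u
    using arr unfolding arrivals_iid(2)[OF that, symmetric]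
    by (subst (asm) integrable_distr_eq) (auto intro: driving_measurable(1)[OF that])
  have "AE \<omega> in M. real (total (X t \<omega>)) \<le> total x + (\<Sum>u\<in>{0<..t}. real (a u \<omega>))"
    using AE_queue_path[OF f srv] start
  proof eventually_elim
    case (elim \<omega>)
    interpret queue_path "\<lambda>t. Q t \<omega>" "\<lambda>t. LI t \<omega>" "\<lambda>t. a t \<omega>"
      "\<lambda>t. routed f (Q (t - 1) \<omega>) (LI t \<omega>) (a t \<omega>) (B t \<omega>)" "\<lambda>t i. s i t \<omega>" smax
      by (rule elim(1))
    have x: "total (X 0 \<omega>) = total x" using elim(2) by simp
    show ?case unfolding x[symmetric] using work_growth[OF confined_UNIV, of 0 t] by (simp add: work_def)
  qed
  then have "(\<integral>\<^sup>+ \<omega>. of_nat (total (X t \<omega>)) \<partial>M) \<le> ennreal (expectation (\<lambda>\<omega>. total x + (\<Sum>u\<in>{0<..t}. real (a u \<omega>))))"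
    by (intro nn_integral_total_le Bochner_Integration.integrable_add Bochner_Integration.integrable_sum a_int) simp_all
  then show ?thesis by (rule le_less_trans) simp
qed

text \<open>
  A slot without arrivals has positive probability, and every capacity is at least 1.
\<close>

lemma queue_decreases_possible:
  assumes f: "splitting_rule f" and start: "AE \<omega> in M. X 0 \<omega> = x" and arr0: "pmf arr_law 0 > 0"
    and srv: "\<And>i. set_pmf (srv_law i) \<subseteq> {1..smax}"
  shows "prob {\<omega> \<in> space M. X 1 \<omega> \<in> {y. \<forall>i. fst y i \<le> fst x i - 1}} > 0"
proof -
  let ?A = "a 1 -` {0} \<inter> space M"
  let ?E = "X 1 -` {y. \<forall>i. fst y i \<le> fst x i - 1} \<inter> space M"
  have "prob ?A = pmf arr_law 0"
    using arrivals_iid(2)[of 1] measure_distr[OF driving_measurable(1)[of 1], of "{0}"]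
    by (simp add: measure_pmf_single)
  moreover have "prob ?A \<le> prob ?E"
  proof (rule finite_measure_mono_AE)
    show "?E \<in> sets M" by (rule measurable_sets[OF X_measurable[OF f]]) simp
    show "AE \<omega> in M. \<omega> \<in> ?A \<longrightarrow> \<omega> \<in> ?E"
      using AE_queue_path[OF f srv] start service_range[OF srv]
    proof eventually_elim
      case (elim \<omega>)
      interpret queue_path "\<lambda>t. Q t \<omega>" "\<lambda>t. LI t \<omega>" "\<lambda>t. a t \<omega>"
        "\<lambda>t. routed f (Q (t - 1) \<omega>) (LI t \<omega>) (a t \<omega>) (B t \<omega>)" "\<lambda>t i. s i t \<omega>" smax
        by (rule elim(1))
      have "Q 1 \<omega> i \<le> fst x i - 1" if "a 1 \<omega> = 0" for i
      proof -
        have "routed f (Q 0 \<omega>) (LI 1 \<omega>) (a 1 \<omega>) (B 1 \<omega>) i = 0"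
          using sum_r[of 0] that by simp
        then have "Q 1 \<omega> i = Q 0 \<omega> i - s i 1 \<omega>" using q_Suc[of 0 i] by simp
        moreover have "s i 1 \<omega> \<ge> 1" using elim(3) by auto
        moreover have "Q 0 \<omega> = fst x" using elim(2) by auto
        ultimately show ?thesis by simp
      qed
      then show ?case by simp
    qed
  qed
  moreover have "?E = {\<omega> \<in> space M. X 1 \<omega> \<in> {y. \<forall>i. fst y i \<le> fst x i - 1}}" by auto
  ultimately show ?thesis using arr0 by simp
qed

text \<open>
  When all servers are idle, the last idle server is drawn from all of them, so that every choice is possible.
\<close>

lemma empty_to_empty_possible:
  assumes f: "splitting_rule f" and start: "AE \<omega> in M. X 0 \<omega> = ((\<lambda>_. 0), l)" and arr0: "pmf arr_law 0 > 0"
  shows "prob {\<omega> \<in> space M. X 1 \<omega> = ((\<lambda>_. 0), j)} > 0"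
proof -
  define Z :: "nat \<Rightarrow> 'n state set" where "Z u = {((\<lambda>_. 0), l)}" for u
  have spl: "measure spl_law UNIV = 1"
    using splitting_iid(2)[of 1] measure_distr[OF driving_measurable(3)[of 1], of UNIV] by (simp add: prob_space)
  have "\<forall>i. \<exists>k. k \<in> set_pmf (srv_law i)" using set_pmf_not_empty by fastforce
  then obtain v where v: "v i \<in> set_pmf (srv_law i)" for i by metis
  have idle: "idle ((\<lambda>_. 0) :: 'n \<Rightarrow> nat) = UNIV" by (simp add: idle_def)
  have X0: "X 0 -` {((\<lambda>_. 0), l)} \<inter> space M \<in> sets M" by (rule measurable_sets[OF X_measurable[OF f]]) simp
  have hist: "{\<omega> \<in> space M. history 0 Z \<omega>} = X 0 -` {((\<lambda>_. 0), l)} \<inter> space M"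
    by (auto simp: Z_def)
  have "prob (X 0 -` {((\<lambda>_. 0), l)} \<inter> space M) = 1"
    using start by (intro prob_eq_1[THEN iffD2] X0) (auto elim: eventually_mono[OF eventually_conj[OF _ AE_space]])
  then have "prob {\<omega> \<in> space M. history 0 Z \<omega> \<and> \<xi> (Suc 0) \<omega> = j} = pmf (pmf_of_set UNIV) j"
    using last_idle_uniform[OF f, of "\<lambda>_. 0" Z 0 j] hist idle by (simp add: Z_def)
  moreover have "pmf (pmf_of_set (UNIV :: 'n set)) j > 0" by simp
  moreover have "prob {\<omega> \<in> space M. (history 0 Z \<omega> \<and> \<xi> (Suc 0) \<omega> = j) \<and>
           (a (Suc 0) \<omega> = 0 \<and> (\<forall>i. s i (Suc 0) \<omega> = v i) \<and> B (Suc 0) \<omega> \<in> UNIV)}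
    = prob {\<omega> \<in> space M. history 0 Z \<omega> \<and> \<xi> (Suc 0) \<omega> = j} *
      (pmf arr_law 0 * (\<Prod>i\<in>UNIV. pmf (srv_law i) (v i)) * measure spl_law UNIV)"
    by (rule slot_independent_of_history[OF f]) simp
  moreover have "(\<Prod>i\<in>UNIV. pmf (srv_law i) (v i)) > 0"
    using v by (intro prod_pos) (auto simp: pmf_positive)
  ultimately have "0 < prob {\<omega> \<in> space M. (history 0 Z \<omega> \<and> \<xi> (Suc 0) \<omega> = j) \<and>
           (a (Suc 0) \<omega> = 0 \<and> (\<forall>i. s i (Suc 0) \<omega> = v i) \<and> B (Suc 0) \<omega> \<in> UNIV)}"
    using arr0 spl by simp
  also have "\<dots> \<le> prob (X 1 -` {((\<lambda>_. 0), j)} \<inter> space M)"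
  proof (rule finite_measure_mono)
    have f0: "f q 0 b i = 0" for q b i
    proof -
      have "(\<Sum>i\<in>UNIV. f q 0 b i) = 0" using f by (simp add: splitting_rule_def)
      then show ?thesis by simp
    qed
    show "{\<omega> \<in> space M. (history 0 Z \<omega> \<and> \<xi> (Suc 0) \<omega> = j) \<and>
           (a (Suc 0) \<omega> = 0 \<and> (\<forall>i. s i (Suc 0) \<omega> = v i) \<and> B (Suc 0) \<omega> \<in> UNIV)}
       \<subseteq> X 1 -` {((\<lambda>_. 0), j)} \<inter> space M"
    proof safe
      fix \<omega> assume \<omega>: "\<omega> \<in> space M" and "history 0 Z \<omega>" and j: "j = \<xi> (Suc 0) \<omega>" and a: "a (Suc 0) \<omega> = 0"
      then have Q0: "Q 0 \<omega> = (\<lambda>_. 0)" by (simp add: Z_def)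
      have "LI (Suc 0) \<omega> = \<xi> (Suc 0) \<omega>" using LI_Suc[OF \<omega>, of 0] by (simp add: Q0 idle)
      moreover have "Q (Suc 0) \<omega> i = 0" for i
        using Q_Suc[OF \<omega>, of 0 i] a by (simp add: Q0 idle routed_def f0)
      ultimately show "\<omega> \<in> X 1 -` {((\<lambda>_. 0), \<xi> (Suc 0) \<omega>)}" by (simp add: fun_eq_iff)
    qed
    show "X 1 -` {((\<lambda>_. 0), j)} \<inter> space M \<in> sets M" by (rule measurable_sets[OF X_measurable[OF f]]) simp
  qed
  also have "X 1 -` {((\<lambda>_. 0), j)} \<inter> space M = {\<omega> \<in> space M. X 1 \<omega> = ((\<lambda>_. 0), j)}" by auto
  finally show ?thesis .
qed

end

section \<open>Ergodicity\<close>

text \<open>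
  The transition probabilities found from the innovation law are the same for all initial states and times; with
  the initial state \<open>x\<close> and the first step they are seen to be the law of the state at time 1 under \<open>P x\<close>.
\<close>

lemma chain_is_markov_process:
  fixes P :: "'n::finite state \<Rightarrow> 'w measure"
  assumes f: "splitting_rule f"
    and chain: "\<And>\<alpha>. pi_split_chain (P \<alpha>) arr_law srv_law spl_law f first a s B \<xi> Q LI"
    and start: "\<And>\<alpha>. AE \<omega> in P \<alpha>. (Q 0 \<omega>, LI 0 \<omega>) = \<alpha>"
  shows "\<exists>K. markov_process K P (\<lambda>t \<omega>. (Q t \<omega>, LI t \<omega>))"
proof -
  let ?X = "\<lambda>t \<omega>. (Q t \<omega>, LI t \<omega>)"
  define \<kappa> where "\<kappa> = (\<lambda>x y. \<integral>\<^sup>+ z. ennreal (innovation_weight arr_law srv_law spl_law f first x z)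
     * indicator {z. next_state x z = y} z \<partial>count_space UNIV)"
  have prob: "prob_space (P x)" for x using chain[of x] by (simp add: pi_split_chain_def)
  have meas: "?X t \<in> measurable (P x) (count_space UNIV)" for t x
    using pi_split_chain.X_measurable[OF chain f] .
  have step: "emeasure (P x) {\<omega> \<in> space (P x). (\<forall>u\<le>t. ?X u \<omega> \<in> Z u) \<and> ?X (Suc t) \<omega> = y}
      = emeasure (P x) {\<omega> \<in> space (P x). \<forall>u\<le>t. ?X u \<omega> \<in> Z u} * \<kappa> z y" if "Z t \<subseteq> {z}" for x t Z y z
    unfolding \<kappa>_def
    using pi_split_chain.history_step[where Z=Z and t=t and x=z and y=y, OF chain f that]
    unfolding pi_split_chain.transition_prob_def[OF chain] .
  have "\<forall>x. \<exists>p. \<forall>y. ennreal (pmf p y) = emeasure (P x) {\<omega> \<in> space (P x). ?X 1 \<omega> = y}"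
    using prob_space_pmf_exists[OF prob meas] by blast
  then obtain K where K: "ennreal (pmf (K x) y) = emeasure (P x) {\<omega> \<in> space (P x). ?X 1 \<omega> = y}" for x y
    by metis
  have K_\<kappa>: "ennreal (pmf (K x) y) = \<kappa> x y" for x y
  proof -
    have sets: "?X t -` A \<inter> space (P x) \<in> sets (P x)" for t A by (rule measurable_sets[OF meas]) simp
    have "emeasure (P x) {\<omega> \<in> space (P x). ?X 1 \<omega> = y}
        = emeasure (P x) {\<omega> \<in> space (P x). (\<forall>u\<le>0. ?X u \<omega> \<in> {x}) \<and> ?X (Suc 0) \<omega> = y}"
    proof (rule emeasure_eq_AE)
      show "AE \<omega> in P x. (\<omega> \<in> {\<omega> \<in> space (P x). ?X 1 \<omega> = y})
          = (\<omega> \<in> {\<omega> \<in> space (P x). (\<forall>u\<le>0. ?X u \<omega> \<in> {x}) \<and> ?X (Suc 0) \<omega> = y})"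
        using start[of x] by (rule eventually_mono) simp
      show "{\<omega> \<in> space (P x). ?X 1 \<omega> = y} \<in> sets (P x)"
        using sets[of 1 "{y}"] by (rule back_subst[of "\<lambda>S. S \<in> _"]) auto
      have "(?X 0 -` {x} \<inter> space (P x)) \<inter> (?X (Suc 0) -` {y} \<inter> space (P x)) \<in> sets (P x)"
        by (intro sets.Int sets)
      then show "{\<omega> \<in> space (P x). (\<forall>u\<le>0. ?X u \<omega> \<in> {x}) \<and> ?X (Suc 0) \<omega> = y} \<in> sets (P x)"
        by (rule back_subst[of "\<lambda>S. S \<in> _"]) auto
    qed
    also have "\<dots> = emeasure (P x) {\<omega> \<in> space (P x). \<forall>u\<le>0. ?X u \<omega> \<in> {x}} * \<kappa> x y"
      by (rule step[where Z="\<lambda>_. {x}"]) simp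
    also have "emeasure (P x) {\<omega> \<in> space (P x). \<forall>u\<le>0. ?X u \<omega> \<in> {x}} = 1"
    proof (rule prob_space.emeasure_eq_1_AE[OF prob])
      show "{\<omega> \<in> space (P x). \<forall>u\<le>0. ?X u \<omega> \<in> {x}} \<in> sets (P x)"
        using sets[of 0 "{x}"] by (rule back_subst[of "\<lambda>S. S \<in> _"]) auto
      show "AE \<omega> in P x. \<omega> \<in> {\<omega> \<in> space (P x). \<forall>u\<le>0. ?X u \<omega> \<in> {x}}"
        using start[of x] AE_space by eventually_elim simp
    qed
    finally show ?thesis using K by simp
  qed
  have "markov_process K P ?X"
  proof (rule markov_process.intro)
    fix x t Z y
    let ?H = "\<lambda>\<omega>. \<forall>u\<le>t. ?X u \<omega> \<in> Z u"
    show "prob_space (P x)" by (rule prob)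
    show "?X t \<in> measurable (P x) (count_space UNIV)" by (rule meas)
    show "AE \<omega> in P x. ?X 0 \<omega> = x" by (rule start)
    have H: "{\<omega> \<in> space (P x). \<forall>u\<le>t. ?X u \<omega> \<in> Z' u} \<in> sets (P x)" for Z'
      using pi_split_chain.history_sets[OF chain meas refl] .
    have "{\<omega> \<in> space (P x). ?H \<omega>} \<inter> (?X (Suc t) -` {y} \<inter> space (P x)) \<in> sets (P x)"
      by (intro sets.Int H measurable_sets[OF meas]) simp
    then have HX: "{\<omega> \<in> space (P x). ?H \<omega> \<and> ?X (Suc t) \<omega> = y} \<in> sets (P x)"
      by (rule back_subst[of "\<lambda>S. S \<in> _"]) blast
    have ind: "indicator {\<omega>. ?H \<omega>} \<in> borel_measurable (P x)"
      using borel_measurable_indicator[OF H[of Z]]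
      by (rule measurable_cong[THEN iffD1, rotated]) (simp add: indicator_def)
    have ind_z: "(\<lambda>\<omega>. indicator {\<omega>. ?H \<omega>} \<omega> * indicator {z} (?X t \<omega>) :: ennreal) \<in> borel_measurable (P x)" for z
      by (rule borel_measurable_times_ennreal[OF ind measurable_compose[OF meas]]) simp
    define Z' where "Z' z u = (if u = t then Z t \<inter> {z} else Z u)" for z u
    have Z': "{\<omega> \<in> space (P x). ?H \<omega> \<and> ?X t \<omega> = z} = {\<omega> \<in> space (P x). \<forall>u\<le>t. ?X u \<omega> \<in> Z' z u}"
      "{\<omega> \<in> space (P x). (?H \<omega> \<and> ?X (Suc t) \<omega> = y) \<and> ?X t \<omega> = z}
        = {\<omega> \<in> space (P x). (\<forall>u\<le>t. ?X u \<omega> \<in> Z' z u) \<and> ?X (Suc t) \<omega> = y}" for z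
    proof -
      have "(\<forall>u\<le>t. ?X u \<omega> \<in> Z' z u) \<longleftrightarrow> ?H \<omega> \<and> ?X t \<omega> = z" for \<omega>
      proof
        assume *: "\<forall>u\<le>t. ?X u \<omega> \<in> Z' z u"
        show "?H \<omega> \<and> ?X t \<omega> = z"
        proof (intro conjI allI impI)
          fix u assume "u \<le> t"
          with * have "?X u \<omega> \<in> Z' z u" by blast
          then show "?X u \<omega> \<in> Z u" by (auto simp: Z'_def split: if_splits)
        next
          from * have "?X t \<omega> \<in> Z' z t" by blast
          then show "?X t \<omega> = z" by (simp add: Z'_def)
        qed
      qed (auto simp: Z'_def)
      then show "{\<omega> \<in> space (P x). ?H \<omega> \<and> ?X t \<omega> = z} = {\<omega> \<in> space (P x). \<forall>u\<le>t. ?X u \<omega> \<in> Z' z u}"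
        "{\<omega> \<in> space (P x). (?H \<omega> \<and> ?X (Suc t) \<omega> = y) \<and> ?X t \<omega> = z}
          = {\<omega> \<in> space (P x). (\<forall>u\<le>t. ?X u \<omega> \<in> Z' z u) \<and> ?X (Suc t) \<omega> = y}"
        by blast+
    qed
    have sub: "Z' z t \<subseteq> {z}" for z by (simp add: Z'_def)
    have "emeasure (P x) {\<omega> \<in> space (P x). ?H \<omega> \<and> ?X (Suc t) \<omega> = y}
        = (\<integral>\<^sup>+ z. emeasure (P x) {\<omega> \<in> space (P x). (?H \<omega> \<and> ?X (Suc t) \<omega> = y) \<and> ?X t \<omega> = z} \<partial>count_space UNIV)"
      by (rule emeasure_split_countable[OF meas HX])
    also have "\<dots> = (\<integral>\<^sup>+ z. emeasure (P x) {\<omega> \<in> space (P x). ?H \<omega> \<and> ?X t \<omega> = z} * ennreal (pmf (K z) y) \<partial>count_space UNIV)"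
      unfolding Z' K_\<kappa> by (intro nn_integral_cong step sub)
    also have "\<dots> = (\<integral>\<^sup>+ z. (\<integral>\<^sup>+ \<omega>. indicator {\<omega>. ?H \<omega>} \<omega> * indicator {z} (?X t \<omega>) * ennreal (pmf (K z) y) \<partial>P x) \<partial>count_space UNIV)"
    proof (rule nn_integral_cong)
      fix z
      have "(\<integral>\<^sup>+ \<omega>. indicator {\<omega>. ?H \<omega>} \<omega> * indicator {z} (?X t \<omega>) \<partial>P x)
          = (\<integral>\<^sup>+ \<omega>. indicator {\<omega> \<in> space (P x). ?H \<omega> \<and> ?X t \<omega> = z} \<omega> \<partial>P x)"
        by (rule nn_integral_cong) (auto simp: indicator_def)
      also have "\<dots> = emeasure (P x) {\<omega> \<in> space (P x). ?H \<omega> \<and> ?X t \<omega> = z}"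
        unfolding Z' by (rule nn_integral_indicator[OF H])
      finally show "emeasure (P x) {\<omega> \<in> space (P x). ?H \<omega> \<and> ?X t \<omega> = z} * ennreal (pmf (K z) y)
          = (\<integral>\<^sup>+ \<omega>. indicator {\<omega>. ?H \<omega>} \<omega> * indicator {z} (?X t \<omega>) * ennreal (pmf (K z) y) \<partial>P x)"
        unfolding nn_integral_multc[OF ind_z] by (rule arg_cong[where f="\<lambda>e. e * ennreal (pmf (K z) y)", OF sym])
    qed
    also have "\<dots> = (\<integral>\<^sup>+ \<omega>. (\<integral>\<^sup>+ z. indicator {\<omega>. ?H \<omega>} \<omega> * indicator {z} (?X t \<omega>) * ennreal (pmf (K z) y) \<partial>count_space UNIV) \<partial>P x)"
      by (rule nn_integral_count_space_nn_integral[symmetric])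
         (rule countableI_type, rule borel_measurable_times_ennreal[OF ind_z measurable_const], simp)
    also have "\<dots> = (\<integral>\<^sup>+ \<omega>. indicator {\<omega>. ?H \<omega>} \<omega> * ennreal (pmf (K (?X t \<omega>)) y) \<partial>P x)"
    proof (rule nn_integral_cong)
      fix \<omega>
      have "(\<integral>\<^sup>+ z. indicator {\<omega>. ?H \<omega>} \<omega> * indicator {z} (?X t \<omega>) * ennreal (pmf (K z) y) \<partial>count_space UNIV)
         = (\<integral>\<^sup>+ z. indicator {\<omega>. ?H \<omega>} \<omega> * ennreal (pmf (K z) y) * indicator {?X t \<omega>} z \<partial>count_space UNIV)"
        by (rule nn_integral_cong) (auto simp: indicator_def)
      then show "(\<integral>\<^sup>+ z. indicator {\<omega>. ?H \<omega>} \<omega> * indicator {z} (?X t \<omega>) * ennreal (pmf (K z) y) \<partial>count_space UNIV)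
         = indicator {\<omega>. ?H \<omega>} \<omega> * ennreal (pmf (K (?X t \<omega>)) y)"
        by simp
    qed
    finally show "emeasure (P x) {\<omega> \<in> space (P x). ?H \<omega> \<and> ?X (Suc t) \<omega> = y}
        = (\<integral>\<^sup>+ \<omega>. indicator {\<omega>. ?H \<omega>} \<omega> * ennreal (pmf (K (?X t \<omega>)) y) \<partial>P x)" .
  qed
  then show ?thesis by blast
qed

theorem theorem3p4:
  fixes arr_law :: "nat pmf" and srv_law :: "'n::finite \<Rightarrow> nat pmf" and spl_law :: "real measure"
    and smax :: nat
    and f :: "('n \<Rightarrow> nat) \<Rightarrow> nat \<Rightarrow> real \<Rightarrow> ('n \<Rightarrow> nat)" and first :: 'n
    and P :: "'n state \<Rightarrow> 'w measure"
    and a :: "nat \<Rightarrow> 'w \<Rightarrow> nat" and s :: "'n \<Rightarrow> nat \<Rightarrow> 'w \<Rightarrow> nat" and B :: "nat \<Rightarrow> 'w \<Rightarrow> real"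
    and \<xi> :: "nat \<Rightarrow> 'w \<Rightarrow> 'n"
    and Q :: "nat \<Rightarrow> 'w \<Rightarrow> 'n \<Rightarrow> nat" and LI :: "nat \<Rightarrow> 'w \<Rightarrow> 'n"
  defines "X \<equiv> \<lambda>t \<omega>. (Q t \<omega>, LI t \<omega>)"
  defines "\<A> \<equiv> reachable_states P X"
  assumes arrival_zero: "pmf arr_law 0 > 0"
    and arrival_mean: "integrable (measure_pmf arr_law) (\<lambda>k. real k)"
    and arrival_variance: "integrable (measure_pmf arr_law) (\<lambda>k. (real k)\<^sup>2)"
    and service_bounds: "\<And>i. set_pmf (srv_law i) \<subseteq> {1..smax}"
    and splitting: "splitting_rule f"
    and chain: "\<And>\<alpha>. pi_split_chain (P \<alpha>) arr_law srv_law spl_law f first a s B \<xi> Q LI"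
    and start: "\<And>\<alpha>. AE \<omega> in P \<alpha>. X 0 \<omega> = \<alpha>"
    and load: "measure_pmf.expectation arr_law (\<lambda>k. real k)
                 < (\<Sum>i\<in>UNIV. measure_pmf.expectation (srv_law i) (\<lambda>k. real k))"
  shows "positive_recurrent P X \<A> \<and>
         (\<exists>!\<pi>. stationary_distribution P X \<A> \<pi>) \<and>
         (\<forall>\<pi>. stationary_distribution P X \<A> \<pi> \<longrightarrow>
            (\<forall>\<alpha>\<in>\<A>. \<forall>C\<subseteq>\<A>. (\<lambda>t. prob_at P X \<alpha> t C) \<longlonglongrightarrow> measure_pmf.prob \<pi> C))"
proof -
  define \<rho> where "\<rho> = measure_pmf.expectation arr_law (\<lambda>k. real k)"
  define \<mu> where "\<mu> = (\<Sum>i\<in>UNIV. measure_pmf.expectation (srv_law i) (\<lambda>k. real k))"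
  define F where "F = fluctuation_const arr_law srv_law"
  \<comment> \<open>the guaranteed rate of decrease; the bound 1 is below every mean capacity\<close>
  define \<epsilon> where "\<epsilon> = min 1 (\<mu> - \<rho>)"
  define \<delta> where "\<delta> = \<epsilon> / 8"
  define C where "C = max (burst_const \<rho> smax CARD('n) \<delta>)
    (burst_const \<rho> smax (CARD('n) - 1) \<delta> + 2 + CARD('n) + CARD('n) * smax)"
  \<comment> \<open>large enough for the mean deviation to contribute at most \<open>\<epsilon> * T / 8\<close> to either bound\<close>
  obtain G :: nat where G: "real G > max 0 (8 * (C * F) / \<epsilon>)" using reals_Archimedean2 by blast
  define T where "T = G ^ 4"
  define \<eta> where "\<eta> = \<epsilon> * T / 4"
  have \<epsilon>: "\<epsilon> > 0" "\<epsilon> \<le> 1" "\<rho> + \<epsilon> \<le> \<mu>" using load by (auto simp: \<epsilon>_def \<rho>_def \<mu>_def)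
  have G0: "G > 0" using G by simp
  have \<eta>: "\<eta> > 0" using \<epsilon> G0 by (simp add: \<eta>_def T_def)
  have F: "F \<ge> 0" unfolding F_def fluctuation_const_def variance_of_def
    by (intro add_nonneg_nonneg mult_nonneg_nonneg sum_nonneg Bochner_Integration.integral_nonneg) simp_all
  have noise: "c * (F * G ^ 3) \<le> \<epsilon> * T / 8" if "c \<le> C" for c
  proof -
    have "8 * (C * F) / \<epsilon> \<le> G" using G by simp
    then have "C * F \<le> \<epsilon> * G / 8" using \<epsilon> by (simp add: field_simps)
    then have "C * F * G ^ 3 \<le> \<epsilon> * G / 8 * G ^ 3" by (intro mult_right_mono) simp_all
    also have "\<dots> = \<epsilon> * T / 8" by (simp add: T_def power_numeral_reduce mult_ac)
    finally have "C * (F * G ^ 3) \<le> \<epsilon> * T / 8" by (simp add: mult.assoc)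
    moreover have "c * (F * G ^ 3) \<le> C * (F * G ^ 3)" using that F by (intro mult_right_mono) simp_all
    ultimately show ?thesis by linarith
  qed
  have start': "AE \<omega> in P \<alpha>. (Q 0 \<omega>, LI 0 \<omega>) = \<alpha>" for \<alpha> using start[of \<alpha>] by (simp add: X_def)
  define V :: "'n state \<Rightarrow> nat" where "V x = (\<Sum>i\<in>UNIV. fst x i)" for x
  note bounds = pi_split_chain.total_bounds[OF chain splitting start' arrival_mean arrival_variance service_bounds G0,
      where \<delta>=\<delta> and \<epsilon>=\<epsilon>, folded \<rho>_def \<mu>_def F_def V_def X_def T_def]
  obtain K where "markov_process K P X"
    unfolding X_def using chain_is_markov_process[OF splitting chain start'] by blast
  then interpret markov_process K P X .
  define c :: "'n state" where "c = ((\<lambda>_. 0), first)"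
  have one_step: "measure_pmf.prob (K x) A = measure (P x) {\<omega> \<in> space (P x). X 1 \<omega> \<in> A}" for x A
    using prob_at_eq[of x 1 A] unfolding One_nat_def kpow_1 by (simp add: prob_at_def)
  have empty_step: "((\<lambda>_. 0), j) \<in> set_pmf (K ((\<lambda>_. 0), l))" for j l
    using pi_split_chain.empty_to_empty_possible[OF chain splitting start' arrival_zero, of l j]
      one_step[of "((\<lambda>_. 0), l)" "{((\<lambda>_. 0), j)}"]
    by (simp add: X_def measure_pmf_single flip: pmf_positive_iff)
  have drain: "\<exists>y \<in> set_pmf (kpow K N x). \<forall>i. fst y i \<le> fst x i - N" for N x
  proof (induction N)
    case (Suc N)
    then obtain y where y: "y \<in> set_pmf (kpow K N x)" "\<And>i. fst y i \<le> fst x i - N" by blast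
    have "measure_pmf.prob (K y) {z. \<forall>i. fst z i \<le> fst y i - 1} > 0"
      using pi_split_chain.queue_decreases_possible[OF chain splitting start' arrival_zero service_bounds, of y]
        one_step[of y] by (simp add: X_def)
    then obtain z where z: "z \<in> set_pmf (K y)" "\<And>i. fst z i \<le> fst y i - 1"
      using measure_pmf_zero_iff[of "K y" "{z. \<forall>i. fst z i \<le> fst y i - 1}"] by fastforce
    have "z \<in> set_pmf (kpow K (Suc N) x)" unfolding kpow_Suc_right using y z by auto
    moreover have "fst z i \<le> fst x i - Suc N" for i using y(2)[of i] z(2)[of i] by linarith
    ultimately show ?case by blast
  qed simp
  have access: "\<exists>N\<^sub>0. \<forall>N\<ge>N\<^sub>0. c \<in> set_pmf (kpow K N x)" for x
  proof (intro exI allI impI)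
    fix N assume N: "N \<ge> Suc (Max (range (fst x)))"
    then obtain N' where N': "N = Suc N'" "Max (range (fst x)) \<le> N'" by (cases N) auto
    from drain obtain y where y: "y \<in> set_pmf (kpow K N' x)" "\<And>i. fst y i \<le> fst x i - N'" by blast
    have "fst y i = 0" for i
    proof -
      have "fst x i \<le> Max (range (fst x))" by (rule Max_ge) auto
      then show ?thesis using y(2)[of i] N'(2) by linarith
    qed
    then have "y = ((\<lambda>_. 0), snd y)" by (simp add: prod_eq_iff fun_eq_iff)
    then have "c \<in> set_pmf (K y)" using empty_step[of first "snd y"] by (simp add: c_def)
    then show "c \<in> set_pmf (kpow K N x)" unfolding N'(1) kpow_Suc_right using y(1) by auto
  qed
  have reach: "y \<in> \<A> \<longleftrightarrow> (\<exists>t. y \<in> set_pmf (kpow K t c))" for y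
  proof
    assume "y \<in> \<A>"
    then obtain i t where "y \<in> set_pmf (kpow K t ((\<lambda>_. 0), i))"
      unfolding \<A>_def reachable_states_def mem_Collect_eq prob_at_eq measure_pmf_single pmf_positive_iff by blast
    then have "y \<in> set_pmf (kpow K (Suc t) c)" using empty_step[of i first] by (auto simp: c_def)
    then show "\<exists>t. y \<in> set_pmf (kpow K t c)" by blast
  next
    assume "\<exists>t. y \<in> set_pmf (kpow K t c)"
    then show "y \<in> \<A>"
      unfolding \<A>_def reachable_states_def mem_Collect_eq prob_at_eq measure_pmf_single pmf_positive_iff c_def by blast
  qed
  show ?thesis
  proof (rule foster_lyapunov[where V=V and L="CARD('n) * (T * smax)" and \<eta>=\<eta> and T=T and c=c])
    show "finite {x. V x \<le> CARD('n) * (T * smax)}"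
    proof (rule finite_subset)
      show "{x. V x \<le> CARD('n) * (T * smax)} \<subseteq> (UNIV \<rightarrow>\<^sub>E {..CARD('n) * (T * smax)}) \<times> UNIV"
      proof
        fix x assume x: "x \<in> {x. V x \<le> CARD('n) * (T * smax)}"
        have "fst x i \<le> V x" for i unfolding V_def by (rule member_le_sum) auto
        then have "fst x i \<le> CARD('n) * (T * smax)" for i using x by (metis mem_Collect_eq order_trans)
        then show "x \<in> (UNIV \<rightarrow>\<^sub>E {..CARD('n) * (T * smax)}) \<times> UNIV" by (cases x) auto
      qed
    qed (intro finite_cartesian_product finite_PiE; simp)
    show "\<eta> > 0" by (rule \<eta>)
    show "(\<integral>\<^sup>+ \<omega>. of_nat (V (X T \<omega>)) \<partial>P x) \<le> of_nat (V x) + ennreal \<eta>" for x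
    proof -
      have "(\<integral>\<^sup>+ \<omega>. of_nat (V (X T \<omega>)) \<partial>P x)
          \<le> ennreal (V x + \<delta> * T + burst_const \<rho> smax CARD('n) \<delta> * (F * G ^ 3))"
        using bounds(1) \<epsilon> by (simp add: \<delta>_def X_def)
      also have "\<dots> \<le> ennreal (V x + \<eta>)"
        using noise[of "burst_const \<rho> smax CARD('n) \<delta>"]
        by (intro ennreal_leI) (simp add: C_def \<eta>_def \<delta>_def)
      also have "\<dots> = of_nat (V x) + ennreal \<eta>" using \<eta> by (simp add: ennreal_of_nat_eq_real_of_nat)
      finally show ?thesis .
    qed
    show "(\<integral>\<^sup>+ \<omega>. of_nat (V (X T \<omega>)) \<partial>P x) + ennreal (3 * \<eta>) \<le> of_nat (V x)"
      if large: "V x > CARD('n) * (T * smax)" for x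
    proof -
      let ?C = "burst_const \<rho> smax (CARD('n) - 1) \<delta> + 2 + CARD('n) + CARD('n) * smax"
      let ?R = "V x + (\<delta> - \<epsilon>) * T + ?C * (F * G ^ 3)"
      have R: "?R + 3 * \<eta> \<le> V x"
        using noise[of ?C] by (simp add: C_def \<eta>_def \<delta>_def algebra_simps)
      have "(\<integral>\<^sup>+ \<omega>. of_nat (V (X T \<omega>)) \<partial>P x) \<le> ennreal ?R"
        using bounds(2)[OF _ _ _ _ large] \<epsilon> by (simp add: \<delta>_def X_def)
      then have "(\<integral>\<^sup>+ \<omega>. of_nat (V (X T \<omega>)) \<partial>P x) + ennreal (3 * \<eta>) \<le> ennreal ?R + ennreal (3 * \<eta>)"
        by (rule add_right_mono)
      also have "\<dots> \<le> ennreal (V x)"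
      proof (cases "?R \<ge> 0")
        case True
        then show ?thesis using R \<eta> by (simp add: ennreal_leI flip: ennreal_plus)
      next
        case False
        \<comment> \<open>a negative bound is rounded up to 0; then the decrease must not exceed \<open>V x\<close> itself\<close>
        obtain k where "k \<in> set_pmf (srv_law undefined)" using set_pmf_not_empty by fastforce
        then have "smax \<ge> 1" using service_bounds[of undefined] by force
        then have "1 * (T * 1) \<le> CARD('n) * (T * smax)" by (intro mult_le_mono) (auto simp: Suc_le_eq)
        then have "T \<le> V x" using large unfolding mult_1 mult_1_right by linarith
        moreover have "3 * \<eta> \<le> T" using \<epsilon> mult_right_mono[of \<epsilon> 1 "real T"] by (simp add: \<eta>_def)
        ultimately have "3 * \<eta> \<le> V x" by linarith
        then show ?thesis using False by (simp add: ennreal_neg ennreal_leI)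
      qed
      finally show ?thesis by (simp add: ennreal_of_nat_eq_real_of_nat)
    qed
    show "(\<integral>\<^sup>+ \<omega>. of_nat (V (X t \<omega>)) \<partial>P x) < \<infinity>" for t x
      using pi_split_chain.total_finite[OF chain splitting start' arrival_mean service_bounds, of x t]
      by (simp add: V_def X_def)
    show "\<exists>N\<^sub>0. \<forall>N\<ge>N\<^sub>0. c \<in> set_pmf (kpow K N x)" for x by (rule access)
    show "y \<in> \<A> \<longleftrightarrow> (\<exists>t. y \<in> set_pmf (kpow K t c))" for y by (rule reach)
  qed
qed

end
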